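(* (Presentation for $S$.) (1) The $K$-algebra $S$ is generated by $\{p(A,B),u(I),\xi(J):(A,B)\in H_p,I\in H_u,J\in H_\xi\}$. (2) The ideal of relations among the generators $\{p(A,B),u(I),\xi(J):(A,B)\in H_p,I\in H_u,J\in H_\xi\}$, i.e. the kernel of the $K$-algebra map $K[X(A,B),Y(I),Z(J)]\to S$, $X(A,B)\mapsto p(A,B)$, $Y(I)\mapsto u(I)$, $Z(J)\mapsto\xi(J)$, is generated by the six types of relations (R1)-(R6) listed in the context.
   Context: Let $K$ be an algebraically closed field of arbitrary characteristic, $V=K^n$, $m,q>n$, $X=V^{\oplus m}\oplus(V^* )^{\oplus q}$, with points $(u_1,\dots,u_m,\xi_1,\dots,\xi_q)$, $\langle u_i,\xi_j\rangle=\xi_j(u_i)$. Fixing a basis of $V$, $X$ is identified with $M_{m,n}(K)\times M_{n,q}(K)$, a point being $(U,W)$ with $u_i$ the $i$-th row of $U$ and $\xi_j$ the $j$-th column of $W$. $I(r,k)$ is the set of strictly increasing $r$-tuples of elements of $\{1,\dots,k\}$. For $A\in I(r,k)$, $A'\in I(r',k)$ write $A\ge A'$ if $r\le r'$ and $a_j\ge a'_j$ for $1\le j\le r$. $H_u=I(n,m)$, $H_\xi=I(n,q)$, $H_p=\bigcup_{1\le r\le n}I(r,m)\times I(r,q)$; on $H_p$, $(A,B)\ge(A',B')$ iff $A\ge A'$ and $B\ge B'$. Functions on $X$: $p(A,B)=\det(\langle u_i,\xi_j\rangle)_{i\in A,j\in B}$ for $(A,B)\in H_p$, $p(\emptyset,\emptyset)=1$;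 $u(I)$, $I\in H_u$, is the $n$-minor of $U$ with rows $I$; $\xi(J)$, $J\in H_\xi$, is the $n$-minor of $W$ with columns $J$. $S$ is the $K$-subalgebra of $K[X]$ generated by all $p(A,B)$ ($(A,B)\in H_p$), $u(I)$, $\xi(J)$. The six types of relations (they hold in $K[X]$; coefficients in $K^*$): (R1) for $I\in H_u,J\in H_\xi$: $u(I)\xi(J)=p(I,J)$. (R2) for non-comparable $I,I'\in H_u$: $u(I)u(I')=\sum_r b_ru(I_r)u(I'_r)$, $I_r\ge$ both $I,I'$, $I'_r\le$ both $I,I'$. (R3) for non-comparable $J,J'\in H_\xi$: $\xi(J)\xi(J')=\sum_sc_s\xi(J_s)\xi(J'_s)$, $J_s\ge$ both $J,J'$, $J'_s\le$ both $J,J'$. (R4) for non-comparable $(A_1,A_2),(B_1,B_2)\in H_p$: $p(A_1,A_2)p(B_1,B_2)=\sum_ia_ip(C_{i1},C_{i2})p(D_{i1},D_{i2})$, $(D_{i1},D_{i2})\in H_p$, $(C_{i1},C_{i2})\in H_p\cup\{(\emptyset,\emptyset)\}$, and for $k=1,2$, $C_{ik}\ge$ both $A_k,B_k$, $D_{ik}\le$ both $A_k,B_k$ (with $\emptyset\ge$ everything). (R5) for $I\in H_u,(A,B)\in H_p$, $A\not\ge I$: $p(A,B)u(I)=\sum_td_tp(A_t,B_t)u(I_t)$, $A_t\ge$ both $A,I$, $I_t\le$ both $A,I$, $B_t\ge B$. (R6) for $J\in H_\xi,(A,B)\in H_p$, $B\not\ge J$: $p(A,B)\xi(J)=\sum_le_lp(A_l,B_l)\xi(J_l)$,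 $A_l\ge A$, $B_l\ge$ both $B,J$, $J_l\le$ both $B,J$. Each is read as an element of the polynomial ring with $p(\emptyset,\emptyset)$ replaced by $1$. *)

theory Defs
  imports
    "Jordan_Normal_Form.Determinant"
    "HOL-Algebra.Ideal"
    "HOL-Algebra.Generated_Rings"
    "HOL-Library.Poly_Mapping"
begin

section \<open>Polynomial rings\<close>

type_synonym ('x, 'a) mpoly = "('x \<Rightarrow>\<^sub>0 nat) \<Rightarrow>\<^sub>0 'a"

definition Const :: "'a::zero \<Rightarrow> ('x, 'a) mpoly" where
  "Const c = Poly_Mapping.single 0 c"

definition Var :: "'x \<Rightarrow> ('x, 'a::zero_neq_one) mpoly" where
  "Var x = Poly_Mapping.single (Poly_Mapping.single x 1) 1"

definition vars :: "('x, 'a::zero) mpoly \<Rightarrow> 'x set" where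
  "vars F = (\<Union>e\<in>Poly_Mapping.keys F. Poly_Mapping.keys e)"

definition poly_ring :: "'x set \<Rightarrow> ('x, 'a::comm_ring_1) mpoly ring" where
  "poly_ring V = \<lparr>carrier = {F. vars F \<subseteq> V}, mult = (*), one = 1, zero = 0, add = (+)\<rparr>"

text \<open>The homomorphism of algebras sending each variable \<open>x\<close> to \<open>g x\<close>.\<close>

definition poly_subst ::
    "('x \<Rightarrow> ('y, 'a::comm_ring_1) mpoly) \<Rightarrow> ('x, 'a) mpoly \<Rightarrow> ('y, 'a) mpoly" where
  "poly_subst g F =
     (\<Sum>e\<in>Poly_Mapping.keys F.
        Const (Poly_Mapping.lookup F e) * (\<Prod>x\<in>Poly_Mapping.keys e. g x ^ Poly_Mapping.lookup e x))"

text \<open>A subalgebra is a subring that contains the constants.\<close>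

definition generated_subalgebra ::
    "('x, 'a::comm_ring_1) mpoly ring \<Rightarrow> ('x, 'a) mpoly set \<Rightarrow> ('x, 'a) mpoly ring" where
  "generated_subalgebra R G = R\<lparr>carrier := generate_ring R (range Const \<union> G)\<rparr>"


section \<open>Index sets\<close>

text \<open>Increasing tuples are lists, and everything is indexed from \<open>0\<close>: \<open>{0..<k}\<close> replaces
  \<open>{1..k}\<close>.  The empty tuple is \<open>\<ge>\<close> every tuple.\<close>

definition I_set :: "nat \<Rightarrow> nat \<Rightarrow> nat list set" where
  "I_set r k = {A. length A = r \<and> sorted_wrt (<) A \<and> set A \<subseteq> {0..<k}}"

definition tuple_ge :: "nat list \<Rightarrow> nat list \<Rightarrow> bool" (infix \<open>\<succeq>\<close> 50) where
  "A \<succeq> A' \<longleftrightarrow> length A \<le> length A' \<and> (\<forall>j<length A. A ! j \<ge> A' ! j)"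

definition pair_ge :: "nat list \<times> nat list \<Rightarrow> nat list \<times> nat list \<Rightarrow> bool" (infix \<open>\<succeq>\<^sub>p\<close> 50) where
  "P \<succeq>\<^sub>p P' \<longleftrightarrow> fst P \<succeq> fst P' \<and> snd P \<succeq> snd P'"

definition H_u :: "nat \<Rightarrow> nat \<Rightarrow> nat list set" where
  "H_u n m = I_set n m"

definition H_xi :: "nat \<Rightarrow> nat \<Rightarrow> nat list set" where
  "H_xi n q = I_set n q"

definition H_p :: "nat \<Rightarrow> nat \<Rightarrow> nat \<Rightarrow> (nat list \<times> nat list) set" where
  "H_p n m q = (\<Union>r\<in>{1..n}. I_set r m \<times> I_set r q)"


section \<open>The functions \<open>p(A,B)\<close>, \<open>u(I)\<close>, \<open>\<xi>(J)\<close> and the algebra \<open>S\<close>\<close>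

text \<open>A point of \<open>X\<close> is a pair \<open>(U, W)\<close> in \<open>carrier_mat m n \<times> carrier_mat n q\<close>; the entry
  \<open>(i, j)\<close> of \<open>U * W\<close> is the value of the covector \<open>\<xi>\<^sub>j\<close> (column \<open>j\<close> of \<open>W\<close>) at the vector \<open>u\<^sub>i\<close>
  (row \<open>i\<close> of \<open>U\<close>).  The functions are defined over an arbitrary commutative ring: over \<open>K\<close> they
  give values at points, and at the generic point they give the elements of
  the coordinate ring \<open>K[X]\<close>.\<close>

definition minor :: "'a::comm_ring_1 mat \<Rightarrow> nat list \<Rightarrow> nat list \<Rightarrow> 'a" where
  "minor M A B = det (mat (length A) (length B) (\<lambda>(i, j). M $$ (A ! i, B ! j)))"

definition p_fun :: "nat list \<Rightarrow> nat list \<Rightarrow> 'a::comm_ring_1 mat \<times> 'a mat \<Rightarrow> 'a" where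
  "p_fun A B = (\<lambda>(U, W). minor (U * W) A B)"

definition u_fun :: "nat \<Rightarrow> nat list \<Rightarrow> 'a::comm_ring_1 mat \<times> 'a mat \<Rightarrow> 'a" where
  "u_fun n I = (\<lambda>(U, W). minor U I [0..<n])"

definition xi_fun :: "nat \<Rightarrow> nat list \<Rightarrow> 'a::comm_ring_1 mat \<times> 'a mat \<Rightarrow> 'a" where
  "xi_fun n J = (\<lambda>(U, W). minor W [0..<n] J)"

datatype coord = U_coord nat nat | W_coord nat nat

definition coords :: "nat \<Rightarrow> nat \<Rightarrow> nat \<Rightarrow> coord set" where
  "coords n m q = {U_coord i k | i k. i < m \<and> k < n} \<union> {W_coord k j | k j. k < n \<and> j < q}"

definition generic_point ::
    "nat \<Rightarrow> nat \<Rightarrow> nat \<Rightarrow> (coord, 'k::comm_ring_1) mpoly mat \<times> (coord, 'k) mpoly mat" where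
  "generic_point n m q =
     (mat m n (\<lambda>(i, k). Var (U_coord i k)), mat n q (\<lambda>(k, j). Var (W_coord k j)))"

text \<open>The coordinate ring of the affine space \<open>X\<close>.\<close>

definition KX :: "nat \<Rightarrow> nat \<Rightarrow> nat \<Rightarrow> (coord, 'k::comm_ring_1) mpoly ring" where
  "KX n m q = poly_ring (coords n m q)"

datatype gen = X "nat list" "nat list" | Y "nat list" | Z "nat list"

definition gens :: "nat \<Rightarrow> nat \<Rightarrow> nat \<Rightarrow> gen set" where
  "gens n m q = {X A B | A B. (A, B) \<in> H_p n m q} \<union> Y ` H_u n m \<union> Z ` H_xi n q"

fun gen_fun :: "nat \<Rightarrow> nat \<Rightarrow> nat \<Rightarrow> gen \<Rightarrow> (coord, 'k::comm_ring_1) mpoly" where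
  "gen_fun n m q (X A B) = p_fun A B (generic_point n m q)"
| "gen_fun n m q (Y I) = u_fun n I (generic_point n m q)"
| "gen_fun n m q (Z J) = xi_fun n J (generic_point n m q)"

definition S_alg :: "nat \<Rightarrow> nat \<Rightarrow> nat \<Rightarrow> (coord, 'k::comm_ring_1) mpoly ring" where
  "S_alg n m q = generated_subalgebra (KX n m q) (gen_fun n m q ` gens n m q)"

definition gen_ring :: "nat \<Rightarrow> nat \<Rightarrow> nat \<Rightarrow> (gen, 'k::comm_ring_1) mpoly ring" where
  "gen_ring n m q = poly_ring (gens n m q)"

definition pres_map ::
    "nat \<Rightarrow> nat \<Rightarrow> nat \<Rightarrow> (gen, 'k::comm_ring_1) mpoly \<Rightarrow> (coord, 'k) mpoly" where
  "pres_map n m q = poly_subst (gen_fun n m q)"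


section \<open>The six types of relations\<close>

text \<open>\<open>p(\<emptyset>,\<emptyset>)\<close> is read as \<open>1\<close>.\<close>

definition X_var :: "nat list \<times> nat list \<Rightarrow> (gen, 'k::comm_ring_1) mpoly" where
  "X_var P = (if P = ([], []) then 1 else Var (X (fst P) (snd P)))"

definition Y_var :: "nat list \<Rightarrow> (gen, 'k::comm_ring_1) mpoly" where
  "Y_var I = Var (Y I)"

definition Z_var :: "nat list \<Rightarrow> (gen, 'k::comm_ring_1) mpoly" where
  "Z_var J = Var (Z J)"

text \<open>The valid relations \<open>lhs = \<Sum>\<^sub>t c\<^sub>t rhs(t)\<close> with finitely many terms \<open>t\<close> from \<open>D\<close> and nonzero
  coefficients, as elements of the kernel.  The relations are constrained only by the shape of
  their right-hand sides, so each of the types below assigns to an index the \<^emph>\<open>set\<close> of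
  relations of the prescribed shape.\<close>

definition straightenings ::
    "nat \<Rightarrow> nat \<Rightarrow> nat \<Rightarrow> (gen, 'k::comm_ring_1) mpoly \<Rightarrow> ('t \<Rightarrow> (gen, 'k) mpoly) \<Rightarrow> 't set
       \<Rightarrow> (gen, 'k) mpoly set" where
  "straightenings n m q lhs rhs D =
     {lhs - (\<Sum>t\<in>T. Const (c t) * rhs t) | T c.
        finite T \<and> T \<subseteq> D \<and> (\<forall>t\<in>T. c t \<noteq> 0)
        \<and> pres_map n m q (lhs - (\<Sum>t\<in>T. Const (c t) * rhs t)) = 0}"

definition R1 :: "nat list \<Rightarrow> nat list \<Rightarrow> (gen, 'k::comm_ring_1) mpoly set" where
  "R1 I J = {Y_var I * Z_var J - X_var (I, J)}"

definition R2 ::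
    "nat \<Rightarrow> nat \<Rightarrow> nat \<Rightarrow> nat list \<Rightarrow> nat list \<Rightarrow> (gen, 'k::comm_ring_1) mpoly set" where
  "R2 n m q I I' = straightenings n m q (Y_var I * Y_var I') (\<lambda>(L, L'). Y_var L * Y_var L')
     {(L, L'). L \<in> H_u n m \<and> L' \<in> H_u n m \<and> L \<succeq> I \<and> L \<succeq> I' \<and> I \<succeq> L' \<and> I' \<succeq> L'}"

definition R3 ::
    "nat \<Rightarrow> nat \<Rightarrow> nat \<Rightarrow> nat list \<Rightarrow> nat list \<Rightarrow> (gen, 'k::comm_ring_1) mpoly set" where
  "R3 n m q J J' = straightenings n m q (Z_var J * Z_var J') (\<lambda>(L, L'). Z_var L * Z_var L')
     {(L, L'). L \<in> H_xi n q \<and> L' \<in> H_xi n q \<and> L \<succeq> J \<and> L \<succeq> J' \<and> J \<succeq> L' \<and> J' \<succeq> L'}"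

definition R4 ::
    "nat \<Rightarrow> nat \<Rightarrow> nat \<Rightarrow> nat list \<times> nat list \<Rightarrow> nat list \<times> nat list
       \<Rightarrow> (gen, 'k::comm_ring_1) mpoly set" where
  "R4 n m q A B = straightenings n m q (X_var A * X_var B) (\<lambda>(C, D). X_var C * X_var D)
     {(C, D). C \<in> H_p n m q \<union> {([], [])} \<and> D \<in> H_p n m q
        \<and> C \<succeq>\<^sub>p A \<and> C \<succeq>\<^sub>p B \<and> A \<succeq>\<^sub>p D \<and> B \<succeq>\<^sub>p D}"

definition R5 ::
    "nat \<Rightarrow> nat \<Rightarrow> nat \<Rightarrow> nat list \<times> nat list \<Rightarrow> nat list
       \<Rightarrow> (gen, 'k::comm_ring_1) mpoly set" where
  "R5 n m q P I = (case P of (A, B) \<Rightarrow>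
     straightenings n m q (X_var (A, B) * Y_var I) (\<lambda>((A', B'), I'). X_var (A', B') * Y_var I')
       {((A', B'), I'). (A', B') \<in> H_p n m q \<and> I' \<in> H_u n m
          \<and> A' \<succeq> A \<and> A' \<succeq> I \<and> A \<succeq> I' \<and> I \<succeq> I' \<and> B' \<succeq> B})"

definition R6 ::
    "nat \<Rightarrow> nat \<Rightarrow> nat \<Rightarrow> nat list \<times> nat list \<Rightarrow> nat list
       \<Rightarrow> (gen, 'k::comm_ring_1) mpoly set" where
  "R6 n m q P J = (case P of (A, B) \<Rightarrow>
     straightenings n m q (X_var (A, B) * Z_var J) (\<lambda>((A', B'), J'). X_var (A', B') * Z_var J')
       {((A', B'), J'). (A', B') \<in> H_p n m q \<and> J' \<in> H_xi n q
          \<and> A' \<succeq> A \<and> B' \<succeq> B \<and> B' \<succeq> J \<and> B \<succeq> J' \<and> J \<succeq> J'})"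

text \<open>One set of candidate relations for every index of every type.\<close>

definition relation_sets ::
    "nat \<Rightarrow> nat \<Rightarrow> nat \<Rightarrow> (gen, 'k::comm_ring_1) mpoly set set" where
  "relation_sets n m q =
     {R1 I J | I J. I \<in> H_u n m \<and> J \<in> H_xi n q}
   \<union> {R2 n m q I I' | I I'. I \<in> H_u n m \<and> I' \<in> H_u n m \<and> \<not> I \<succeq> I' \<and> \<not> I' \<succeq> I}
   \<union> {R3 n m q J J' | J J'. J \<in> H_xi n q \<and> J' \<in> H_xi n q \<and> \<not> J \<succeq> J' \<and> \<not> J' \<succeq> J}
   \<union> {R4 n m q A B | A B. A \<in> H_p n m q \<and> B \<in> H_p n m q \<and> \<not> A \<succeq>\<^sub>p B \<and> \<not> B \<succeq>\<^sub>p A}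
   \<union> {R5 n m q P I | P I. P \<in> H_p n m q \<and> I \<in> H_u n m \<and> \<not> fst P \<succeq> I}
   \<union> {R6 n m q P J | P J. P \<in> H_p n m q \<and> J \<in> H_xi n q \<and> \<not> snd P \<succeq> J}"

text \<open>A full list of relations: every member is a relation of one of the six types, and every
  index is covered.\<close>

definition relation_system ::
    "nat \<Rightarrow> nat \<Rightarrow> nat \<Rightarrow> (gen, 'k::comm_ring_1) mpoly set \<Rightarrow> bool" where
  "relation_system n m q G \<longleftrightarrow>
     G \<subseteq> \<Union> (relation_sets n m q) \<and> (\<forall>R \<in> relation_sets n m q. G \<inter> R \<noteq> {})"

end

theory Submission
  imports Defs
begin

text \<open>
  Call a monomial in the generators standard if its factors are pairwise \<open>comparable\<close>: the
  factors \<open>p(A,B)\<close> form a chain, the factors \<open>u(I)\<close> (or \<open>\<xi>(J)\<close>) form a chain, every \<open>A\<close>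
  dominates every \<open>I\<close> (every \<open>B\<close> every \<open>J\<close>), and \<open>u\<close> and \<open>\<xi>\<close> do not both occur.  The theorem
  says in essence that the standard monomials are a basis of \<open>S\<close>, and that each relation
  rewrites a product of two incomparable generators.

  Independence.  There is a weight on the coordinates for which each minor has a single term of
  least weight, the diagonal one, with coefficient 1: for \<open>p(A,B)\<close> it is \<open>\<Prod>\<^sub>i u(a\<^sub>i,i)
  w(i,b\<^sub>i)\<close> (\<open>initial_gen_fun\<close>).  The diagonal term of a product records, for each position
  \<open>j\<close>, the multiset of the \<open>j\<close>-th entries of the tuples involved.  In a standard monomial these
  tuples form chains, so the least tuple, and inductively the whole monomial, can be read off
  (\<open>standard_determined_by_diagonals\<close>).  Polynomials with distinct initial monomials are
  linearly independent, in every characteristic (\<open>standard_independent\<close>).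

  Existence of the relations.  All of them come from the maximal minors \<open>[a]\<close> of one matrix
  with \<open>k\<close> columns.  A multilinear alternating function of \<open>k + 1\<close> vectors of a \<open>k\<close>-dimensional
  space vanishes; this gives exchange relations with coefficients \<open>\<plusminus>1\<close> (\<open>pluecker_exchange\<close>),
  and repeated exchange writes \<open>[a][b]\<close> as a combination of \<open>[c][d]\<close> with \<open>c \<succeq> d\<close>, \<open>c \<succeq> a\<close> and
  \<open>b \<succeq> d\<close>.  Starting from \<open>[b][a]\<close> instead gives \<open>c \<succeq> b\<close> and \<open>a \<succeq> d\<close>.  By independence the two
  expansions are the same, so all four inequalities hold (\<open>two_sided_straightening\<close>).  This is
  (R2) and (R3).  Stacking a matrix on a permutation matrix turns all of its minors into
  maximal minors of the larger matrix; the order on pairs of tuples becomes the order on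
  tuples, and the empty minor becomes the largest element (\<open>minor_straightening\<close>).  For the
  matrix \<open>UW\<close>, whose minors of size greater than \<open>n\<close> vanish, this is (R4).  For \<open>U[1|W]\<close> it
  gives (R5) (\<open>row_straightening\<close>): \<open>u(I)\<close> is the minor on the first \<open>n\<close> columns, which are the
  smallest ones, so the smaller factor on the right must again be of the form \<open>u(I')\<close>.
  Transposing gives (R6), and (R1) is multiplicativity of the determinant.

  Generation.  On the right-hand side of each relation, one factor is larger than both factors
  on the left, or (R1) the number of factors \<open>u\<close>, \<open>\<xi>\<close> drops.  So an exponential cost decreases
  (\<open>two_power_convex\<close>), and modulo any full system of relations every polynomial is a
  combination of standard monomials.  If the polynomial is in the kernel, then the combination
  maps to 0 and so is trivial by independence (\<open>kernel_subset_ideal\<close>).  Only the shape of the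
  relations enters, which is why every choice of relations of the six types generates the same
  ideal.
\<close>

abbreviation "keys \<equiv> Poly_Mapping.keys"
abbreviation "lookup \<equiv> Poly_Mapping.lookup"
abbreviation "single \<equiv> Poly_Mapping.single"

section \<open>Determinants with prescribed rows\<close>

text \<open>The rows are named by the entries of a list, so that repeating, permuting and replacing
rows are operations on lists.\<close>

definition rdet :: "nat \<Rightarrow> ('i \<Rightarrow> nat \<Rightarrow> 'a::comm_ring_1) \<Rightarrow> 'i list \<Rightarrow> 'a" where
  "rdet k \<rho> xs = det (mat k k (\<lambda>(i, j). \<rho> (xs ! i) j))"

lemma rdet_cong:
  assumes "\<And>i j. i < k \<Longrightarrow> j < k \<Longrightarrow> \<rho> (xs ! i) j = \<rho>' (ys ! i) j"
  shows "rdet k \<rho> xs = rdet k \<rho>' ys"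
proof -
  have "mat k k (\<lambda>(i, j). \<rho> (xs ! i) j) = mat k k (\<lambda>(i, j). \<rho>' (ys ! i) j)"
    using assms by (intro eq_matI) auto
  thus ?thesis by (simp add: rdet_def)
qed

text \<open>The sign depends on the two lists only.  Having it in front of the quantifier over \<open>\<rho>\<close>
makes the equation one between functions of the matrix.\<close>

lemma rdet_mset_eq:
  assumes "mset xs = mset ys" and "length ys = k"
  shows "\<exists>\<epsilon>\<in>{1, -1}. \<forall>\<rho> :: 'i \<Rightarrow> nat \<Rightarrow> 'a::comm_ring_1. rdet k \<rho> xs = \<epsilon> * rdet k \<rho> ys"
proof -
  obtain p where p: "p permutes {..<length ys}" and xs: "permute_list p ys = xs"
    using mset_eq_permutation[OF assms(1)] by blast
  have p': "p permutes {0..<k}" using p assms(2) by (simp add: lessThan_atLeast0)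
  have "rdet k \<rho> xs = signof p * rdet k \<rho> ys" for \<rho> :: "'i \<Rightarrow> nat \<Rightarrow> 'a"
  proof -
    have "xs ! i = ys ! p i" "p i < k" if "i < k" for i
      using that assms(2) permute_list_nth[OF p, of i] permutes_in_image[OF p', of i]
      by (simp_all add: xs)
    hence "mat k k (\<lambda>(i, j). \<rho> (xs ! i) j) =
        mat k k (\<lambda>(i, j). mat k k (\<lambda>(i, j). \<rho> (ys ! i) j) $$ (p i, j))"
      by (intro eq_matI) auto
    thus ?thesis unfolding rdet_def
      using det_permute_rows[OF _ p', of "mat k k (\<lambda>(i, j). \<rho> (ys ! i) j)"] by simp
  qed
  moreover have "(signof p :: 'a) \<in> {1, -1}" by (auto simp: sign_def)
  ultimately show ?thesis by (intro bexI[of _ "signof p"]) auto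
qed

lemma rdet_not_distinct:
  assumes "\<not> distinct xs" and "length xs = k"
  shows "rdet k \<rho> xs = 0"
proof -
  obtain i j where ij: "i < k" "j < k" "i \<noteq> j" "xs ! i = xs ! j"
    using assms by (auto simp: distinct_conv_nth)
  show ?thesis unfolding rdet_def
    by (rule det_identical_rows[OF _ ij(3) ij(1,2)]) (use ij in \<open>auto intro!: eq_vecI\<close>)
qed

text \<open>By the pigeonhole principle, each term of the Leibniz formula has a factor in a row of
\<open>P\<close> outside the columns of \<open>Q\<close>.\<close>

lemma det_zero_block:
  fixes A :: "'a::comm_ring_1 mat"
  assumes A: "A \<in> carrier_mat k k" and P: "P \<subseteq> {0..<k}" and Q: "finite Q" "card Q < card P"
    and z: "\<And>i j. i \<in> P \<Longrightarrow> j < k \<Longrightarrow> j \<notin> Q \<Longrightarrow> A $$ (i, j) = 0"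
  shows "det A = 0"
proof -
  have "(\<Prod>i = 0..<k. A $$ (i, p i)) = 0" if p: "p permutes {0..<k}" for p
  proof -
    have "\<not> p ` P \<subseteq> Q"
    proof
      assume "p ` P \<subseteq> Q"
      hence "card (p ` P) \<le> card Q" using Q(1) by (rule card_mono[rotated])
      moreover have "card (p ` P) = card P"
        by (rule card_image[OF inj_on_subset[OF permutes_inj[OF p]]]) simp
      ultimately show False using Q(2) by simp
    qed
    then obtain i where i: "i \<in> P" "p i \<notin> Q" by auto
    moreover have "p i < k" using permutes_in_image[OF p, of i] i(1) P by auto
    ultimately have "A $$ (i, p i) = 0" using z by blast
    thus ?thesis using i(1) P by (intro prod_zero) auto
  qed
  thus ?thesis by (simp add: det_def'[OF A])
qed

lemma det_append_unit_columns:
  fixes f :: "nat \<Rightarrow> nat \<Rightarrow> 'a::comm_ring_1"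
  shows "det (mat (a + b) (a + b) (\<lambda>(i, j). if j < a then f i j else if i = j then 1 else 0))
    = det (mat a a (\<lambda>(i, j). f i j))"
proof (induction b)
  case 0
  have "mat a a (\<lambda>(i, j). if j < a then f i j else if i = j then 1 else 0)
     = mat a a (\<lambda>(i, j). f i j)" by (intro eq_matI) auto
  thus ?case by simp
next
  case (Suc b)
  let ?g = "\<lambda>(i, j). if j < a then f i j else if i = j then 1 else 0"
  have eq: "mat (a + Suc b) (a + Suc b) ?g = four_block_mat (mat (a + b) (a + b) ?g)
      (0\<^sub>m (a + b) 1) (mat 1 (a + b) (\<lambda>(i, j). ?g (a + b, j))) (1\<^sub>m 1)"
    by (intro eq_matI) (auto simp: less_Suc_eq)
  show ?case unfolding eq
    by (subst det_four_block_mat_upper_right_zero_col) (auto simp: Suc)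
qed

lemma det_prepend_unit:
  fixes g :: "nat \<Rightarrow> nat \<Rightarrow> 'a::comm_ring_1"
  shows "det (mat (a + b) (a + b)
      (\<lambda>(i, j). if i < a \<or> j < a then (if i = j then 1 else 0) else g (i - a) (j - a)))
    = det (mat b b (\<lambda>(i, j). g i j))"
proof (induction a)
  case 0
  thus ?case by simp
next
  case (Suc a)
  let ?g = "\<lambda>a (i, j). if i < a \<or> j < a then (if i = j then 1 else 0) else g (i - a) (j - a)"
  have eq: "mat (Suc a + b) (Suc a + b) (?g (Suc a)) = four_block_mat (1\<^sub>m 1) (0\<^sub>m 1 (a + b))
      (0\<^sub>m (a + b) 1) (mat (a + b) (a + b) (?g a))"
    by (intro eq_matI) (auto simp: less_Suc_eq_0_disj)
  show ?case unfolding eq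
    by (subst det_four_block_mat_lower_left_zero_col) (auto simp: Suc)
qed

text \<open>The block-diagonal matrix is the product of two matrices with an identity block each.
This needs no cancellation, so it covers all commutative rings.\<close>

lemma det_block_diagonal:
  fixes f g :: "nat \<Rightarrow> nat \<Rightarrow> 'a::comm_ring_1"
  shows "det (mat (a + b) (a + b) (\<lambda>(i, j). if i < a then (if j < a then f i j else 0)
        else if j < a then 0 else g (i - a) (j - a)))
    = det (mat a a (\<lambda>(i, j). f i j)) * det (mat b b (\<lambda>(i, j). g i j))" (is "det ?D = _")
proof -
  let ?F = "mat (a + b) (a + b)
      (\<lambda>(i, j). if j < a then (if i < a then f i j else 0) else if i = j then 1 else 0)"
  let ?G = "mat (a + b) (a + b)
      (\<lambda>(i, j). if i < a \<or> j < a then (if i = j then 1 else 0) else g (i - a) (j - a))"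
  have "?D = ?F * ?G"
  proof (intro eq_matI)
    fix i j assume ij: "i < dim_row (?F * ?G)" "j < dim_col (?F * ?G)"
    have "(?F * ?G) $$ (i, j) = (\<Sum>l = 0..<a + b. ?F $$ (i, l) * ?G $$ (l, j))"
      using ij by (simp add: scalar_prod_def)
    also have "\<dots> = ?D $$ (i, j)"
    proof (cases "j < a")
      case True
      have "(\<Sum>l = 0..<a + b. ?F $$ (i, l) * ?G $$ (l, j))
          = (\<Sum>l = 0..<a + b. if l = j then ?F $$ (i, j) else 0)"
        using ij True by (intro sum.cong) auto
      thus ?thesis using ij True by simp
    next
      case False
      have "(\<Sum>l = 0..<a + b. ?F $$ (i, l) * ?G $$ (l, j))
          = (\<Sum>l = 0..<a + b. if l = i then ?D $$ (i, j) else 0)"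
        using ij False by (intro sum.cong) auto
      thus ?thesis using ij False by simp
    qed
    finally show "?D $$ (i, j) = (?F * ?G) $$ (i, j)" by simp
  qed auto
  hence "det ?D = det ?F * det ?G" by (simp add: det_mult[of _ "a + b"])
  also have "det ?F = det (mat a a (\<lambda>(i, j). if i < a then f i j else 0))"
    by (rule det_append_unit_columns)
  also have "mat a a (\<lambda>(i, j). if i < a then f i j else 0) = mat a a (\<lambda>(i, j). f i j)"
    by (intro eq_matI) auto
  also have "det ?G = det (mat b b (\<lambda>(i, j). g i j))" by (rule det_prepend_unit)
  finally show ?thesis .
qed

lemma rdet_row_add:
  fixes \<rho> :: "'i \<Rightarrow> nat \<Rightarrow> 'a::comm_ring_1"
  assumes "length pre < k" and "\<And>j. j < k \<Longrightarrow> \<rho> z j = \<rho> x j + \<rho> y j"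
  shows "rdet k \<rho> (pre @ z # post) = rdet k \<rho> (pre @ x # post) + rdet k \<rho> (pre @ y # post)"
proof -
  let ?l = "length pre"
  let ?v = "\<lambda>x. vec k (\<rho> x)"
  have r: "rdet k \<rho> (pre @ w # post) = det (mat\<^sub>r k k (\<lambda>i. if i = ?l then ?v w
      else ?v ((pre @ x # post) ! i)))" for w
    unfolding rdet_def by (rule arg_cong[of _ _ det], intro eq_matI)
      (auto simp: nth_append nth_Cons')
  have z: "?v z = ?v x + ?v y" using assms(2) by (intro eq_vecI) auto
  show ?thesis unfolding r z
    using det_row_add[of "\<lambda>_. ?v x" ?l k "\<lambda>_. ?v y" "\<lambda>i. ?v ((pre @ x # post) ! i)"] assms(1)
    by auto
qed

section \<open>Linear combinations of functions\<close>

lemma Const_0 [simp]: "Const 0 = 0"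
  by (simp add: Const_def)

lemma Const_1 [simp]: "Const 1 = 1"
  by (simp add: Const_def)

lemma Const_add: "Const (a + b) = Const a + Const b"
  by (simp add: Const_def single_add)

lemma Const_mult: "Const (a * b) = Const a * Const b"
  for a b :: "'a::comm_ring_1"
  by (simp add: Const_def mult_single)

lemma Const_uminus: "Const (- a) = - Const a"
  for a :: "'a::comm_ring_1"
  by (simp add: Const_def single_uminus)

lemma Const_diff: "Const (a - b) = Const a - Const b"
  for a b :: "'a::comm_ring_1"
  by (simp add: Const_def single_diff)

lemma lookup_Const_mult: "lookup (Const c * F) e = c * lookup F e"
  for F :: "('x, 'a::comm_ring_1) mpoly"
proof -
  have "Const c * F = Poly_Mapping.map ((*) c) F"
    unfolding Const_def by (rule mult_map_scale_conv_mult[symmetric])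
  thus ?thesis by (simp add: Poly_Mapping.map.rep_eq when_def)
qed

text \<open>The \<open>K\<close>-linear combinations of the functions \<open>F i\<close>, \<open>i \<in> D\<close>, of a parameter \<open>p\<close> (a
matrix, say).  The coefficients do not depend on \<open>p\<close>, so that an identity found for the generic
matrix and one found for all matrices can be compared coefficient by coefficient.\<close>

inductive_set comb :: "('i \<Rightarrow> 'p \<Rightarrow> ('x, 'k::comm_ring_1) mpoly) \<Rightarrow> 'i set \<Rightarrow> ('p \<Rightarrow> ('x, 'k) mpoly) set"
  for F :: "'i \<Rightarrow> 'p \<Rightarrow> ('x, 'k::comm_ring_1) mpoly" and D :: "'i set" where
  zero: "(\<lambda>_. 0) \<in> comb F D"
| step: "i \<in> D \<Longrightarrow> g \<in> comb F D \<Longrightarrow> (\<lambda>p. Const c * F i p + g p) \<in> comb F D"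

lemma comb_base: "i \<in> D \<Longrightarrow> F i \<in> comb F D"
  using comb.step[of i D "\<lambda>_. 0" F 1] comb.zero by fastforce

lemma comb_add: "f \<in> comb F D \<Longrightarrow> g \<in> comb F D \<Longrightarrow> (\<lambda>p. f p + g p) \<in> comb F D"
proof (induction rule: comb.induct)
  case (step i h c)
  thus ?case using comb.step[of i D "\<lambda>p. h p + g p" F c] by (simp add: add.assoc)
qed simp

lemma comb_scale: "f \<in> comb F D \<Longrightarrow> (\<lambda>p. Const a * f p) \<in> comb F D"
proof (induction rule: comb.induct)
  case (step i h c)
  thus ?case using comb.step[of i D "\<lambda>p. Const a * h p" F "a * c"]
    by (simp add: Const_mult distrib_left mult.assoc)
qed (simp add: comb.zero)

lemma comb_uminus: "f \<in> comb F D \<Longrightarrow> (\<lambda>p. - f p) \<in> comb F D"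
  using comb_scale[of f F D "-1"] by (simp add: Const_uminus)

lemma comb_sign: "\<epsilon> \<in> {1, -1} \<Longrightarrow> f \<in> comb F D \<Longrightarrow> (\<lambda>p. \<epsilon> * f p) \<in> comb F D"
  using comb_uminus[of f F D] by auto

lemma comb_sum: "(\<And>x. x \<in> A \<Longrightarrow> f x \<in> comb F D) \<Longrightarrow> (\<lambda>p. \<Sum>x\<in>A. f x p) \<in> comb F D"
  by (induction A rule: infinite_finite_induct) (auto simp: comb.zero intro: comb_add)

lemma comb_trans:
  assumes "f \<in> comb F D" and "\<And>i. i \<in> D \<Longrightarrow> F i \<in> comb F' D'"
  shows "f \<in> comb F' D'"
  using assms(1)
proof induction
  case (step i g c)
  show ?case by (intro comb_add comb_scale step.IH assms(2) step.hyps)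
qed (rule comb.zero)

lemma comb_compose: "f \<in> comb F D \<Longrightarrow> (\<lambda>p. f (h p)) \<in> comb (\<lambda>i p. F i (h p)) D"
  by (induction rule: comb.induct) (auto intro: comb.zero comb.step)

lemma comb_explicit:
  assumes "f \<in> comb F D"
  shows "\<exists>T c. finite T \<and> T \<subseteq> D \<and> (\<forall>t\<in>T. c t \<noteq> 0) \<and> (\<forall>p. f p = (\<Sum>t\<in>T. Const (c t) * F t p))"
proof -
  have "\<exists>c. finite {t. c t \<noteq> 0} \<and> {t. c t \<noteq> 0} \<subseteq> D \<and>
      (\<forall>p. f p = (\<Sum>t | c t \<noteq> 0. Const (c t) * F t p))"
    using assms
  proof induction
    case zero
    show ?case by (intro exI[of _ "\<lambda>_. 0"]) simp
  next
    case (step i g a)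
    then obtain c where c: "finite {t. c t \<noteq> 0}" "{t. c t \<noteq> 0} \<subseteq> D"
      "\<And>p. g p = (\<Sum>t | c t \<noteq> 0. Const (c t) * F t p)" by blast
    let ?c = "c(i := a + c i)" and ?S = "insert i {t. c t \<noteq> 0}"
    have sub: "{t. ?c t \<noteq> 0} \<subseteq> ?S" by auto
    have "Const a * F i p + g p = (\<Sum>t | ?c t \<noteq> 0. Const (?c t) * F t p)" for p
    proof -
      have "(\<Sum>t | ?c t \<noteq> 0. Const (?c t) * F t p) = (\<Sum>t\<in>?S. Const (?c t) * F t p)"
        using c(1) sub by (intro sum.mono_neutral_left) auto
      also have "\<dots> = (\<Sum>t\<in>?S. Const (if t = i then a else 0) * F t p + Const (c t) * F t p)"
        by (intro sum.cong) (auto simp: Const_add distrib_right)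
      also have "\<dots> = (\<Sum>t\<in>?S. if t = i then Const a * F t p else 0)
          + (\<Sum>t\<in>?S. Const (c t) * F t p)"
        unfolding sum.distrib by (intro arg_cong2[of _ _ _ _ "(+)"] sum.cong) auto
      also have "(\<Sum>t\<in>?S. if t = i then Const a * F t p else 0) = Const a * F i p"
        using c(1) by simp
      also have "(\<Sum>t\<in>?S. Const (c t) * F t p) = g p"
        unfolding c(3) using c(1) by (intro sum.mono_neutral_right) auto
      finally show ?thesis by simp
    qed
    moreover have "finite {t. ?c t \<noteq> 0}" using c(1) sub by (metis finite.insertI finite_subset)
    moreover have "{t. ?c t \<noteq> 0} \<subseteq> D" using c(2) sub step(1) by blast
    ultimately show ?case by blast
  qed
  thus ?thesis by blast
qed

section \<open>Increasing tuples\<close>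

text \<open>The order on tuples is equivalent to the pointwise order on counting functions
(\<open>tuple_ge_iff_cnt\<close>), and counting functions are additive under exchange and compatible with
complements.\<close>

definition cnt :: "nat list \<Rightarrow> nat \<Rightarrow> nat" where
  "cnt A y = length (filter (\<lambda>x. x < y) A)"

lemma less_cnt_iff:
  "sorted_wrt (<) A \<Longrightarrow> j < cnt A y \<longleftrightarrow> j < length A \<and> A ! j < y"
proof (induction A arbitrary: j)
  case Nil
  show ?case by (simp add: cnt_def)
next
  case (Cons x A)
  show ?case
  proof (cases "x < y")
    case True
    have "cnt (x # A) y = Suc (cnt A y)" using True by (simp add: cnt_def)
    thus ?thesis using Cons True by (cases j) auto
  next
    case False
    have "y \<le> (x # A) ! j" if "j < length (x # A)"
      using that Cons.prems False by (cases j) (auto dest!: nth_mem)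
    moreover have "cnt (x # A) y = 0" using False Cons.prems
        by (auto simp: cnt_def filter_empty_conv)
    ultimately show ?thesis by fastforce
  qed
qed

lemma tuple_ge_iff_cnt:
  assumes A: "sorted_wrt (<) A" and A': "sorted_wrt (<) A'"
  shows "A \<succeq> A' \<longleftrightarrow> (\<forall>y. cnt A y \<le> cnt A' y)"
proof
  assume ge: "A \<succeq> A'"
  show "\<forall>y. cnt A y \<le> cnt A' y"
  proof
    fix y
    have "j < cnt A' y" if "j < cnt A y" for j
      using that ge unfolding less_cnt_iff[OF A] less_cnt_iff[OF A'] tuple_ge_def by force
    thus "cnt A y \<le> cnt A' y" using linorder_not_less by blast
  qed
next
  assume le: "\<forall>y. cnt A y \<le> cnt A' y"
  have "j < length A' \<and> A' ! j \<le> A ! j" if "j < length A" for j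
  proof -
    have "j < cnt A (Suc (A ! j))" using that by (simp add: less_cnt_iff[OF A])
    hence "j < cnt A' (Suc (A ! j))" using le less_le_trans by blast
    thus ?thesis by (simp add: less_cnt_iff[OF A'])
  qed
  thus "A \<succeq> A'" unfolding tuple_ge_def using linorder_not_less by blast
qed

lemma tuple_ge_refl [simp]: "A \<succeq> A"
  by (simp add: tuple_ge_def)

lemma tuple_ge_trans: "A \<succeq> B \<Longrightarrow> B \<succeq> C \<Longrightarrow> A \<succeq> C"
  unfolding tuple_ge_def by (meson le_trans order_less_le_trans)

lemma tuple_ge_antisym: "A \<succeq> B \<Longrightarrow> B \<succeq> A \<Longrightarrow> A = B"
  unfolding tuple_ge_def by (metis le_antisym nth_equalityI)

lemma cnt_mset: "cnt A y = size (filter_mset (\<lambda>x. x < y) (mset A))"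
  unfolding cnt_def mset_filter[symmetric] size_mset ..

text \<open>Replacing some entries of a tuple by the same number of larger ones makes the tuple
larger.\<close>

lemma tuple_ge_exchange:
  assumes "sorted_wrt (<) A" and "sorted_wrt (<) A'" and "mset A' + R = mset A + S"
    and "size R = size S" and "\<And>x y. x \<in># R \<Longrightarrow> y \<in># S \<Longrightarrow> x < y"
  shows "A' \<succeq> A"
  unfolding tuple_ge_iff_cnt[OF assms(2,1)]
proof
  fix y
  let ?f = "\<lambda>M :: nat multiset. size (filter_mset (\<lambda>x. x < y) M)"
  have "?f (mset A' + R) = ?f (mset A + S)" by (simp only: assms(3))
  hence eq: "cnt A' y + ?f R = cnt A y + ?f S" by (simp add: cnt_mset)
  have "?f S \<le> ?f R"
  proof (cases "filter_mset (\<lambda>x. x < y) S = {#}")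
    case True
    show ?thesis unfolding True by simp
  next
    case False
    then obtain s where "s \<in># filter_mset (\<lambda>x. x < y) S" by (rule multiset_nonemptyE)
    hence s: "s \<in># S" "s < y" by simp_all
    have "filter_mset (\<lambda>x. x < y) R = filter_mset (\<lambda>_. True) R"
      using assms(5)[OF _ s(1)] s(2) by (intro filter_mset_cong) (auto intro: less_trans)
    thus ?thesis using assms(4) size_filter_mset_lesseq[of "\<lambda>x. x < y" S] by simp
  qed
  thus "cnt A' y \<le> cnt A y" using eq by simp
qed

lemma I_setD:
  assumes "A \<in> I_set r k"
  shows "length A = r" "sorted_wrt (<) A" "set A \<subseteq> {0..<k}" "distinct A"
  using assms by (auto simp: I_set_def strict_sorted_iff)

lemma sort_in_I_set:
  "distinct A \<Longrightarrow> length A = r \<Longrightarrow> set A \<subseteq> {0..<k} \<Longrightarrow> sort A \<in> I_set r k"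
  by (simp add: I_set_def strict_sorted_iff)

lemma nth_less: "set A \<subseteq> {0..<m} \<Longrightarrow> i < length A \<Longrightarrow> A ! i < m"
  by (metis atLeastLessThan_iff nth_mem subsetD)

section \<open>Exchange relations between maximal minors\<close>

text \<open>The rows of a matrix with \<open>2k\<close> columns: the vector \<open>\<rho> i\<close> is placed in the left half, in
the right half, or in both, according to the two marks.\<close>

definition doubled :: "nat \<Rightarrow> ('i \<Rightarrow> nat \<Rightarrow> 'a::comm_ring_1) \<Rightarrow> 'i \<times> bool \<times> bool \<Rightarrow> nat \<Rightarrow> 'a" where
  "doubled k \<rho> = (\<lambda>(i, l, r) j.
     if j < k then (if l then \<rho> i j else 0) else (if r then \<rho> i (j - k) else 0))"

abbreviation on_left :: "'i \<Rightarrow> 'i \<times> bool \<times> bool" where "on_left x \<equiv> (x, True, False)"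
abbreviation on_right :: "'i \<Rightarrow> 'i \<times> bool \<times> bool" where "on_right x \<equiv> (x, False, True)"
abbreviation on_both :: "'i \<Rightarrow> 'i \<times> bool \<times> bool" where "on_both x \<equiv> (x, True, True)"

lemma rdet_doubled_blocks:
  assumes "length xs = k" and "length ys = k"
  shows "rdet (2 * k) (doubled k \<rho>) (map on_left xs @ map on_right ys) = rdet k \<rho> xs * rdet k \<rho> ys"
proof -
  have "mat (2 * k) (2 * k) (\<lambda>(i, j). doubled k \<rho> ((map on_left xs @ map on_right ys) ! i) j)
    = mat (k + k) (k + k) (\<lambda>(i, j). if i < k then (if j < k then \<rho> (xs ! i) j else 0)
        else if j < k then 0 else \<rho> (ys ! (i - k)) (j - k))"
    using assms by (intro eq_matI) (auto simp: doubled_def nth_append)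
  thus ?thesis unfolding rdet_def
    using det_block_diagonal[of k k "\<lambda>i j. \<rho> (xs ! i) j" "\<lambda>i j. \<rho> (ys ! i) j"] by simp
qed

lemma rdet_doubled_unbalanced:
  assumes "length xs + length ys = 2 * k" and "length xs \<noteq> k"
  shows "rdet (2 * k) (doubled k \<rho>) (map on_left xs @ map on_right ys) = 0"
proof (cases "length xs < k")
  case True
  show ?thesis unfolding rdet_def
  proof (rule det_zero_block[of _ _ "{length xs..<2 * k}" "{k..<2 * k}"])
    fix i j assume "i \<in> {length xs..<2 * k}" "j < 2 * k" "j \<notin> {k..<2 * k}"
    thus "mat (2 * k) (2 * k) (\<lambda>(i, j). doubled k \<rho> ((map on_left xs @ map on_right ys) ! i) j)
        $$ (i, j) = 0"
      using assms(1) by (auto simp: doubled_def nth_append)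
  qed (use True in auto)
next
  case False
  show ?thesis unfolding rdet_def
  proof (rule det_zero_block[of _ _ "{0..<length xs}" "{0..<k}"])
    fix i j assume "i \<in> {0..<length xs}" "j < 2 * k" "j \<notin> {0..<k}"
    thus "mat (2 * k) (2 * k) (\<lambda>(i, j). doubled k \<rho> ((map on_left xs @ map on_right ys) ! i) j)
        $$ (i, j) = 0"
      using assms(1) by (auto simp: doubled_def nth_append)
  qed (use False assms in auto)
qed

text \<open>Subtracting the left half of the columns from the right half puts \<open>k + 1\<close> rows into the
left half.\<close>

lemma rdet_doubled_dependent:
  assumes "length xs = Suc k" and "length xs + length as + length bs = 2 * k"
  shows "rdet (2 * k) (doubled k \<rho>) (map on_both xs @ map on_left as @ map on_right bs) = 0"
    (is "rdet _ _ ?zs = 0")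
proof -
  let ?d = "\<lambda>(x, l, r) j. if j < k then (if l then \<rho> x j else 0)
      else if l then (if r then 0 else - \<rho> x (j - k)) else \<rho> x (j - k)"
  let ?D = "mat (2 * k) (2 * k) (\<lambda>(i, j). ?d (?zs ! i) j)"
  \<comment> \<open>The matrix \<open>?D\<close> has the rows \<open>(x, 0)\<close>, \<open>(a, -a)\<close> and \<open>(0, b)\<close>.  Multiplication by \<open>?C\<close> adds
    the left half of the columns to the right half.\<close>
  let ?C = "mat (2 * k) (2 * k) (\<lambda>(i, j). if i = j \<or> i + k = j then 1 else 0)"
  have "mat (2 * k) (2 * k) (\<lambda>(i, j). doubled k \<rho> (?zs ! i) j) = ?D * ?C"
  proof (intro eq_matI)
    fix i j assume ij: "i < dim_row (?D * ?C)" "j < dim_col (?D * ?C)"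
    obtain x l r where z: "?zs ! i = (x, l, r)" by (cases "?zs ! i") auto
    have "?zs ! i \<in> set ?zs" using ij assms by (intro nth_mem) simp
    hence lr: "l \<or> r" using z by auto
    have "(?D * ?C) $$ (i, j) = (\<Sum>t = 0..<2 * k. ?D $$ (i, t) * ?C $$ (t, j))"
      using ij by (simp add: scalar_prod_def)
    also have "\<dots> = (\<Sum>t = 0..<2 * k. (if t = j then ?d (?zs ! i) j else 0)
        + (if t = j - k then (if k \<le> j then ?d (?zs ! i) (j - k) else 0) else 0))"
    proof (intro sum.cong refl)
      fix t assume "t \<in> {0..<2 * k}"
      thus "?D $$ (i, t) * ?C $$ (t, j) = (if t = j then ?d (?zs ! i) j else 0)
          + (if t = j - k then (if k \<le> j then ?d (?zs ! i) (j - k) else 0) else 0)"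
        using ij by (cases "t = j"; cases "t + k = j") (auto simp: less_imp_diff_less)
    qed
    also have "\<dots> = ?d (?zs ! i) j + (if k \<le> j then ?d (?zs ! i) (j - k) else 0)"
      using ij unfolding sum.distrib by (simp add: less_imp_diff_less)
    also have "\<dots> = doubled k \<rho> (?zs ! i) j" unfolding z using ij lr by (auto simp: doubled_def)
    finally show "mat (2 * k) (2 * k) (\<lambda>(i, j). doubled k \<rho> (?zs ! i) j) $$ (i, j)
        = (?D * ?C) $$ (i, j)" using ij by simp
  qed auto
  moreover have "det ?D = 0"
  proof (rule det_zero_block[of _ _ "{0..<Suc k}" "{0..<k}"])
    fix i j assume "i \<in> {0..<Suc k}" "j < 2 * k" "j \<notin> {0..<k}"
    thus "?D $$ (i, j) = 0" using assms by (auto simp: nth_append)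
  qed (use assms in auto)
  ultimately show ?thesis unfolding rdet_def by (simp add: det_mult[of _ "2 * k"])
qed

definition sel :: "bool list \<Rightarrow> 'i list \<Rightarrow> 'i list" where
  "sel cs xs = map fst (filter snd (zip xs cs))"

lemma sel_simps [simp]:
  "sel [] xs = []"
  "sel (c # cs) (x # xs) = (if c then x # sel cs xs else sel cs xs)"
  by (simp_all add: sel_def)

lemma sel_append:
  "length cs = length xs \<Longrightarrow> sel (cs @ cs') (xs @ xs') = sel cs xs @ sel cs' xs'"
  by (simp add: sel_def)

lemma mset_sel:
  "length cs = length xs \<Longrightarrow> mset (sel cs xs) + mset (sel (map Not cs) xs) = mset xs"
  by (induction cs xs rule: list_induct2) auto

lemma set_sel: "set (sel cs xs) \<subseteq> set xs"
  by (auto simp: sel_def dest: set_zip_leftD)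

lemma length_sel: "length cs = length xs \<Longrightarrow> length (sel cs xs) = length (filter id cs)"
  by (induction cs xs rule: list_induct2) auto

definition choose_sides :: "bool list \<Rightarrow> 'i list \<Rightarrow> ('i \<times> bool \<times> bool) list" where
  "choose_sides cs xs = map2 (\<lambda>x c. (x, c, \<not> c)) xs cs"

lemma choose_sides_simps [simp]:
  "choose_sides [] xs = []"
  "choose_sides (c # cs) (x # xs) = (x, c, \<not> c) # choose_sides cs xs"
  by (simp_all add: choose_sides_def)

lemma mset_choose_sides:
  "length cs = length xs \<Longrightarrow>
     mset (choose_sides cs xs) = mset (map on_left (sel cs xs) @ map on_right (sel (map Not cs)
         xs))"
  by (induction cs xs rule: list_induct2) auto

text \<open>Multilinear expansion of the rows \<open>(x, x) = (x, 0) + (0, x)\<close>.\<close>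

lemma rdet_doubled_expand:
  "length pre + length xs \<le> 2 * k \<Longrightarrow>
    rdet (2 * k) (doubled k \<rho>) (pre @ map on_both xs @ post)
    = (\<Sum>cs | length cs = length xs. rdet (2 * k) (doubled k \<rho>) (pre @ choose_sides cs xs @ post))"
proof (induction xs arbitrary: pre)
  case Nil
  show ?case by simp
next
  case (Cons x xs)
  let ?r = "rdet (2 * k) (doubled k \<rho>)"
  let ?S = "{cs :: bool list. length cs = length xs}"
  have fin: "finite ?S" using finite_lists_length_eq[of "UNIV :: bool set"] by simp
  have S: "{cs :: bool list. length cs = length (x # xs)} = Cons True ` ?S \<union> Cons False ` ?S"
    by (auto simp: length_Suc_conv)
  have "?r (pre @ map on_both (x # xs) @ post)
      = ?r (pre @ on_left x # (map on_both xs @ post)) + ?r (pre @ on_right x # (map on_both xs @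
          post))"
    using Cons.prems unfolding list.map append.simps
    by (intro rdet_row_add) (auto simp: doubled_def)
  also have "?r (pre @ on_left x # (map on_both xs @ post))
      = (\<Sum>cs\<in>?S. ?r (pre @ choose_sides (True # cs) (x # xs) @ post))"
    using Cons.IH[of "pre @ [on_left x]"] Cons.prems by simp
  also have "?r (pre @ on_right x # (map on_both xs @ post))
      = (\<Sum>cs\<in>?S. ?r (pre @ choose_sides (False # cs) (x # xs) @ post))"
    using Cons.IH[of "pre @ [on_right x]"] Cons.prems by simp
  also have "(\<Sum>cs\<in>?S. ?r (pre @ choose_sides (True # cs) (x # xs) @ post))
      + (\<Sum>cs\<in>?S. ?r (pre @ choose_sides (False # cs) (x # xs) @ post))
      = (\<Sum>cs | length cs = length (x # xs). ?r (pre @ choose_sides cs (x # xs) @ post))"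
    unfolding S using fin
    by (subst sum.union_disjoint) (auto simp: sum.reindex)
  finally show ?case .
qed

definition rdet2 :: "nat \<Rightarrow> 'i list \<times> 'i list \<Rightarrow> ('i \<Rightarrow> nat \<Rightarrow> 'a::comm_ring_1) \<Rightarrow> 'a" where
  "rdet2 k P \<rho> = rdet k \<rho> (fst P) * rdet k \<rho> (snd P)"

text \<open>Consider the matrix with \<open>2k\<close> columns and the rows \<open>(x, x)\<close> for the \<open>k + 1\<close> entries \<open>x\<close>
of \<open>xs\<close>, \<open>(a, 0)\<close> for \<open>a\<close> in \<open>as\<close> and \<open>(0, b)\<close> for \<open>b\<close> in \<open>bs\<close>.  Its determinant vanishes.
Expanding it over the ways of choosing a side for each \<open>x\<close> gives products of two maximal minors
up to sign, and 0 if the sides are unbalanced.  The sum runs over subsets in place of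
permutations, so each product occurs once and no factorials have to be inverted.\<close>

lemma pluecker_exchange:
  fixes xs as bs :: "'i list"
  defines "R \<equiv> \<lambda>cs. (sel cs xs @ as, sel (map Not cs) xs @ bs)"
  assumes xs: "length xs = Suc k" and tot: "length xs + length as + length bs = 2 * k"
    and cs0: "length cs0 = Suc k" "length (sel cs0 xs @ as) = k"
  shows "(rdet2 k (R cs0) :: ('i \<Rightarrow> nat \<Rightarrow> ('x, 'k::comm_ring_1) mpoly) \<Rightarrow> _)
    \<in> comb (rdet2 k) (R ` {cs. length cs = Suc k \<and> cs \<noteq> cs0 \<and> length (sel cs xs @ as) = k})"
    (is "_ \<in> comb ?F (R ` ?C)")
proof -
  let ?S = "{cs :: bool list. length cs = Suc k}"
  define G :: "bool list \<Rightarrow> ('i \<Rightarrow> nat \<Rightarrow> ('x, 'k) mpoly) \<Rightarrow> ('x, 'k) mpoly" where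
    "G = (\<lambda>cs \<rho>. rdet (2 * k) (doubled k \<rho>) (choose_sides cs xs @ map on_left as @ map on_right
        bs))"
  have fin: "finite ?S" using finite_lists_length_eq[of "UNIV :: bool set"] by simp
  have sum0: "(\<Sum>cs\<in>?S. G cs \<rho>) = 0" for \<rho>
    using rdet_doubled_dependent[OF xs tot, of \<rho>] xs tot
      rdet_doubled_expand[of "[]" xs k \<rho> "map on_left as @ map on_right bs"]
    by (simp add: G_def)
  have ms: "mset (choose_sides cs xs @ map on_left as @ map on_right bs)
      = mset (map on_left (fst (R cs)) @ map on_right (snd (R cs)))" if "cs \<in> ?S" for cs
    using mset_choose_sides[of cs xs] xs that by (simp add: R_def)
  have len: "length (fst (R cs)) + length (snd (R cs)) = 2 * k" if "cs \<in> ?S" for cs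
    using arg_cong[OF mset_sel[of cs xs], of size] xs tot that by (simp add: R_def)
  have len': "length (map on_left (fst (R cs)) @ map on_right (snd (R cs))) = 2 * k"
    if "cs \<in> ?S" for cs using len[OF that] by simp
  have sgn: "\<exists>\<epsilon>\<in>{1, -1}. \<forall>\<rho>. G cs \<rho> = \<epsilon> * ?F (R cs) \<rho>"
    if S: "cs \<in> ?S" and l: "length (sel cs xs @ as) = k" for cs
  proof -
    obtain \<epsilon> where e: "\<epsilon> \<in> {1, -1}" "\<And>\<rho> :: 'i \<times> bool \<times> bool \<Rightarrow> nat \<Rightarrow> ('x, 'k) mpoly.
        rdet (2 * k) \<rho> (choose_sides cs xs @ map on_left as @ map on_right bs)
        = \<epsilon> * rdet (2 * k) \<rho> (map on_left (fst (R cs)) @ map on_right (snd (R cs)))"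
      using rdet_mset_eq[OF ms[OF S] len'[OF S]] by blast
    have "length (fst (R cs)) = k" "length (snd (R cs)) = k"
      using l len[OF S] by (simp_all add: R_def)
    hence "G cs \<rho> = \<epsilon> * ?F (R cs) \<rho>" for \<rho>
      unfolding G_def e(2) rdet2_def by (simp only: rdet_doubled_blocks)
    thus ?thesis using e(1) by blast
  qed
  have other: "G cs \<in> comb ?F (R ` ?C)" if cs: "cs \<in> ?S - {cs0}" for cs
  proof (cases "length (sel cs xs @ as) = k")
    case True
    have "cs \<in> ?S" using cs by simp
    then obtain \<epsilon> where e: "\<epsilon> \<in> {1, -1}" "\<And>\<rho>. G cs \<rho> = \<epsilon> * ?F (R cs) \<rho>"
      using sgn True by blast
    have "G cs = (\<lambda>\<rho>. \<epsilon> * ?F (R cs) \<rho>)" using e(2) by blast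
    also have "\<dots> \<in> comb ?F (R ` ?C)"
      by (intro comb_sign[OF e(1)] comb_base) (use cs True in auto)
    finally show ?thesis .
  next
    case False
    have S: "cs \<in> ?S" using cs by simp
    obtain \<epsilon> where e: "\<And>\<rho> :: 'i \<times> bool \<times> bool \<Rightarrow> nat \<Rightarrow> ('x, 'k) mpoly.
        rdet (2 * k) \<rho> (choose_sides cs xs @ map on_left as @ map on_right bs)
        = \<epsilon> * rdet (2 * k) \<rho> (map on_left (fst (R cs)) @ map on_right (snd (R cs)))"
      using rdet_mset_eq[OF ms[OF S] len'[OF S]] by blast
    have "length (fst (R cs)) \<noteq> k" using False by (simp add: R_def)
    hence "G cs = (\<lambda>_. 0)"
      unfolding G_def e by (simp add: rdet_doubled_unbalanced[OF len[OF S]])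
    thus ?thesis by (simp only: comb.zero)
  qed
  obtain \<epsilon> where e: "\<epsilon> \<in> {1, -1}" "\<And>\<rho>. G cs0 \<rho> = \<epsilon> * ?F (R cs0) \<rho>"
    using sgn[of cs0] cs0 by blast
  have "?F (R cs0) \<rho> = \<epsilon> * - (\<Sum>cs\<in>?S - {cs0}. G cs \<rho>)" for \<rho>
  proof -
    have "G cs0 \<rho> + (\<Sum>cs\<in>?S - {cs0}. G cs \<rho>) = 0"
      using sum0[of \<rho>] sum.remove[OF fin, of cs0 "\<lambda>cs. G cs \<rho>"] cs0 by simp
    hence G: "G cs0 \<rho> = - (\<Sum>cs\<in>?S - {cs0}. G cs \<rho>)" by (simp add: eq_neg_iff_add_eq_0)
    have "?F (R cs0) \<rho> = \<epsilon> * G cs0 \<rho>" using e by (auto simp: mult.assoc[symmetric])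
    thus ?thesis by (simp only: G)
  qed
  hence "?F (R cs0) = (\<lambda>\<rho>. \<epsilon> * - (\<Sum>cs\<in>?S - {cs0}. G cs \<rho>))" by blast
  also have "\<dots> \<in> comb ?F (R ` ?C)"
    by (intro comb_sign[OF e(1)] comb_uminus comb_sum other)
  finally show ?thesis .
qed

lemma sum_list_upper: "\<forall>x\<in>set L. x \<le> u \<Longrightarrow> sum_list L \<le> length L * u" for u :: nat
  by (induction L) auto

lemma sum_list_lower: "\<forall>x\<in>set L. v \<le> x \<Longrightarrow> length L * v \<le> sum_list L" for v :: nat
  by (induction L) auto

lemma rdet2_not_distinct:
  assumes "\<not> (distinct (fst P) \<and> distinct (snd P))" and "length (fst P) = k" and "length (snd P)
      = k"
  shows "rdet2 k P = (\<lambda>_. 0)"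
  using assms by (intro ext) (auto simp: rdet2_def rdet_not_distinct)

lemma rdet2_sort:
  assumes "length a = k" and "length b = k"
  shows "\<exists>\<epsilon>\<in>{1, -1}. \<forall>\<rho> :: nat \<Rightarrow> nat \<Rightarrow> 'a::comm_ring_1.
    rdet2 k (a, b) \<rho> = \<epsilon> * rdet2 k (sort a, sort b) \<rho>"
proof -
  have s: "mset a = mset (sort a)" "mset b = mset (sort b)" "length (sort a) = k"
      "length (sort b) = k"
    using assms by simp_all
  obtain \<epsilon> where e1: "\<epsilon> \<in> {1, -1}"
    "\<And>\<rho> :: nat \<Rightarrow> nat \<Rightarrow> 'a. rdet k \<rho> a = \<epsilon> * rdet k \<rho> (sort a)"
    using rdet_mset_eq[OF s(1,3)] by blast
  obtain \<epsilon>' where e2: "\<epsilon>' \<in> {1, -1}"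
    "\<And>\<rho> :: nat \<Rightarrow> nat \<Rightarrow> 'a. rdet k \<rho> b = \<epsilon>' * rdet k \<rho> (sort b)"
    using rdet_mset_eq[OF s(2,4)] by blast
  have "rdet2 k (a, b) \<rho> = (\<epsilon> * \<epsilon>') * rdet2 k (sort a, sort b) \<rho>" for \<rho> :: "nat \<Rightarrow> nat \<Rightarrow> 'a"
    unfolding rdet2_def fst_conv snd_conv e1(2)[of \<rho>] e2(2)[of \<rho>] by (simp only: ac_simps)
  moreover have "\<epsilon> * \<epsilon>' \<in> {1, -1}" using e1(1) e2(1) by auto
  ultimately show ?thesis by (intro bexI[of _ "\<epsilon> * \<epsilon>'"]) auto
qed

text \<open>If \<open>a\<^sub>s < b\<^sub>s\<close>, then \<open>a\<^sub>0, \<dots>, a\<^sub>s\<close> are smaller than \<open>b\<^sub>s, b\<^sub>s\<^sub>+\<^sub>1, \<dots>\<close>, and together they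
are \<open>k + 1\<close> entries.  Every nontrivial exchange among them replaces entries of \<open>a\<close> by larger
ones.\<close>

lemma straightening_step:
  assumes a: "a \<in> I_set k N" and b: "b \<in> I_set k N" and s: "s < k" "a ! s < b ! s"
  shows "(rdet2 k (a, b) :: (nat \<Rightarrow> nat \<Rightarrow> ('x, 'k::comm_ring_1) mpoly) \<Rightarrow> _) \<in> comb (rdet2 k)
    {(c, d). c \<in> I_set k N \<and> d \<in> I_set k N \<and> c \<succeq> a \<and> b \<succeq> d
       \<and> mset c + mset d = mset a + mset b \<and> sum_list d < sum_list b}" (is "_ \<in> comb _ ?D")
proof -
  note a' = I_setD[OF a] and b' = I_setD[OF b]
  let ?A1 = "take (Suc s) a" and ?B2 = "drop s b"
  let ?xs = "?A1 @ ?B2" and ?as = "drop (Suc s) a" and ?bs = "take s b"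
  \<comment> \<open>The original product: \<open>a\<^sub>0, \<dots>, a\<^sub>s\<close> on the left, the entries of \<open>b\<close> on the right.\<close>
  let ?cs0 = "replicate (Suc s) True @ replicate (k - s) False"
  let ?R = "\<lambda>cs. (sel cs ?xs @ ?as, sel (map Not cs) ?xs @ ?bs)"
  let ?C = "{cs. length cs = Suc k \<and> cs \<noteq> ?cs0 \<and> length (sel cs ?xs @ ?as) = k}"
  have sel_True: "sel (replicate (length L) True) L = L" for L :: "nat list"
    by (induction L) auto
  have sel_False: "sel (replicate (length L) False) L = []" for L :: "nat list"
    by (induction L) auto
  have lA1: "length ?A1 = Suc s" and lB2: "length ?B2 = k - s" using a' b' s by auto
  have R0: "sel ?cs0 ?xs = ?A1" "sel (map Not ?cs0) ?xs = ?B2"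
    using sel_True[of ?A1] sel_False[of ?B2] sel_False[of ?A1] sel_True[of ?B2]
    by (simp_all only: lA1 lB2 map_append map_replicate not_True_eq_False not_False_eq_True
        length_replicate sel_append append_Nil append_Nil2)
  have exchange: "(rdet2 k (?R ?cs0) :: (nat \<Rightarrow> nat \<Rightarrow> ('x, 'k) mpoly) \<Rightarrow> _)
      \<in> comb (rdet2 k) (?R ` ?C)"
    by (rule pluecker_exchange) (use a' b' s R0 in auto)
  have "rdet2 k (?R cs) \<in> comb (rdet2 k :: _ \<Rightarrow> (nat \<Rightarrow> nat \<Rightarrow> ('x, 'k) mpoly) \<Rightarrow> _) ?D"
    if cs: "cs \<in> ?C" for cs
  proof -
    let ?a = "fst (?R cs)" and ?b = "snd (?R cs)"
    let ?c1 = "take (Suc s) cs" and ?c2 = "drop (Suc s) cs"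
    let ?r = "sel (map Not ?c1) ?A1" and ?s = "sel ?c2 ?B2"
    have l1: "length ?c1 = length ?A1" and l2: "length ?c2 = length ?B2" using cs lA1 lB2 s by auto
    have split: "sel cs ?xs = sel ?c1 ?A1 @ ?s" "sel (map Not cs) ?xs = ?r @ sel (map Not ?c2) ?B2"
      using sel_append[OF l1, of ?c2 ?B2] sel_append[of "map Not ?c1" ?A1 "map Not ?c2" ?B2] l1
      by (simp_all add: map_append[symmetric] del: map_append)
    \<comment> \<open>The entries \<open>?r\<close> leave \<open>a\<close>, and the entries \<open>?s\<close> replace them.\<close>
    have ma: "mset ?a + mset ?r = mset a + mset ?s"
    proof -
      have "mset a = mset ?A1 + mset ?as" by (metis append_take_drop_id mset_append)
      thus ?thesis unfolding split fst_conv mset_append mset_sel[OF l1, symmetric]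
        by (simp only: ac_simps)
    qed
    have mb: "mset ?b + mset ?s = mset b + mset ?r"
    proof -
      have "mset b = mset ?bs + mset ?B2" by (metis append_take_drop_id mset_append)
      thus ?thesis unfolding split snd_conv mset_append mset_sel[OF l2, symmetric]
        by (simp only: ac_simps)
    qed
    have la: "length ?a = k" using cs by simp
    have lrs: "length ?r = length ?s"
      using arg_cong[OF ma, of size] la a'(1) by simp
    have lb: "length ?b = k"
      using arg_cong[OF mb, of size] lrs b'(1) by simp
    have r_le: "x \<le> a ! s" if "x \<in> set ?r" for x
    proof -
      have "x \<in> set ?A1" using that set_sel by fastforce
      then obtain i where "i < Suc s" "x = a ! i" using a' s by (auto simp: in_set_conv_nth)
      thus ?thesis using sorted_wrt_nth_less[OF a'(2), of i s] a'(1) s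
        by (cases "i = s") auto
    qed
    have s_ge: "b ! s \<le> x" if "x \<in> set ?s" for x
    proof -
      have "x \<in> set ?B2" using that set_sel by fastforce
      then obtain i where "i < k - s" "x = b ! (s + i)" using b' s by (auto simp: in_set_conv_nth)
      thus ?thesis using sorted_wrt_nth_less[OF b'(2), of s "s + i"] b'(1) s(1)
        by (cases "i = 0") (auto simp: less_diff_conv add.commute)
    qed
    have r_ne: "?r \<noteq> []"
    proof
      assume r: "?r = []"
      hence "filter Not ?c1 = []" "filter id ?c2 = []"
        using length_sel[of "map Not ?c1" ?A1] length_sel[OF l2] l1 lrs
        by (auto simp: filter_map comp_def)
      hence "?c1 = replicate (length ?c1) True" "?c2 = replicate (length ?c2) False"
        by (auto simp: filter_empty_conv intro!: replicate_eqI)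
      hence "?c1 @ ?c2 = ?cs0" using l1 l2 lA1 lB2 by simp
      thus False using cs by simp
    qed
    have "sum_list ?r \<le> length ?r * (a ! s)" using r_le by (intro sum_list_upper) auto
    also have "\<dots> < length ?r * (b ! s)" using s r_ne by simp
    also have "\<dots> \<le> sum_list ?s" unfolding lrs using s_ge by (intro sum_list_lower) auto
    finally have "sum_list ?r < sum_list ?s" .
    hence sum_b: "sum_list ?b < sum_list b"
      using arg_cong[OF mb, of sum_mset] by (simp add: sum_mset_sum_list)
    show ?thesis
    proof (cases "distinct ?a \<and> distinct ?b")
      case False
      hence "rdet2 k (?R cs) = (\<lambda>\<rho> :: nat \<Rightarrow> nat \<Rightarrow> ('x, 'k) mpoly. 0)"
        by (rule rdet2_not_distinct[OF _ la lb])
      thus ?thesis by (simp only: comb.zero)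
    next
      case True
      have sa: "set ?a \<subseteq> {0..<N}" and sb: "set ?b \<subseteq> {0..<N}"
      proof -
        have "set ?xs \<subseteq> {0..<N}" "set ?as \<subseteq> {0..<N}" "set ?bs \<subseteq> {0..<N}"
          using a'(3) b'(3) by (auto dest!: in_set_takeD in_set_dropD)
        thus "set ?a \<subseteq> {0..<N}" "set ?b \<subseteq> {0..<N}"
          using set_sel[of cs ?xs] set_sel[of "map Not cs" ?xs]
          unfolding fst_conv snd_conv set_append by blast+
      qed
      have Ia: "sort ?a \<in> I_set k N" and Ib: "sort ?b \<in> I_set k N"
        using True la lb sa sb sort_in_I_set by blast+
      have lt: "x < y" if "x \<in> set ?r" "y \<in> set ?s" for x y
        using r_le[OF that(1)] s_ge[OF that(2)] s(2) by simp
      have ge_a: "sort ?a \<succeq> a"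
        by (rule tuple_ge_exchange[OF a'(2) I_setD(2)[OF Ia], of "mset ?r" "mset ?s"])
          (use ma lrs lt in auto)
      have ge_b: "b \<succeq> sort ?b"
        by (rule tuple_ge_exchange[OF I_setD(2)[OF Ib] b'(2), of "mset ?r" "mset ?s"])
          (use mb lrs lt in auto)
      have "mset ?a + mset ?b + (mset ?r + mset ?s) = mset a + mset b + (mset ?r + mset ?s)"
        using arg_cong2[OF ma mb, of "(+)"] by (simp only: ac_simps)
      hence content: "mset (sort ?a) + mset (sort ?b) = mset a + mset b"
        by (simp only: mset_sort add_right_cancel)
      have "sum_list (sort ?b) = sum_list ?b"
        by (metis mset_sort sum_mset_sum_list)
      hence "(sort ?a, sort ?b) \<in> ?D" using Ia Ib ge_a ge_b content sum_b by simp
      moreover obtain \<epsilon> where e: "\<epsilon> \<in> {1, -1}"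
        "\<And>\<rho> :: nat \<Rightarrow> nat \<Rightarrow> ('x, 'k) mpoly. rdet2 k (?a, ?b) \<rho> = \<epsilon> * rdet2 k (sort ?a, sort ?b) \<rho>"
        using rdet2_sort[OF la lb] by blast
      ultimately have "(\<lambda>\<rho>. \<epsilon> * rdet2 k (sort ?a, sort ?b) \<rho>) \<in> comb (rdet2 k) ?D"
        by (intro comb_sign comb_base)
      also have "(\<lambda>\<rho>. \<epsilon> * rdet2 k (sort ?a, sort ?b) \<rho>) = rdet2 k (?R cs)"
        unfolding e(2)[symmetric] prod.collapse ..
      finally show ?thesis .
    qed
  qed
  hence "(rdet2 k (?R ?cs0) :: (nat \<Rightarrow> nat \<Rightarrow> ('x, 'k) mpoly) \<Rightarrow> _) \<in> comb (rdet2 k) ?D"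
    using comb_trans[OF exchange] by blast
  also have "?R ?cs0 = (a, ?B2 @ ?bs)" unfolding R0 by simp
  finally have *: "(rdet2 k (a, ?B2 @ ?bs) :: (nat \<Rightarrow> nat \<Rightarrow> ('x, 'k) mpoly) \<Rightarrow> _)
      \<in> comb (rdet2 k) ?D" .
  have mb: "mset b = mset (?B2 @ ?bs)"
    by (metis append_take_drop_id mset_append add.commute)
  have lb: "length (?B2 @ ?bs) = k" using b'(1) s by simp
  obtain \<epsilon> where e: "\<epsilon> \<in> {1, -1}"
    "\<And>\<rho> :: nat \<Rightarrow> nat \<Rightarrow> ('x, 'k) mpoly. rdet k \<rho> b = \<epsilon> * rdet k \<rho> (?B2 @ ?bs)"
    using rdet_mset_eq[OF mb lb] by blast
  have "rdet2 k (a, b) = (\<lambda>\<rho> :: nat \<Rightarrow> nat \<Rightarrow> ('x, 'k) mpoly. \<epsilon> * rdet2 k (a, ?B2 @ ?bs) \<rho>)"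
    by (rule ext) (simp add: rdet2_def e(2) mult.left_commute)
  thus ?thesis using comb_sign[OF e(1) *] by simp
qed

text \<open>The sum of the entries of the second tuple decreases with each exchange.\<close>

lemma one_sided_straightening:
  assumes "a \<in> I_set k N" and "b \<in> I_set k N"
  shows "(rdet2 k (a, b) :: (nat \<Rightarrow> nat \<Rightarrow> ('x, 'k::comm_ring_1) mpoly) \<Rightarrow> _) \<in> comb (rdet2 k)
    {(c, d). c \<in> I_set k N \<and> d \<in> I_set k N \<and> c \<succeq> d \<and> c \<succeq> a \<and> b \<succeq> d
       \<and> mset c + mset d = mset a + mset b}"
  using assms
proof (induction "sum_list b" arbitrary: a b rule: less_induct)
  case less
  note a = I_setD[OF less(2)] and b = I_setD[OF less(3)]
  show ?case
  proof (cases "a \<succeq> b")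
    case True
    thus ?thesis by (intro comb_base) (use less in auto)
  next
    case False
    then obtain s where s: "s < k" "a ! s < b ! s"
      using a(1) b(1) by (auto simp: tuple_ge_def not_le)
    show ?thesis
    proof (rule comb_trans[OF straightening_step[OF less(2,3) s]], clarify)
      fix c d assume cd: "c \<in> I_set k N" "d \<in> I_set k N" "c \<succeq> a" "b \<succeq> d"
        "mset c + mset d = mset a + mset b" "sum_list d < sum_list b"
      show "(rdet2 k (c, d) :: (nat \<Rightarrow> nat \<Rightarrow> ('x, 'k) mpoly) \<Rightarrow> _) \<in> comb (rdet2 k)
        {(c, d). c \<in> I_set k N \<and> d \<in> I_set k N \<and> c \<succeq> d \<and> c \<succeq> a \<and> b \<succeq> d
          \<and> mset c + mset d = mset a + mset b}"
        by (rule comb_trans[OF less(1)[OF cd(6,1,2)]], rule comb_base)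
          (use cd tuple_ge_trans in \<open>auto intro: tuple_ge_trans\<close>)
    qed
  qed
qed

section \<open>Initial monomials\<close>

definition wt :: "('x \<Rightarrow> nat) \<Rightarrow> ('x \<Rightarrow>\<^sub>0 nat) \<Rightarrow> nat" where
  "wt w e = (\<Sum>x\<in>keys e. lookup e x * w x)"

lemma wt_add: "wt w (e + e') = wt w e + wt w e'"
  unfolding wt_def by (rule setsum_keys_plus_distrib) (auto simp: distrib_right)

lemma wt_zero [simp]: "wt w 0 = 0"
  by (simp add: wt_def)

lemma wt_single [simp]: "wt w (single x (Suc 0)) = w x"
  by (simp add: wt_def)

lemma wt_sum: "wt w (sum e A) = (\<Sum>a\<in>A. wt w (e a))"
  by (induction A rule: infinite_finite_induct) (auto simp: wt_add)

text \<open>The monomial \<open>e\<close> occurs in \<open>F\<close> with coefficient 1 and is the only one of its weight or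
less.\<close>

definition initial :: "('x \<Rightarrow> nat) \<Rightarrow> ('x, 'a::comm_ring_1) mpoly \<Rightarrow> ('x \<Rightarrow>\<^sub>0 nat) \<Rightarrow> bool" where
  "initial w F e \<longleftrightarrow> (\<forall>e'\<in>keys (F - single e 1). wt w e < wt w e')"

lemma initial_single [simp]: "initial w (single e 1) e"
  by (simp add: initial_def)

lemma initial_one: "initial w 1 0"
  using initial_single[of w 0] by simp

lemma initial_le: "initial w F e \<Longrightarrow> e' \<in> keys F \<Longrightarrow> wt w e \<le> wt w e'"
proof -
  assume i: "initial w F e" and e': "e' \<in> keys F"
  have "e' \<in> keys (F - single e 1) \<or> e' = e"
    using e' by (auto simp: in_keys_iff lookup_minus lookup_single when_def)
  thus ?thesis using i by (auto simp: initial_def less_imp_le)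
qed

lemma initial_mult:
  assumes F: "initial w F e" and G: "initial w G e'"
  shows "initial w (F * G) (e + e')"
  unfolding initial_def
proof
  fix d assume d: "d \<in> keys (F * G - single (e + e') 1)"
  let ?F = "F - single e 1" and ?G = "G - single e' 1"
  have "F * G - single (e + e') 1 = ?F * G + single e 1 * ?G"
    by (simp add: algebra_simps mult_single)
  hence "d \<in> keys (?F * G) \<or> d \<in> keys (single e 1 * ?G)"
    using d Poly_Mapping.keys_add by fastforce
  thus "wt w (e + e') < wt w d"
  proof
    assume "d \<in> keys (?F * G)"
    then obtain a b where ab: "d = a + b" "a \<in> keys ?F" "b \<in> keys G"
      using keys_mult by blast
    have "wt w e < wt w a" using F ab(2) by (simp add: initial_def)
    moreover have "wt w e' \<le> wt w b" using initial_le[OF G ab(3)] .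
    ultimately show ?thesis by (simp add: ab(1) wt_add)
  next
    assume "d \<in> keys (single e 1 * ?G)"
    then obtain a b where ab: "d = a + b" "a \<in> keys (single e (1 :: 'b))"
      "b \<in> keys ?G"
      using keys_mult by blast
    have "wt w e' < wt w b" using G ab(3) by (simp add: initial_def)
    moreover have "a = e" using ab(2) by (simp split: if_splits)
    ultimately show ?thesis by (simp add: ab(1) wt_add)
  qed
qed

lemma initial_prod_mset:
  "(\<And>x. x \<in># M \<Longrightarrow> initial w (F x) (E x)) \<Longrightarrow>
     initial w (\<Prod>x\<in>#M. F x) (\<Sum>x\<in>#M. E x)"
  by (induction M) (auto intro: initial_mult initial_one)

lemma initial_sum:
  assumes "finite T" and "t0 \<in> T" and "F t0 = single E 1"
    and "\<And>t e. t \<in> T \<Longrightarrow> t \<noteq> t0 \<Longrightarrow> e \<in> keys (F t) \<Longrightarrow> wt w E < wt w e"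
  shows "initial w (sum F T) E"
  unfolding initial_def
proof
  fix e assume e: "e \<in> keys (sum F T - single E 1)"
  have "sum F T - single E 1 = sum F (T - {t0})"
    using sum.remove[OF assms(1,2), of F] assms(3) by simp
  then obtain t where "t \<in> T - {t0}" "e \<in> keys (F t)"
    using e keys_sum[of F "T - {t0}"] by auto
  thus "wt w E < wt w e" using assms(4) by blast
qed

text \<open>Among the terms with a nonzero coefficient, take one whose initial monomial has the least
weight: no other term contains this monomial.\<close>

lemma initial_independent:
  fixes c :: "'t \<Rightarrow> 'a::comm_ring_1"
  assumes T: "finite T" and init: "\<And>t. t \<in> T \<Longrightarrow> initial w (F t) (E t)" and inj: "inj_on E T"
    and zero: "(\<Sum>t\<in>T. Const (c t) * F t) = 0" and t: "t \<in> T"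
  shows "c t = 0"
proof (rule ccontr)
  assume "c t \<noteq> 0"
  hence "finite {t \<in> T. c t \<noteq> 0}" "{t \<in> T. c t \<noteq> 0} \<noteq> {}" using T t by auto
  then obtain s where s: "s \<in> T" "c s \<noteq> 0" and
    min: "\<And>t. t \<in> T \<Longrightarrow> c t \<noteq> 0 \<Longrightarrow> wt w (E s) \<le> wt w (E t)"
    using ex_min_if_finite[of "(\<lambda>t. wt w (E t)) ` {t \<in> T. c t \<noteq> 0}"]
    by (auto simp: not_less Ball_def)
  have look: "c t * lookup (F t) (E s) = (if t = s then c s else 0)" if t: "t \<in> T" for t
  proof (cases "c t = 0")
    case False
    have "E s \<notin> keys (F t - single (E t) 1)"
      using init[OF t] min[OF t False] by (auto simp: initial_def)
    hence "lookup (F t) (E s) = lookup (single (E t) 1) (E s)"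
      by (simp add: in_keys_iff lookup_minus)
    thus ?thesis using inj_onD[OF inj, of t s] t s(1) by (auto simp: lookup_single when_def)
  qed (use s in auto)
  have "0 = lookup (\<Sum>t\<in>T. Const (c t) * F t) (E s)" by (simp add: zero)
  also have "\<dots> = (\<Sum>t\<in>T. if t = s then c s else 0)"
    unfolding lookup_sum lookup_Const_mult using look by (intro sum.cong) auto
  also have "\<dots> = c s" using T s(1) by simp
  finally show False using s(2) by simp
qed

lemma sum_lessThan_card_le: "finite S \<Longrightarrow> \<Sum>{..<card S} \<le> \<Sum>S" for S :: "nat set"
proof (induction rule: finite_linorder_max_induct)
  case (insert b A)
  have "card A \<le> card {..<b}" using insert by (intro card_mono) auto
  moreover have "b \<notin> A" using insert by auto
  ultimately show ?case using insert by simp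
qed simp

text \<open>Abel summation: the difference of the two sums is a combination with positive
coefficients of the partial sums \<open>D t\<close> of \<open>f i - i\<close>.  These are nonnegative, since \<open>f\<close> takes
distinct values.\<close>

lemma rearrangement:
  fixes g f :: "nat \<Rightarrow> nat"
  assumes dec: "\<And>i. Suc i < r \<Longrightarrow> g (Suc i) < g i" and pos: "\<And>i. i < r \<Longrightarrow> 0 < g i"
    and inj: "inj_on f {..<r}"
  shows "(\<forall>i<r. f i = i) \<or> (\<Sum>i<r. g i * i) < (\<Sum>i<r. g i * f i)"
proof -
  define d where "d = (\<lambda>i. int (f i) - int i)"
  define D where "D = (\<lambda>t. \<Sum>i<t. d i)"
  have D0: "0 \<le> D t" if "t \<le> r" for t
  proof -
    have i: "inj_on f {..<t}" by (rule inj_on_subset[OF inj]) (use that in auto)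
    have "\<Sum>{..<t} \<le> \<Sum>(f ` {..<t})"
      using sum_lessThan_card_le[of "f ` {..<t}"] card_image[OF i] by simp
    also have "\<dots> = (\<Sum>i<t. f i)" using sum.reindex[OF i, of id] by simp
    finally have "int (\<Sum>{..<t}) \<le> int (\<Sum>i<t. f i)" by (simp only: of_nat_le_iff)
    thus ?thesis unfolding D_def d_def sum_subtractf of_nat_sum by simp
  qed
  \<comment> \<open>Since \<open>g\<close> drops by at least 1 in each step, the multiple \<open>g t - 1\<close> of the last partial sum
    covers the multiple \<open>g (t + 1)\<close> that the next step needs.\<close>
  have step: "(\<Sum>s\<le>t. D (Suc s)) + (int (g t) - 1) * D (Suc t) \<le> (\<Sum>i\<le>t. int (g i) * d i)"
    if "t < r" for t
    using that
  proof (induction t)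
    case 0
    show ?case by (simp add: D_def algebra_simps)
  next
    case (Suc t)
    have "int (g (Suc t)) * D (Suc t) \<le> (int (g t) - 1) * D (Suc t)"
      using dec[OF Suc.prems] D0[of "Suc t"] Suc.prems by (intro mult_right_mono) auto
    moreover have "D (Suc (Suc t)) = D (Suc t) + d (Suc t)" by (simp add: D_def)
    ultimately show ?case using Suc by (simp add: algebra_simps)
  qed
  show ?thesis
  proof (rule disjCI)
    assume "\<not> (\<Sum>i<r. g i * i) < (\<Sum>i<r. g i * f i)"
    moreover have "(\<Sum>i<r. int (g i) * d i) = int (\<Sum>i<r. g i * f i) - int (\<Sum>i<r. g i * i)"
      by (simp add: d_def right_diff_distrib sum_subtractf)
    ultimately have le: "(\<Sum>i<r. int (g i) * d i) \<le> 0" by linarith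
    show "\<forall>i<r. f i = i"
    proof (cases r)
      case (Suc t)
      have "0 \<le> (int (g t) - 1) * D (Suc t)"
        using pos[of t] D0[of "Suc t"] Suc by (intro mult_nonneg_nonneg) auto
      hence "(\<Sum>s\<le>t. D (Suc s)) \<le> 0"
        using step[of t] le Suc by (simp add: lessThan_Suc_atMost)
      moreover have nn: "\<And>s. s \<in> {..t} \<Longrightarrow> 0 \<le> D (Suc s)" using D0 Suc by auto
      ultimately have "(\<Sum>s\<le>t. D (Suc s)) = 0" using sum_nonneg[of "{..t}"
          "\<lambda>s. D (Suc s)", OF nn] by linarith
      hence "\<forall>s\<in>{..t}. D (Suc s) = 0" using sum_nonneg_eq_0_iff[of "{..t}"
          "\<lambda>s. D (Suc s)"] nn by auto
      hence Dz: "D i = 0" if "i \<le> r" for i using that Suc by (cases i) (auto simp: D_def)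
      have "d i = 0" if "i < r" for i
        using Dz[of i] Dz[of "Suc i"] that by (simp add: D_def)
      thus ?thesis by (simp add: d_def)
    qed simp
  qed
qed

section \<open>Minors and their initial monomials\<close>

text \<open>The Cauchy-Binet formula before collecting the maps \<open>f\<close> with the same image; maps that
are not injective give two equal rows.\<close>

lemma minor_mult:
  fixes U W :: "'a::comm_ring_1 mat"
  assumes U: "U \<in> carrier_mat m n" and W: "W \<in> carrier_mat n q"
    and A: "length A = r" "set A \<subseteq> {0..<m}" and B: "length B = r" "set B \<subseteq> {0..<q}"
  shows "minor (U * W) A B = (\<Sum>f\<in>{f \<in> {0..<r} \<rightarrow>\<^sub>E {0..<n}. inj_on f {0..<r}}.
    (\<Prod>i = 0..<r. U $$ (A ! i, f i)) * det (mat r r (\<lambda>(i, j). W $$ (f i, B ! j))))"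
proof -
  let ?P = "{p. p permutes {0..<r}}" and ?F = "{0..<r} \<rightarrow>\<^sub>E {0..<n}"
  let ?W = "\<lambda>f. mat r r (\<lambda>(i, j). W $$ (f i, B ! j))"
  have fin: "finite ?F" by (intro finite_PiE) auto
  have Ai: "A ! i < m" "B ! i < q" if "i < r" for i
    using that A B nth_less[of A m] nth_less[of B q] by auto
  have "minor (U * W) A B
      = (\<Sum>p\<in>?P. signof p * (\<Prod>i = 0..<r. \<Sum>k = 0..<n. U $$ (A ! i, k) * W $$ (k, B ! p i)))"
    unfolding minor_def A(1) B(1) det_def'[OF mat_carrier]
  proof (intro sum.cong refl arg_cong2[of _ _ _ _ "(*)"] prod.cong)
    fix p i assume p: "p \<in> ?P" and i: "i \<in> {0..<r}"
    have "p i < r" using permutes_in_image[of p "{0..<r}" i] p i by auto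
    thus "mat r r (\<lambda>(i, j). (U * W) $$ (A ! i, B ! j)) $$ (i, p i)
        = (\<Sum>k = 0..<n. U $$ (A ! i, k) * W $$ (k, B ! p i))"
      using i U W Ai by (simp add: scalar_prod_def)
  qed
  also have "\<dots> = (\<Sum>p\<in>?P. \<Sum>f\<in>?F. (\<Prod>i = 0..<r. U $$ (A ! i, f i))
      * (signof p * (\<Prod>i = 0..<r. W $$ (f i, B ! p i))))"
    by (simp add: prod_sum_PiE prod.distrib sum_distrib_left mult.left_commute)
  also have "\<dots> = (\<Sum>f\<in>?F. \<Sum>p\<in>?P. (\<Prod>i = 0..<r. U $$ (A ! i, f i))
      * (signof p * (\<Prod>i = 0..<r. W $$ (f i, B ! p i))))"
    by (rule sum.swap)
  also have "\<dots> = (\<Sum>f\<in>?F. (\<Prod>i = 0..<r. U $$ (A ! i, f i)) * det (?W f))"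
  proof (intro sum.cong refl)
    fix f
    have "det (?W f) = (\<Sum>p\<in>?P. signof p * (\<Prod>i = 0..<r. W $$ (f i, B ! p i)))"
      unfolding det_def'[OF mat_carrier]
    proof (intro sum.cong refl arg_cong2[of _ _ _ _ "(*)"] prod.cong)
      fix p i assume p: "p \<in> ?P" and i: "i \<in> {0..<r}"
      have "p i < r" using permutes_in_image[of p "{0..<r}" i] p i by auto
      thus "?W f $$ (i, p i) = W $$ (f i, B ! p i)" using i by simp
    qed
    thus "(\<Sum>p\<in>?P. (\<Prod>i = 0..<r. U $$ (A ! i, f i))
        * (signof p * (\<Prod>i = 0..<r. W $$ (f i, B ! p i))))
      = (\<Prod>i = 0..<r. U $$ (A ! i, f i)) * det (?W f)"
      by (simp add: sum_distrib_left)
  qed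
  also have "\<dots> = (\<Sum>f\<in>{f \<in> ?F. inj_on f {0..<r}}.
      (\<Prod>i = 0..<r. U $$ (A ! i, f i)) * det (?W f))"
  proof (intro sum.mono_neutral_right ballI)
    fix f assume "f \<in> ?F - {f \<in> ?F. inj_on f {0..<r}}"
    then obtain i j where ij: "i < r" "j < r" "i \<noteq> j" "f i = f j" by (auto simp: inj_on_def)
    have "det (?W f) = 0"
      by (rule det_identical_rows[OF _ ij(3,1,2)]) (use ij in \<open>auto intro!: eq_vecI\<close>)
    thus "(\<Prod>i = 0..<r. U $$ (A ! i, f i)) * det (?W f) = 0" by simp
  qed (use fin in auto)
  finally show ?thesis .
qed

lemma minor_mult_eq_0:
  fixes U W :: "'a::comm_ring_1 mat"
  assumes "U \<in> carrier_mat m n" and "W \<in> carrier_mat n q"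
    and "length A = r" "set A \<subseteq> {0..<m}" and "length B = r" "set B \<subseteq> {0..<q}" and "n < r"
  shows "minor (U * W) A B = 0"
proof -
  have "\<not> inj_on f {0..<r}" if "f \<in> {0..<r} \<rightarrow>\<^sub>E {0..<n}" for f
    using that card_inj_on_le[of f "{0..<r}" "{0..<n}"] assms(7) by auto
  hence none: "{f \<in> {0..<r} \<rightarrow>\<^sub>E {0..<n}. inj_on f {0..<r}} = {}" by blast
  show ?thesis unfolding minor_mult[OF assms(1-6)] none by simp
qed

lemma minor_transpose:
  assumes "M \<in> carrier_mat m q" and "length A = length B" and "set A \<subseteq> {0..<m}" and "set B
      \<subseteq> {0..<q}"
  shows "minor M\<^sup>T B A = minor M A B"
proof -
  let ?N = "mat (length A) (length B) (\<lambda>(i, j). M $$ (A ! i, B ! j))"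
  have "A ! i < m" "B ! i < q" if "i < length A" for i
    using that assms nth_less[of A m] nth_less[of B q] by auto
  hence "mat (length B) (length A) (\<lambda>(i, j). M\<^sup>T $$ (B ! i, A ! j)) = ?N\<^sup>T"
    using assms by (intro eq_matI) auto
  thus ?thesis unfolding minor_def using det_transpose[of ?N "length A"] assms(2) by simp
qed

lemma minor_eq_rdet:
  "length A = length B \<Longrightarrow> minor M A B = rdet (length B) (\<lambda>i j. M $$ (i, B ! j)) A"
  by (simp add: minor_def rdet_def)

lemma minor_full_columns: "length A = n \<Longrightarrow> minor M A [0..<n] = rdet n (\<lambda>i j. M $$ (i, j)) A"
  by (simp add: minor_eq_rdet) (rule rdet_cong, simp)

text \<open>The factor \<open>M - i\<close> decreases with the row (or column) index, so by the rearrangement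
inequality the weight of a term of a minor is least if small column indices go with small row
indices.\<close>

fun coord_weight :: "nat \<Rightarrow> coord \<Rightarrow> nat" where
  "coord_weight M (U_coord i k) = (M - i) * k"
| "coord_weight M (W_coord k j) = (M - j) * k"

fun row_tuple :: "gen \<Rightarrow> nat list" where
  "row_tuple (X A B) = A" | "row_tuple (Y I) = I" | "row_tuple (Z J) = []"

fun col_tuple :: "gen \<Rightarrow> nat list" where
  "col_tuple (X A B) = B" | "col_tuple (Y I) = []" | "col_tuple (Z J) = J"

text \<open>The exponent of the product of the diagonal entries.  For \<open>p(A,B)\<close> these are the
diagonals of two minors: of \<open>U\<close> with rows \<open>A\<close> and the first columns, and of \<open>W\<close> with the first
rows and columns \<open>B\<close>.\<close>

definition diagonal :: "gen \<Rightarrow> coord \<Rightarrow>\<^sub>0 nat" where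
  "diagonal g = (\<Sum>i<length (row_tuple g). single (U_coord (row_tuple g ! i) i) 1)
     + (\<Sum>i<length (col_tuple g). single (W_coord i (col_tuple g ! i)) 1)"

lemma prod_Var:
  "(\<Prod>i\<in>S. Var (x i)) = (single (\<Sum>i\<in>S. single (x i) 1) 1 :: ('x, 'a::comm_ring_1) mpoly)"
  by (induction S rule: infinite_finite_induct) (auto simp: Var_def mult_single)

lemma keys_signof_single:
  "e' \<in> keys (signof p * single e (1 :: 'a::comm_ring_1)) \<Longrightarrow> e' = e"
  by (auto simp: sign_def in_keys_iff lookup_single when_def split: if_splits)

lemma permutes_idI:
  "p permutes {0..<r} \<Longrightarrow> \<forall>i<r. p i = i \<Longrightarrow> p = id"
  by (rule ext) (auto simp: permutes_def)

lemma det_Var: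
  "det (mat r r (\<lambda>(i, j). Var (x i j))) = (\<Sum>p | p permutes {0..<r}.
     signof p * single (\<Sum>i = 0..<r. single (x i (p i)) 1) (1 :: 'a::comm_ring_1))"
  unfolding det_def'[OF mat_carrier] prod_Var[symmetric]
proof (intro sum.cong refl arg_cong2[of _ _ _ _ "(*)"] prod.cong)
  fix p i assume "p \<in> {p. p permutes {0..<r}}" "i \<in> {0..<r}"
  thus "mat r r (\<lambda>(i, j). Var (x i j)) $$ (i, p i) = Var (x i (p i))"
    using permutes_in_image[of p "{0..<r}" i] by auto
qed

lemma initial_det:
  assumes "\<And>p. p permutes {0..<r} \<Longrightarrow> p \<noteq> id \<Longrightarrow> (\<Sum>i<r. w (x i i)) < (\<Sum>i<r. w (x i (p i)))"
  shows "initial w (det (mat r r (\<lambda>(i, j). Var (x i j))) :: ('x, 'a::comm_ring_1) mpoly)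
    (\<Sum>i<r. single (x i i) 1)"
  unfolding det_Var
proof (rule initial_sum[of _ id])
  fix p and e :: "'x \<Rightarrow>\<^sub>0 nat" assume "p \<in> {p. p permutes {0..<r}}" "p \<noteq> id"
    "e \<in> keys (signof p * single
      (\<Sum>i = 0..<r. single (x i (p i)) 1) (1 :: 'a))"
  thus "wt w (\<Sum>i<r. single (x i i) 1) < wt w e"
    using assms[of p] by (auto dest!: keys_signof_single simp: wt_sum lessThan_atLeast0)
qed (auto simp: permutes_id finite_permutations lessThan_atLeast0)

lemma tuple_gap:
  assumes "I \<in> I_set r m" and "m \<le> M"
  shows "Suc i < r \<Longrightarrow> M - I ! Suc i < M - I ! i" and "i < r \<Longrightarrow> 0 < M - I ! i"
proof -
  note I = I_setD[OF assms(1)]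
  have lt: "I ! i < m" if "i < r" for i using that I nth_less[of I m] by auto
  show "Suc i < r \<Longrightarrow> M - I ! Suc i < M - I ! i"
    using sorted_wrt_nth_less[OF I(2), of i "Suc i"] I(1) lt[of "Suc i"] assms(2) by auto
  show "i < r \<Longrightarrow> 0 < M - I ! i" using lt[of i] assms(2) by auto
qed

lemma tuple_rearrangement:
  assumes "I \<in> I_set r m" and "m \<le> M" and "inj_on f {..<r}"
  shows "(\<forall>i<r. f i = i) \<or> (\<Sum>i<r. (M - I ! i) * i) < (\<Sum>i<r. (M - I ! i) * f i)"
  by (rule rearrangement) (use tuple_gap[OF assms(1,2)] assms(3) in auto)

lemma sum_permute_inv:
  fixes p g h :: "nat \<Rightarrow> nat"
  assumes "p permutes {0..<r}"
  shows "(\<Sum>i<r. g (p i) * h i) = (\<Sum>i<r. g i * h (Hilbert_Choice.inv p i))"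
proof -
  have "(\<Sum>i<r. g i * h (Hilbert_Choice.inv p i)) = (\<Sum>i<r. ((\<lambda>i. g i * h (Hilbert_Choice.inv p i))
      \<circ> p) i)"
    unfolding lessThan_atLeast0 by (rule sum.permute[OF assms])
  thus ?thesis by (simp add: permutes_inverses[OF assms])
qed

lemma initial_u_fun:
  assumes "I \<in> I_set n m" and "m \<le> M"
  shows "initial (coord_weight M) (u_fun n I (generic_point n m q) :: (coord, 'a::comm_ring_1)
      mpoly)
    (diagonal (Y I))"
proof -
  note I = I_setD[OF assms(1)]
  have "mat n n (\<lambda>(i, j). mat m n (\<lambda>(i, k). Var (U_coord i k)) $$ (I ! i, [0..<n] ! j))
      = mat n n (\<lambda>(i, j). Var (U_coord (I ! i) j) :: (coord, 'a) mpoly)"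
    using I nth_less[of I m] by (intro eq_matI) auto
  hence "u_fun n I (generic_point n m q)
      = det (mat n n (\<lambda>(i, j). Var (U_coord (I ! i) j) :: (coord, 'a) mpoly))"
    by (simp add: u_fun_def minor_def generic_point_def I(1))
  moreover have "initial (coord_weight M) \<dots> (\<Sum>i<n. single (U_coord (I ! i) i) 1)"
  proof (rule initial_det)
    fix p assume p: "p permutes {0..<n}" "p \<noteq> id"
    have "inj_on p {..<n}" using permutes_inj_on[OF p(1)] by blast
    thus "(\<Sum>i<n. coord_weight M (U_coord (I ! i) i))
        < (\<Sum>i<n. coord_weight M (U_coord (I ! i) (p i)))"
      using tuple_rearrangement[OF assms, of p] permutes_idI[OF p(1)] p(2) by auto
  qed
  ultimately show ?thesis by (simp add: diagonal_def I(1))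
qed

lemma initial_xi_fun:
  assumes "J \<in> I_set n q" and "q \<le> M"
  shows "initial (coord_weight M) (xi_fun n J (generic_point n m q) :: (coord, 'a::comm_ring_1)
      mpoly)
    (diagonal (Z J))"
proof -
  note J = I_setD[OF assms(1)]
  have "mat n n (\<lambda>(i, j). mat n q (\<lambda>(i, k). Var (W_coord i k)) $$ ([0..<n] ! i, J ! j))
      = mat n n (\<lambda>(i, j). Var (W_coord i (J ! j)) :: (coord, 'a) mpoly)"
    using J nth_less[of J q] by (intro eq_matI) auto
  hence "xi_fun n J (generic_point n m q)
      = det (mat n n (\<lambda>(i, j). Var (W_coord i (J ! j)) :: (coord, 'a) mpoly))"
    by (simp add: xi_fun_def minor_def generic_point_def J(1))
  moreover have "initial (coord_weight M) \<dots> (\<Sum>i<n. single (W_coord i (J ! i)) 1)"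
  proof (rule initial_det)
    fix p assume p: "p permutes {0..<n}" "p \<noteq> id"
    have p': "Hilbert_Choice.inv p permutes {0..<n}" "Hilbert_Choice.inv p \<noteq> id"
      using permutes_inv[OF p(1)] p by (metis permutes_inv_eq id_apply eq_id_iff)+
    have "inj_on (Hilbert_Choice.inv p) {..<n}" using permutes_inj_on[OF p'(1)] by blast
    hence "(\<Sum>i<n. (M - J ! i) * i) < (\<Sum>i<n. (M - J ! i) * Hilbert_Choice.inv p i)"
      using tuple_rearrangement[OF assms, of "Hilbert_Choice.inv p"] permutes_idI[OF p'(1)] p'(2)
          by auto
    also have "\<dots> = (\<Sum>i<n. (M - J ! (p i)) * i)"
      using sum_permute_inv[OF p(1), of "\<lambda>i. M - J ! i" "\<lambda>i. i"] by simp
    finally show "(\<Sum>i<n. coord_weight M (W_coord i (J ! i)))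
        < (\<Sum>i<n. coord_weight M (W_coord i (J ! p i)))" by simp
  qed
  ultimately show ?thesis by (simp add: diagonal_def J(1))
qed

text \<open>A term is given by an injective map \<open>f\<close>, which assigns to a row its column in \<open>U\<close>, and a
permutation.  The rearrangement inequality for \<open>U\<close> forces \<open>f\<close> to be the identity, the one for
\<open>W\<close> forces it for the composition of \<open>f\<close> with the inverse permutation.\<close>

lemma initial_p_fun:
  assumes A: "A \<in> I_set r m" "m \<le> M" and B: "B \<in> I_set r q" "q \<le> M" and "r \<le> n"
  shows "initial (coord_weight M) (p_fun A B (generic_point n m q) :: (coord, 'a::comm_ring_1)
      mpoly)
    (diagonal (X A B))"
proof -
  let ?F = "{f \<in> {0..<r} \<rightarrow>\<^sub>E {0..<n}. inj_on f {0..<r}}" and ?P = "{p. p permutes {0..<r}}"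
  let ?e = "\<lambda>f. \<Sum>i = 0..<r. single (U_coord (A ! i) (f i)) (1 :: nat)"
  let ?d = "\<lambda>f p. \<Sum>i = 0..<r. single (W_coord (f i) (B ! p i)) (1 :: nat)"
  let ?s = "\<lambda>f p. signof p * single (?e f + ?d f p) (1 :: 'a)"
  let ?t = "\<lambda>(f, p). ?s f p"
  note A' = I_setD[OF A(1)] and B' = I_setD[OF B(1)]
  have Ai: "A ! i < m" "B ! i < q" if "i < r" for i
    using that A' B' nth_less[of A m] nth_less[of B q] by auto
  have finF: "finite ?F" by (intro finite_Collect_conjI disjI1) (auto intro!: finite_PiE)
  have finP: "finite ?P" by (simp add: finite_permutations)
  have "p_fun A B (generic_point n m q) = (\<Sum>f\<in>?F. \<Sum>p\<in>?P. ?s f p)"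
    unfolding p_fun_def generic_point_def prod.case
      minor_mult[OF mat_carrier mat_carrier A'(1,3) B'(1,3)]
  proof (intro sum.cong refl)
    fix f assume f: "f \<in> ?F"
    hence fi: "f i < n" if "i < r" for i using that by (auto simp: PiE_iff)
    have "(\<Prod>i = 0..<r. mat m n (\<lambda>(i, k). Var (U_coord i k)) $$ (A ! i, f i))
        = (\<Prod>i = 0..<r. Var (U_coord (A ! i) (f i)) :: (coord, 'a) mpoly)"
      using Ai fi by (intro prod.cong) auto
    moreover have "mat r r (\<lambda>(i, j). mat n q (\<lambda>(k, j). Var (W_coord k j)) $$ (f i, B ! j))
        = mat r r (\<lambda>(i, j). Var (W_coord (f i) (B ! j)) :: (coord, 'a) mpoly)"
      using Ai fi by (intro eq_matI) auto
    ultimately show "(\<Prod>i = 0..<r. mat m n (\<lambda>(i, k). Var (U_coord i k)) $$ (A ! i, f i))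
        * det (mat r r (\<lambda>(i, j). mat n q (\<lambda>(k, j). Var (W_coord k j)) $$ (f i, B ! j)))
        = (\<Sum>p\<in>?P. ?s f p)"
      by (simp only: prod_Var det_Var sum_distrib_left prod.case mult.left_commute mult_single
          mult_1_right)
  qed
  also have "\<dots> = sum ?t (?F \<times> ?P)" by (simp add: sum.cartesian_product)
  finally have eq: "p_fun A B (generic_point n m q) = sum ?t (?F \<times> ?P)" .
  let ?id = "restrict id {0..<r}"
  have diag: "diagonal (X A B) = ?e ?id + ?d ?id id"
    unfolding diagonal_def by (simp add: A'(1) B'(1) lessThan_atLeast0)
  have wt: "wt (coord_weight M) (?e f + ?d f p)
      = (\<Sum>i<r. (M - A ! i) * f i) + (\<Sum>i<r. (M - B ! i) * f (Hilbert_Choice.inv p i))" if "p \<in> ?P"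
          for f p
    using that sum_permute_inv[of p r "\<lambda>i. M - B ! i" f]
    by (simp add: wt_add wt_sum lessThan_atLeast0)
  show ?thesis unfolding eq
  proof (rule initial_sum[of _ "(?id, id)"])
    fix t e assume t: "t \<in> ?F \<times> ?P" "t \<noteq> (?id, id)" and e: "e \<in> keys (?t t)"
    obtain f p where fp: "t = (f, p)" "f \<in> {0..<r} \<rightarrow>\<^sub>E {0..<n}" "inj_on f {..<r}"
        "p permutes {0..<r}"
      using t(1) by (cases t) (auto simp: lessThan_atLeast0)
    have "e = ?e f + ?d f p" using e fp(1) by (auto dest!: keys_signof_single)
    hence we: "wt (coord_weight M) e
        = (\<Sum>i<r. (M - A ! i) * f i) + (\<Sum>i<r. (M - B ! i) * f (Hilbert_Choice.inv p i))"
            using wt fp(4) by simp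
    have w0: "wt (coord_weight M) (diagonal (X A B))
        = (\<Sum>i<r. (M - A ! i) * i) + (\<Sum>i<r. (M - B ! i) * i)"
      unfolding diag by (subst wt) (auto simp: permutes_id)
    have p': "Hilbert_Choice.inv p permutes {0..<r}" by (rule permutes_inv[OF fp(4)])
    have "inj_on (f \<circ> Hilbert_Choice.inv p) {..<r}"
      using fp(3) permutes_inj_on[OF p', of "{..<r}"] permutes_image[OF p']
      by (auto simp: lessThan_atLeast0 intro!: comp_inj_on)
    from tuple_rearrangement[OF A fp(3)] tuple_rearrangement[OF B this]
    have "(\<forall>i<r. f i = i) \<and> (\<forall>i<r. f (Hilbert_Choice.inv p i) = i)
        \<or> wt (coord_weight M) (diagonal (X A B)) < wt (coord_weight M) e"
      unfolding we w0 by auto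
    moreover have False if id: "\<forall>i<r. f i = i" "\<forall>i<r. f (Hilbert_Choice.inv p i) = i"
    proof -
      have "Hilbert_Choice.inv p i = i" if "i < r" for i
        using id that permutes_in_image[OF p', of i] by auto
      hence "Hilbert_Choice.inv p = id" using permutes_idI[OF p'] by blast
      hence "p = id" using permutes_inv_inv[OF fp(4)] by simp
      moreover have "f = ?id" using fp(2) id(1) by (intro ext) (auto simp: PiE_def extensional_def
          restrict_def)
      ultimately show False using t(2) fp(1) by simp
    qed
    ultimately show "wt (coord_weight M) (diagonal (X A B)) < wt (coord_weight M) e" by blast
  qed (use finF finP \<open>r \<le> n\<close> diag in \<open>auto simp: permutes_id inj_on_def\<close>)
qed

lemma initial_gen_fun:
  assumes "g \<in> gens n m q"
  shows "initial (coord_weight (m + q)) (gen_fun n m q g :: (coord, 'a::comm_ring_1) mpoly)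
      (diagonal g)"
  using assms
  by (auto simp: gens_def H_p_def H_u_def H_xi_def intro!: initial_p_fun initial_u_fun
      initial_xi_fun)

section \<open>Independence of the standard monomials\<close>

fun comparable :: "gen \<Rightarrow> gen \<Rightarrow> bool" where
  "comparable (X A B) (X A' B') \<longleftrightarrow> (A, B) \<succeq>\<^sub>p (A', B') \<or> (A', B') \<succeq>\<^sub>p (A, B)"
| "comparable (Y I) (Y I') \<longleftrightarrow> I \<succeq> I' \<or> I' \<succeq> I"
| "comparable (Z J) (Z J') \<longleftrightarrow> J \<succeq> J' \<or> J' \<succeq> J"
| "comparable (X A B) (Y I) \<longleftrightarrow> A \<succeq> I"
| "comparable (Y I) (X A B) \<longleftrightarrow> A \<succeq> I"
| "comparable (X A B) (Z J) \<longleftrightarrow> B \<succeq> J"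
| "comparable (Z J) (X A B) \<longleftrightarrow> B \<succeq> J"
| "comparable (Y I) (Z J) \<longleftrightarrow> False"
| "comparable (Z J) (Y I) \<longleftrightarrow> False"

text \<open>Pairwise comparability, which is a condition on the set of factors alone since every
generator is comparable with itself.\<close>

definition standard :: "gen multiset \<Rightarrow> bool" where
  "standard M \<longleftrightarrow> (\<forall>g\<in>#M. \<forall>h\<in>#M. comparable g h)"

definition diagonals :: "gen multiset \<Rightarrow> coord \<Rightarrow>\<^sub>0 nat" where
  "diagonals M = (\<Sum>g\<in>#M. diagonal g)"

lemma diagonals_simps [simp]:
  "diagonals {#} = 0" "diagonals (add_mset g M) = diagonal g + diagonals M"
  by (simp_all add: diagonals_def)

lemma keys_add_nat: "keys (e + e') = keys e \<union> keys e'"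
  for e e' :: "'x \<Rightarrow>\<^sub>0 nat"
  by (auto simp: in_keys_iff lookup_add)

lemma keys_sum_nat: "finite S \<Longrightarrow> keys (\<Sum>i\<in>S. e i) = (\<Union>i\<in>S. keys (e i))"
  for e :: "'i \<Rightarrow> 'x \<Rightarrow>\<^sub>0 nat"
  by (induction S rule: finite_induct) (auto simp: keys_add_nat)

lemma keys_diagonals:
  "U_coord i j \<in> keys (diagonals M)
     \<longleftrightarrow> (\<exists>g\<in>#M. j < length (row_tuple g) \<and> row_tuple g ! j = i)"
  "W_coord j i \<in> keys (diagonals M)
     \<longleftrightarrow> (\<exists>g\<in>#M. j < length (col_tuple g) \<and> col_tuple g ! j = i)"
  by (induction M) (auto simp: keys_add_nat diagonal_def keys_sum_nat)

definition in_U :: "coord \<Rightarrow> nat" where "in_U x = (case x of U_coord _ _ \<Rightarrow> 1 | W_coord _ _ \<Rightarrow> 0)"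
definition in_W :: "coord \<Rightarrow> nat" where "in_W x = (case x of U_coord _ _ \<Rightarrow> 0 | W_coord _ _ \<Rightarrow> 1)"

lemma wt_diagonals:
  "wt in_U (diagonals M) = (\<Sum>g\<in>#M. length (row_tuple g))"
  "wt in_W (diagonals M) = (\<Sum>g\<in>#M. length (col_tuple g))"
  by (induction M) (auto simp: wt_add diagonal_def wt_sum in_U_def in_W_def)

lemma chain_least:
  assumes "finite S" and "S \<noteq> {}" and "\<And>x y. x \<in> S \<Longrightarrow> y \<in> S \<Longrightarrow> R x y \<or> R y x"
    and "\<And>x y z. R x y \<Longrightarrow> R y z \<Longrightarrow> R x z"
  shows "\<exists>l\<in>S. \<forall>x\<in>S. R x l"
  using assms(1-3)
proof (induction rule: finite_ne_induct)
  case (singleton x)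
  thus ?case by blast
next
  case (insert x F)
  then obtain l where l: "l \<in> F" "\<forall>y\<in>F. R y l" by blast
  show ?case
  proof (cases "R x l")
    case True
    thus ?thesis using l by blast
  next
    case False
    hence "R l x" using insert.prems l(1) by blast
    hence "\<forall>y\<in>F. R y x" using l(2) assms(4) by blast
    moreover have "R x x" using insert.prems by blast
    ultimately show ?thesis by blast
  qed
qed

text \<open>The \<open>j\<close>-th entry of the least tuple is the least index that occurs in position \<open>j\<close>, and
its length is the largest occurring length.\<close>

lemma least_tuple_unique:
  fixes f :: "gen \<Rightarrow> nat list" and x :: "nat \<Rightarrow> nat \<Rightarrow> coord"
  assumes keys: "\<And>M i j. x i j \<in> keys (diagonals M)
      \<longleftrightarrow> (\<exists>g\<in>#M. j < length (f g) \<and> f g ! j = i)"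
    and "diagonals M = diagonals M'"
    and "g \<in># M" "\<forall>h\<in>#M. f h \<succeq> f g"
    and "g' \<in># M'" "\<forall>h\<in>#M'. f h \<succeq> f g'"
  shows "f g = f g'"
proof -
  have le: "f g \<succeq> f g'" if d: "diagonals M = diagonals M'"
    and g: "g \<in># M" and g': "\<forall>h\<in>#M'. f h \<succeq> f g'" for M M' g g'
  proof -
    have "j < length (f g') \<and> f g' ! j \<le> f g ! j"
      if j: "j < length (f g)" for j
    proof -
      have "x (f g ! j) j \<in> keys (diagonals M')"
        unfolding d[symmetric] keys using g j by blast
      then obtain h where "h \<in># M'" "j < length (f h)" "f h ! j = f g ! j"
        unfolding keys by blast
      thus ?thesis using g' by (fastforce simp: tuple_ge_def)
    qed
    thus ?thesis unfolding tuple_ge_def using linorder_not_less by blast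
  qed
  show ?thesis using le[of M M' g g'] le[of M' M g' g] assms(2-) tuple_ge_antisym by metis
qed

lemmas least_row_unique = least_tuple_unique[of U_coord row_tuple, OF keys_diagonals(1)]
lemmas least_col_unique = least_tuple_unique[of "\<lambda>i j. W_coord j i" col_tuple, OF keys_diagonals(2)]

lemma gens_iff:
  "X A B \<in> gens n m q \<longleftrightarrow> (A, B) \<in> H_p n m q" "Y I \<in> gens n m q \<longleftrightarrow> I \<in> H_u n m"
  "Z J \<in> gens n m q \<longleftrightarrow> J \<in> H_xi n q"
  by (auto simp: gens_def)

lemma gens_length:
  assumes "g \<in> gens n m q"
  shows "\<And>A B. g = X A B \<Longrightarrow> length A = length B \<and> A \<noteq> []"
    "\<And>I. g = Y I \<Longrightarrow> length I = n" "\<And>J. g = Z J \<Longrightarrow> length J = n"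
  using assms by (auto simp: gens_def H_p_def H_u_def H_xi_def I_set_def)

text \<open>A nonempty standard monomial has a least factor, and the type of this factor is visible
in the degrees: each \<open>p(A,B)\<close> has equal degrees in the entries of \<open>U\<close> and of \<open>W\<close>.\<close>

lemma standard_cases:
  assumes n: "1 \<le> n" and M: "standard M" "set_mset M \<subseteq> gens n m q"
  obtains
    (empty) "M = {#}" "wt in_U (diagonals M) = 0" "wt in_W (diagonals M) = 0"
  | (Y) g where "g \<in># M" "g = Y (row_tuple g)" "\<forall>h\<in>#M. row_tuple h \<succeq> row_tuple g"
      "wt in_W (diagonals M) < wt in_U (diagonals M)"
  | (Z) g where "g \<in># M" "g = Z (col_tuple g)" "\<forall>h\<in>#M. col_tuple h \<succeq> col_tuple g"
      "wt in_U (diagonals M) < wt in_W (diagonals M)"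
  | (X) g where "g \<in># M" "g = X (row_tuple g) (col_tuple g)"
      "\<forall>h\<in>#M. row_tuple h \<succeq> row_tuple g" "\<forall>h\<in>#M. col_tuple h \<succeq> col_tuple g"
      "0 < wt in_U (diagonals M)" "wt in_W (diagonals M) = wt in_U (diagonals M)"
proof -
  have comp: "comparable g h" if "g \<in># M" "h \<in># M" for g h
    using M(1) that by (auto simp: standard_def)
  have len: "length (row_tuple h) = length (col_tuple h) \<and> row_tuple h \<noteq> []"
    if "h \<in># M" "\<And>I. h \<noteq> Y I" "\<And>J. h \<noteq> Z J" for h
    using that M(2) gens_length[of h n m q] by (cases h) auto
  consider (e) "M = {#}" | (y) I where "Y I \<in># M" | (z) J where "Z J \<in># M"
    | (x) "M \<noteq> {#}" "\<And>I. Y I \<notin># M" "\<And>J. Z J \<notin># M" by blast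
  thus thesis
  proof cases
    case e
    thus thesis by (intro empty) auto
  next
    case (y I)
    have noZ: "Z J \<notin># M" for J using comp[OF y, of "Z J"] by auto
    let ?S = "{I. Y I \<in># M}"
    have "finite ?S"
      by (rule finite_vimageI[of "set_mset M" Y, unfolded vimage_def]) (auto simp: inj_on_def)
    hence "\<exists>L\<in>?S. \<forall>I\<in>?S. I \<succeq> L"
    proof (rule chain_least)
      show "?S \<noteq> {}" using y by blast
      show "I \<succeq> I' \<or> I' \<succeq> I" if "I \<in> ?S" "I' \<in> ?S" for I I'
        using comp[of "Y I" "Y I'"] that by simp
    qed (rule tuple_ge_trans)
    then obtain L where L: "Y L \<in># M" "\<forall>I\<in>?S. I \<succeq> L" by blast
    have "row_tuple h \<succeq> L" if h: "h \<in># M" for h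
      using comp[OF h L(1)] L(2) noZ h by (cases h) auto
    moreover have "wt in_W (diagonals M) < wt in_U (diagonals M)"
    proof -
      obtain N where N: "M = add_mset (Y L) N" using L(1) by (metis insert_DiffM)
      have "length (col_tuple h) \<le> length (row_tuple h)" if "h \<in># M" for h
        using that noZ len[of h] by (cases h) auto
      hence "(\<Sum>g\<in>#N. length (col_tuple g)) \<le> (\<Sum>g\<in>#N. length (row_tuple g))"
        by (intro sum_mset_mono) (simp add: N)
      moreover have "length L = n" using M(2) L(1) gens_length(2)[of "Y L" n m q] by blast
      ultimately show ?thesis unfolding wt_diagonals N using n by simp
    qed
    ultimately show thesis using L(1) by (intro Y[of "Y L"]) auto
  next
    case (z J)
    have noY: "Y I \<notin># M" for I using comp[OF z, of "Y I"] by auto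
    let ?S = "{J. Z J \<in># M}"
    have "finite ?S"
      by (rule finite_vimageI[of "set_mset M" Z, unfolded vimage_def]) (auto simp: inj_on_def)
    hence "\<exists>L\<in>?S. \<forall>I\<in>?S. I \<succeq> L"
    proof (rule chain_least)
      show "?S \<noteq> {}" using z by blast
      show "I \<succeq> I' \<or> I' \<succeq> I" if "I \<in> ?S" "I' \<in> ?S" for I I'
        using comp[of "Z I" "Z I'"] that by simp
    qed (rule tuple_ge_trans)
    then obtain L where L: "Z L \<in># M" "\<forall>I\<in>?S. I \<succeq> L" by blast
    have "col_tuple h \<succeq> L" if h: "h \<in># M" for h
      using comp[OF h L(1)] L(2) noY h by (cases h) auto
    moreover have "wt in_U (diagonals M) < wt in_W (diagonals M)"
    proof -
      obtain N where N: "M = add_mset (Z L) N" using L(1) by (metis insert_DiffM)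
      have "length (row_tuple h) \<le> length (col_tuple h)" if "h \<in># M" for h
        using that noY len[of h] by (cases h) auto
      hence "(\<Sum>g\<in>#N. length (row_tuple g)) \<le> (\<Sum>g\<in>#N. length (col_tuple g))"
        by (intro sum_mset_mono) (simp add: N)
      moreover have "length L = n" using M(2) L(1) gens_length(3)[of "Z L" n m q] by blast
      ultimately show ?thesis unfolding wt_diagonals N using n by simp
    qed
    ultimately show thesis using L(1) by (intro Z[of "Z L"]) auto
  next
    case x
    let ?R = "\<lambda>g h. (row_tuple g, col_tuple g) \<succeq>\<^sub>p (row_tuple h, col_tuple h)"
    have is_X: "h = X (row_tuple h) (col_tuple h)" if "h \<in># M" for h
      using that x by (cases h) auto
    have "\<exists>l\<in>#M. \<forall>h\<in>#M. ?R h l"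
    proof (rule chain_least)
      show "?R g h \<or> ?R h g" if "g \<in># M" "h \<in># M" for g h
        using comp[OF that] is_X[OF that(1)] is_X[OF that(2)] by (metis comparable.simps(1))
      show "?R g l" if "?R g h" "?R h l" for g h l
        using that unfolding pair_ge_def by (blast intro: tuple_ge_trans)
    qed (use x(1) in auto)
    then obtain l where l: "l \<in># M" "\<forall>h\<in>#M. ?R h l" by blast
    have len': "length (row_tuple h) = length (col_tuple h) \<and> row_tuple h \<noteq> []" if "h \<in># M" for h
      using len[OF that] x that by blast
    have "wt in_W (diagonals M) = wt in_U (diagonals M)"
      unfolding wt_diagonals by (intro arg_cong[of _ _ sum_mset] image_mset_cong) (simp add: len')
    moreover have "0 < wt in_U (diagonals M)"
    proof -
      obtain N where N: "M = add_mset l N" using l(1) by (metis insert_DiffM)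
      thus ?thesis unfolding wt_diagonals N using len'[OF l(1)] by auto
    qed
    ultimately show thesis using l is_X[OF l(1)] by (intro X[of l]) (auto simp: pair_ge_def)
  qed
qed

text \<open>The least factor can be read off and removed.\<close>

lemma standard_determined_by_diagonals:
  assumes "1 \<le> n" and "standard M" "set_mset M \<subseteq> gens n m q"
    and "standard M'" "set_mset M' \<subseteq> gens n m q" and "diagonals M = diagonals M'"
  shows "M = M'"
  using assms(2-)
proof (induction "size M" arbitrary: M M')
  case (0 M M')
  hence "M = {#}" by simp
  with 0(5,6) have "wt in_U (diagonals M') = 0"
      "wt in_W (diagonals M') = 0" by (metis wt_zero diagonals_simps(1))+
  with assms(1) 0(4,5) \<open>M = {#}\<close> show ?case by (cases rule: standard_cases) auto
next
  case (Suc s M M')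
  have "\<exists>g. g \<in># M \<and> g \<in># M'"
    using assms(1) Suc.prems(1,2)
  proof (cases rule: standard_cases)
    case empty
    thus ?thesis using Suc.hyps(2) by simp
  next
    case (Y g)
    note g = Y
    from assms(1) Suc.prems(3,4) show ?thesis
    proof (cases rule: standard_cases)
      case (Y h)
      have "row_tuple g = row_tuple h"
        using least_row_unique[OF Suc.prems(5)] g(1,3) Y(1,3) by blast
      hence "g = h" using g(2) Y(2) by simp
      thus ?thesis using g(1) Y(1) by blast
    qed (use g(4) Suc.prems(5) in auto)
  next
    case (Z g)
    note g = Z
    from assms(1) Suc.prems(3,4) show ?thesis
    proof (cases rule: standard_cases)
      case (Z h)
      have "col_tuple g = col_tuple h"
        using least_col_unique[OF Suc.prems(5)] g(1,3) Z(1,3) by blast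
      hence "g = h" using g(2) Z(2) by simp
      thus ?thesis using g(1) Z(1) by blast
    qed (use g(4) Suc.prems(5) in auto)
  next
    case (X g)
    note g = X
    from assms(1) Suc.prems(3,4) show ?thesis
    proof (cases rule: standard_cases)
      case (X h)
      have "row_tuple g = row_tuple h"
        using least_row_unique[OF Suc.prems(5)] g(1,3) X(1,3) by blast
      moreover have "col_tuple g = col_tuple h"
        using least_col_unique[OF Suc.prems(5)] g(1,4) X(1,4) by blast
      ultimately have "g = h" using g(2) X(2) by simp
      thus ?thesis using g(1) X(1) by blast
    qed (use g(5,6) Suc.prems(5) in auto)
  qed
  then obtain g N N' where N: "M = add_mset g N" "M' = add_mset g N'" by (metis insert_DiffM)
  have "N = N'"
    by (rule Suc.hyps(1)) (use Suc.prems Suc.hyps(2) N in \<open>auto simp: standard_def\<close>)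
  thus ?case by (simp add: N)
qed

lemma initial_gen_funs:
  assumes "set_mset M \<subseteq> gens n m q"
  shows "initial (coord_weight (m + q)) (\<Prod>g\<in>#M. gen_fun n m q g :: (coord, 'a::comm_ring_1) mpoly)
    (diagonals M)"
  unfolding diagonals_def by (rule initial_prod_mset) (use assms initial_gen_fun in blast)

lemma standard_independent:
  fixes c :: "'t \<Rightarrow> 'a::comm_ring_1"
  assumes "1 \<le> n" and "finite T" and "inj_on f T"
    and std: "\<And>t. t \<in> T \<Longrightarrow> standard (f t) \<and> set_mset (f t) \<subseteq> gens n m q"
    and "(\<Sum>t\<in>T. Const (c t) * (\<Prod>g\<in>#f t. gen_fun n m q g)) = 0" and "t \<in> T"
  shows "c t = 0"
proof (rule initial_independent[OF assms(2) _ _ assms(5,6)])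
  show "initial (coord_weight (m + q)) (\<Prod>g\<in>#f t. gen_fun n m q g :: (coord, 'a) mpoly)
      (diagonals (f t))" if "t \<in> T" for t
    using std[OF that] by (intro initial_gen_funs) blast
  show "inj_on (\<lambda>t. diagonals (f t)) T"
    using standard_determined_by_diagonals[OF assms(1)] std inj_onD[OF assms(3)]
    by (intro inj_onI) metis
qed

section \<open>Straightening laws for maximal minors and for all minors\<close>

text \<open>The products \<open>[a][b]\<close> and \<open>[b][a]\<close> are equal, and their one-sided expansions give
complementary bounds.  At the generic matrix the standard products are independent, so the two
expansions have the same terms, and each term satisfies both bounds.\<close>

lemma two_sided_straightening:
  assumes k: "1 \<le> k" and a: "a \<in> I_set k N" and b: "b \<in> I_set k N"
  shows "(rdet2 k (a, b) :: (nat \<Rightarrow> nat \<Rightarrow> (coord, 'k::comm_ring_1) mpoly) \<Rightarrow> _) \<in> comb (rdet2 k)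
    {(c, d). c \<in> I_set k N \<and> d \<in> I_set k N \<and> c \<succeq> a \<and> c \<succeq> b \<and> a \<succeq> d \<and> b \<succeq> d
       \<and> mset c + mset d = mset a + mset b}" (is "_ \<in> comb _ ?D")
proof -
  let ?F = "rdet2 k :: _ \<Rightarrow> (nat \<Rightarrow> nat \<Rightarrow> (coord, 'k) mpoly) \<Rightarrow> _"
  let ?D1 = "\<lambda>a b. {(c, d). c \<in> I_set k N \<and> d \<in> I_set k N \<and> c \<succeq> d \<and> c \<succeq> a \<and> b \<succeq> d
       \<and> mset c + mset d = mset a + mset b}"
  obtain T1 and c1 :: "_ \<Rightarrow> 'k" where T1: "finite T1" "T1 \<subseteq> ?D1 a b" "\<forall>t\<in>T1. c1 t \<noteq> 0"
    "\<And>\<rho>. ?F (a, b) \<rho> = (\<Sum>t\<in>T1. Const (c1 t) * ?F t \<rho>)"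
    using comb_explicit[OF one_sided_straightening[OF a b]] by blast
  obtain T2 and c2 :: "_ \<Rightarrow> 'k" where T2: "finite T2" "T2 \<subseteq> ?D1 b a" "\<forall>t\<in>T2. c2 t \<noteq> 0"
    "\<And>\<rho>. ?F (b, a) \<rho> = (\<Sum>t\<in>T2. Const (c2 t) * ?F t \<rho>)"
    using comb_explicit[OF one_sided_straightening[OF b a]] by blast
  \<comment> \<open>The generic matrix with \<open>k\<close> columns, as the first component of a generic point.\<close>
  define \<rho> where "\<rho> = (\<lambda>i j. fst (generic_point k N 0) $$ (i, j) :: (coord, 'k) mpoly)"
  let ?f = "\<lambda>t. {#Y (fst t), Y (snd t)#}"
  define T where "T = T1 \<union> T2"
  define e where "e = (\<lambda>t. (if t \<in> T1 then c1 t else 0) - (if t \<in> T2 then c2 t else 0))"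
  have T: "finite T" "\<And>t. t \<in> T \<Longrightarrow> fst t \<in> I_set k N \<and> snd t \<in> I_set k N \<and> fst t \<succeq> snd t"
    using T1(1,2) T2(1,2) by (auto simp: T_def)
  have u: "?F t \<rho> = (\<Prod>g\<in>#?f t. gen_fun k N 0 g)" if "t \<in> T" for t
    using T(2)[OF that] I_setD(1)
    by (auto simp: rdet2_def u_fun_def generic_point_def minor_full_columns \<rho>_def)
  have "(\<Sum>t\<in>T. Const (e t) * ?F t \<rho>)
      = (\<Sum>t\<in>T. Const (if t \<in> T1 then c1 t else 0) * ?F t \<rho>)
        - (\<Sum>t\<in>T. Const (if t \<in> T2 then c2 t else 0) * ?F t \<rho>)"
    unfolding e_def sum_subtractf[symmetric]
    by (simp only: Const_diff left_diff_distrib)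
  also have "(\<Sum>t\<in>T. Const (if t \<in> T1 then c1 t else 0) * ?F t \<rho>) = ?F (a, b) \<rho>"
    unfolding T1(4) using T(1) by (intro sum.mono_neutral_cong_right) (auto simp: T_def)
  also have "(\<Sum>t\<in>T. Const (if t \<in> T2 then c2 t else 0) * ?F t \<rho>) = ?F (b, a) \<rho>"
    unfolding T2(4) using T(1) by (intro sum.mono_neutral_cong_right) (auto simp: T_def)
  also have "?F (a, b) \<rho> - ?F (b, a) \<rho> = 0" by (simp add: rdet2_def mult.commute)
  finally have "(\<Sum>t\<in>T. Const (e t) * (\<Prod>g\<in>#?f t. gen_fun k N 0 g)) = 0" using u by simp
  moreover have "inj_on ?f T"
  proof (rule inj_onI)
    fix s t assume st: "s \<in> T" "t \<in> T" "?f s = ?f t"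
    hence "fst s = fst t \<and> snd s = snd t \<or> fst s = snd t \<and> snd s = fst t"
      by (auto simp: add_eq_conv_ex)
    thus "s = t" using T(2)[OF st(1)] T(2)[OF st(2)] tuple_ge_antisym by (auto simp: prod_eq_iff)
  qed
  moreover have "standard (?f t) \<and> set_mset (?f t) \<subseteq> gens k N 0" if "t \<in> T" for t
    using T(2)[OF that] by (auto simp: standard_def gens_def H_u_def)
  ultimately have e0: "e t = 0" if "t \<in> T" for t
    using standard_independent[OF k T(1)] that by blast
  have "T1 \<subseteq> T2"
  proof
    fix t assume "t \<in> T1"
    thus "t \<in> T2" using e0[of t] T1(3) by (auto simp: e_def T_def split: if_splits)
  qed
  hence "T1 \<subseteq> ?D" using T1(2) T2(2) by auto
  hence "(\<lambda>\<rho>. \<Sum>t\<in>T1. Const (c1 t) * ?F t \<rho>) \<in> comb ?F ?D"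
    by (intro comb_sum comb_scale comb_base) blast
  also have "(\<lambda>\<rho>. \<Sum>t\<in>T1. Const (c1 t) * ?F t \<rho>) = ?F (a, b)" using T1(4) by auto
  finally show ?thesis .
qed

text \<open>The \<open>m \<times> q\<close> matrix \<open>M\<close> on top of the antidiagonal permutation matrix.\<close>

definition stacked :: "nat \<Rightarrow> nat \<Rightarrow> 'a::comm_ring_1 mat \<Rightarrow> nat \<Rightarrow> nat \<Rightarrow> 'a" where
  "stacked m q M i j = (if i < m then M $$ (i, j) else if i = m + (q - 1 - j) then 1 else 0)"

text \<open>A maximal minor of the stacked matrix uses some rows of \<open>M\<close> and some unit rows.  The unit
rows remove columns; the columns that are left are the \<open>free_columns\<close>.\<close>

definition matrix_rows :: "nat \<Rightarrow> nat list \<Rightarrow> nat list" where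
  "matrix_rows m L = filter (\<lambda>x. x < m) L"

definition free_columns :: "nat \<Rightarrow> nat \<Rightarrow> nat list \<Rightarrow> nat list" where
  "free_columns m q L = filter (\<lambda>b. m + (q - 1 - b) \<notin> set L) [0..<q]"

definition pluecker_tuple :: "nat \<Rightarrow> nat \<Rightarrow> nat list \<Rightarrow> nat list \<Rightarrow> nat list" where
  "pluecker_tuple m q A B = A @ map (\<lambda>t. m + t) (filter (\<lambda>t. q - 1 - t \<notin> set B) [0..<q])"

lemma cnt_eq_card: "distinct A \<Longrightarrow> cnt A y = card {x \<in> set A. x < y}"
  unfolding cnt_def using distinct_card[of "filter (\<lambda>x. x < y) A"] by (simp add: set_filter)

lemma cnt_matrix_rows: "cnt (matrix_rows m L) y = cnt L (min y m)"
  unfolding cnt_def matrix_rows_def by (simp add: conj_commute)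

text \<open>Passing to the complement and reversing the order both reverse inequalities, so together
they preserve them.\<close>

lemma cnt_free_columns:
  assumes L: "L \<in> I_set q (m + q)"
  shows "cnt (free_columns m q L) y + q = min y q + cnt L (m + q - min y q)"
proof -
  note L' = I_setD[OF L]
  let ?y = "min y q"
  let ?S = "{b. b < ?y \<and> m + (q - 1 - b) \<in> set L}" and ?N = "{b. b < ?y \<and> m + (q - 1 - b) \<notin> set L}"
  have "cnt (free_columns m q L) y = card ?N"
    by (subst cnt_eq_card) (auto simp: free_columns_def intro!: arg_cong[of _ _ card])
  moreover have "card ?N + card ?S = ?y"
  proof -
    have "card (?N \<union> ?S) = card ?N + card ?S" by (rule card_Un_disjoint) auto
    moreover have "?N \<union> ?S = {..<?y}" by auto
    ultimately show ?thesis by (metis card_lessThan)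
  qed
  moreover have "card ?S + cnt L (m + q - ?y) = q"
  proof -
    let ?G = "{x \<in> set L. m + q - ?y \<le> x}" and ?H = "{x \<in> set L. x < m + q - ?y}"
    have "bij_betw (\<lambda>b. m + (q - 1 - b)) ?S ?G"
    proof (rule bij_betwI[of _ _ _ "\<lambda>x. m + q - 1 - x"])
      show "(\<lambda>x. m + q - 1 - x) \<in> ?G \<rightarrow> ?S"
      proof
        fix x assume x: "x \<in> ?G"
        hence "x < m + q" using L'(3) by auto
        hence "m + (q - 1 - (m + q - 1 - x)) = x" "m + q - 1 - x < ?y" using x by auto
        thus "m + q - 1 - x \<in> ?S" using x by simp
      qed
      show "m + (q - 1 - (m + q - 1 - x)) = x" if "x \<in> ?G" for x
      proof -
        have "x < m + q" using L'(3) that by auto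
        thus ?thesis using that by auto
      qed
    qed auto
    hence "card ?S = card ?G" by (rule bij_betw_same_card)
    moreover have "card (?G \<union> ?H) = card ?G + card ?H" by (rule card_Un_disjoint) auto
    moreover have "?G \<union> ?H = set L" by auto
    moreover have "card (set L) = q" using distinct_card[OF L'(4)] L'(1) by simp
    ultimately show ?thesis using cnt_eq_card[OF L'(4), of "m + q - ?y"] by simp
  qed
  ultimately show ?thesis by simp
qed

lemma sorted_matrix_rows: "sorted_wrt (<) L \<Longrightarrow> sorted_wrt (<) (matrix_rows m L)"
  by (simp add: matrix_rows_def sorted_wrt_filter)

lemma sorted_free_columns: "sorted_wrt (<) (free_columns m q L)"
  by (simp add: free_columns_def sorted_wrt_filter sorted_wrt_upt)

lemma cnt_large: "\<forall>x\<in>set A. x < y \<Longrightarrow> cnt A y = length A"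
  by (simp add: cnt_def)

lemma length_free_columns:
  assumes "L \<in> I_set q (m + q)"
  shows "length (free_columns m q L) = length (matrix_rows m L)"
proof -
  have "cnt (free_columns m q L) q = length (free_columns m q L)"
    by (rule cnt_large) (auto simp: free_columns_def)
  moreover have "cnt (matrix_rows m L) m = length (matrix_rows m L)"
    by (rule cnt_large) (auto simp: matrix_rows_def)
  ultimately show ?thesis
    using cnt_free_columns[OF assms, of q] cnt_matrix_rows[of m L m] by simp
qed

lemma matrix_rows_in_I_set:
  "L \<in> I_set q (m + q) \<Longrightarrow> matrix_rows m L \<in> I_set (length (matrix_rows m L)) m"
  by (auto simp: I_set_def sorted_matrix_rows) (auto simp: matrix_rows_def)

lemma free_columns_in_I_set:
  "L \<in> I_set q (m + q) \<Longrightarrow> free_columns m q L \<in> I_set (length (matrix_rows m L)) q"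
  by (auto simp: I_set_def[of _ q] sorted_free_columns length_free_columns) (auto simp:
      free_columns_def)

text \<open>The order of the unit rows is the reverse of that of the columns they remove, which is
why the antidiagonal matrix, and not the identity, is stacked.\<close>

lemma tuple_ge_matrix_rows:
  assumes "L \<in> I_set q (m + q)" and "L' \<in> I_set q (m + q)" and "L \<succeq> L'"
  shows "matrix_rows m L \<succeq> matrix_rows m L'" and "free_columns m q L \<succeq> free_columns m q L'"
proof -
  have le: "cnt L y \<le> cnt L' y" for y
    using assms(3) tuple_ge_iff_cnt I_setD(2) assms(1,2) by blast
  show "matrix_rows m L \<succeq> matrix_rows m L'"
    using tuple_ge_iff_cnt sorted_matrix_rows I_setD(2) assms(1,2) le cnt_matrix_rows by metis
  have "cnt (free_columns m q L) y \<le> cnt (free_columns m q L') y" for y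
    using cnt_free_columns[OF assms(1), of y] cnt_free_columns[OF assms(2), of y]
      le[of "m + q - min y q"] by linarith
  thus "free_columns m q L \<succeq> free_columns m q L'"
    using tuple_ge_iff_cnt[OF sorted_free_columns sorted_free_columns] by blast
qed

lemma pluecker_tuple:
  assumes A: "A \<in> I_set r m" and B: "B \<in> I_set r q"
  shows "pluecker_tuple m q A B \<in> I_set q (m + q)"
    and "matrix_rows m (pluecker_tuple m q A B) = A"
    and "free_columns m q (pluecker_tuple m q A B) = B"
proof -
  note A' = I_setD[OF A] and B' = I_setD[OF B]
  let ?T = "filter (\<lambda>t. q - 1 - t \<notin> set B) [0..<q]"
  have len: "length ?T = q - r"
  proof -
    have "length ?T = card {t. t < q \<and> q - 1 - t \<notin> set B}"
      using distinct_card[of ?T] by (simp add: conj_commute)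
    also have "\<dots> = card ({..<q} - set B)"
    proof (rule bij_betw_same_card[of "\<lambda>t. q - 1 - t"], rule bij_betwI[of _ _ _ "\<lambda>t. q - 1 - t"])
      show "(\<lambda>t. q - 1 - t) \<in> {..<q} - set B \<rightarrow> {t. t < q \<and> q - 1 - t \<notin> set B}" by auto
    qed auto
    also have "\<dots> = q - r"
      using B' distinct_card[OF B'(4)] card_Diff_subset[of "set B"
          "{..<q}"] by (auto simp: lessThan_atLeast0)
    finally show ?thesis .
  qed
  have rq: "r \<le> q" using distinct_card[OF B'(4)] card_mono[OF _ B'(3)] B'(1) by simp
  show I: "pluecker_tuple m q A B \<in> I_set q (m + q)"
    using A' len rq by (auto simp: I_set_def pluecker_tuple_def sorted_wrt_append sorted_wrt_map
        sorted_wrt_filter sorted_wrt_upt)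
  show "matrix_rows m (pluecker_tuple m q A B) = A"
    using A'(3) by (auto simp: matrix_rows_def pluecker_tuple_def filter_map comp_def
        filter_id_conv subset_iff)
  have mem: "m + (q - 1 - b) \<in> set (pluecker_tuple m q A B) \<longleftrightarrow> b \<notin> set B" if "b < q" for b
  proof -
    have "m + t \<in> set (pluecker_tuple m q A B) \<longleftrightarrow> q - 1 - t \<notin> set B" if "t < q" for t
      using A'(3) that by (auto simp: pluecker_tuple_def)
    from this[of "q - 1 - b"] show ?thesis using that by simp
  qed
  show "free_columns m q (pluecker_tuple m q A B) = B"
  proof (rule strict_sorted_equal)
    show "sorted_wrt (<) B" by (rule B'(2))
    show "set (free_columns m q (pluecker_tuple m q A B)) = set B"
      using mem B'(3) by (auto simp: free_columns_def)
  qed (rule sorted_free_columns)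
qed

lemma sorted_filter_split: "sorted L \<Longrightarrow> filter (\<lambda>x. x < m) L @ filter (\<lambda>x. \<not> x < m) L = L"
  for m :: nat
proof (induction L)
  case (Cons a L)
  show ?case
  proof (cases "a < m")
    case False
    hence "\<forall>x\<in>set L. \<not> x < m" using Cons.prems by auto
    thus ?thesis using False by simp
  qed (use Cons in simp)
qed simp

text \<open>With the removed columns moved to the end, in the order of the unit rows, the matrix is
block triangular with an identity block.\<close>

lemma rdet_stacked:
  assumes L: "L \<in> I_set q (m + q)"
  shows "\<exists>\<epsilon>\<in>{1, -1}. \<forall>M :: 'a::comm_ring_1 mat.
    minor M (matrix_rows m L) (free_columns m q L) = \<epsilon> * rdet q (stacked m q M) L"
proof -
  note L' = I_setD[OF L]
  let ?A = "matrix_rows m L" and ?B = "free_columns m q L"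
  define T where "T = map (\<lambda>x. x - m) (filter (\<lambda>x. \<not> x < m) L)"
  \<comment> \<open>The free columns, then the removed ones in the order of the unit rows.\<close>
  define cs where "cs = ?B @ map (\<lambda>t. q - 1 - t) T"
  let ?r = "length ?A"
  have lenB: "length ?B = ?r" by (rule length_free_columns[OF L])
  have "sorted L" using L'(2) strict_sorted_iff by blast
  hence "L = filter (\<lambda>x. x < m) L @ filter (\<lambda>x. \<not> x < m) L"
    using sorted_filter_split[of L m] by simp
  also have "filter (\<lambda>x. \<not> x < m) L = map (\<lambda>t. m + t) T"
    unfolding T_def map_map by (rule map_idI[symmetric]) auto
  finally have Leq: "L = ?A @ map (\<lambda>t. m + t) T" unfolding matrix_rows_def .
  have lenT: "?r + length T = q" using arg_cong[OF Leq, of length] L'(1) by simp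
  have T: "t < q" "m + t \<in> set L" if "t \<in> set T" for t
    using that L'(3) by (auto simp: T_def)
  have dT: "distinct T" using L'(4) Leq by (metis distinct_append distinct_map)
  have cs: "mset cs = mset [0..<q]"
  proof -
    have "distinct cs" unfolding cs_def distinct_append
    proof (intro conjI)
      show "distinct ?B" by (simp add: free_columns_def)
      show "distinct (map (\<lambda>t. q - 1 - t) T)"
        unfolding distinct_map
      proof (intro conjI dT inj_onI)
        fix t t' assume t: "t \<in> set T" "t' \<in> set T" "q - 1 - t = q - 1 - t'"
        thus "t = t'" using T(1)[OF t(1)] T(1)[OF t(2)] by linarith
      qed
      have "q - 1 - t \<notin> set ?B" if "t \<in> set T" for t
      proof -
        have "q - 1 - (q - 1 - t) = t" using T(1)[OF that] by simp
        hence "m + (q - 1 - (q - 1 - t)) \<in> set L" using T(2)[OF that] by simp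
        thus ?thesis unfolding free_columns_def by simp
      qed
      thus "set ?B \<inter> set (map (\<lambda>t. q - 1 - t) T) = {}" by auto
    qed
    moreover have "set cs = {0..<q}"
    proof (rule card_subset_eq)
      show "set cs \<subseteq> {0..<q}" by (auto simp: cs_def free_columns_def dest!: T(1))
      show "card (set cs) = card {0..<q}"
        using distinct_card[OF \<open>distinct cs\<close>] lenB lenT by (simp add: cs_def)
    qed simp
    ultimately show ?thesis using set_eq_iff_mset_eq_distinct[of cs "[0..<q]"] by simp
  qed
  have "length [0..<q] = q" by simp
  from rdet_mset_eq[OF cs this, where 'a = 'a] obtain \<epsilon> where e: "\<epsilon> \<in> {1, -1}"
    "\<And>\<rho> :: nat \<Rightarrow> nat \<Rightarrow> 'a. rdet q \<rho> cs = \<epsilon> * rdet q \<rho> [0..<q]" by blast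
  have "minor M ?A ?B = \<epsilon> * rdet q (stacked m q M) L" for M :: "'a mat"
  proof -
    let ?\<rho> = "\<lambda>c i. stacked m q M (L ! i) c"
    let ?f = "\<lambda>i j. stacked m q M (L ! j) (cs ! i)"
    have low: "stacked m q M (L ! j) (cs ! i) = (if i = j then 1 else 0)"
      if ij: "i < q" "j < q" "?r \<le> j" for i j
    proof -
      have jT: "j - ?r < length T" using ij lenT by simp
      have "(?A @ map (\<lambda>t. m + t) T) ! j = m + T ! (j - ?r)"
        using ij jT by (simp add: nth_append)
      hence Lj: "L ! j = m + T ! (j - ?r)" by (simp only: Leq[symmetric])
      show ?thesis
      proof (cases "i < ?r")
        case True
        hence "cs ! i \<in> set ?B" using lenB by (simp add: cs_def nth_append)
        hence "m + (q - 1 - cs ! i) \<notin> set L"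
          unfolding free_columns_def set_filter by blast
        moreover have "L ! j \<in> set L" using ij L'(1) by simp
        ultimately have "L ! j \<noteq> m + (q - 1 - cs ! i)" by metis
        thus ?thesis using True ij Lj by (simp add: stacked_def)
      next
        case False
        have iT: "i - ?r < length T" using False ij lenT by simp
        have ci: "cs ! i = q - 1 - T ! (i - ?r)" using False lenB iT
            by (simp add: cs_def nth_append)
        have "T ! (i - ?r) < q" using T(1) iT by simp
        hence "q - 1 - cs ! i = T ! (i - ?r)" using ci by simp
        hence "L ! j = m + (q - 1 - cs ! i) \<longleftrightarrow> T ! (j - ?r) = T ! (i - ?r)" using Lj by simp
        also have "\<dots> \<longleftrightarrow> j - ?r = i - ?r" using dT iT jT nth_eq_iff_index_eq by blast
        also have "\<dots> \<longleftrightarrow> i = j" using False ij by auto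
        finally show ?thesis using Lj by (auto simp: stacked_def)
      qed
    qed
    have "rdet q ?\<rho> cs = det (mat (?r + length T) (?r + length T)
        (\<lambda>(i, j). if j < ?r then ?f i j else if i = j then 1 else 0))"
      unfolding rdet_def lenT using low by (intro arg_cong[of _ _ det] eq_matI) auto
    also have "\<dots> = det (mat ?r ?r (\<lambda>(i, j). ?f i j))" by (rule det_append_unit_columns)
    also have "mat ?r ?r (\<lambda>(i, j). ?f i j) = (mat ?r ?r (\<lambda>(i, j). M $$ (?A ! i, ?B ! j)))\<^sup>T"
    proof (intro eq_matI)
      fix i j assume "i < dim_row ((mat ?r ?r (\<lambda>(i, j). M $$ (?A ! i, ?B ! j)))\<^sup>T)"
        "j < dim_col ((mat ?r ?r (\<lambda>(i, j). M $$ (?A ! i, ?B ! j)))\<^sup>T)"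
      hence ij: "i < ?r" "j < ?r" by auto
      have "(?A @ map (\<lambda>t. m + t) T) ! j = ?A ! j" using ij by (simp add: nth_append)
      hence "L ! j = ?A ! j" by (simp only: Leq[symmetric])
      moreover have "?A ! j < m" using ij nth_mem[of j ?A] by (simp add: matrix_rows_def)
      moreover have "cs ! i = ?B ! i" using ij lenB by (simp add: cs_def nth_append)
      ultimately show "mat ?r ?r (\<lambda>(i, j). ?f i j) $$ (i, j)
          = (mat ?r ?r (\<lambda>(i, j). M $$ (?A ! i, ?B ! j)))\<^sup>T $$ (i, j)"
        using ij by (simp add: stacked_def)
    qed auto
    also have "det \<dots> = minor M ?A ?B"
      unfolding minor_def lenB by (rule det_transpose[of _ ?r]) simp
    finally have "minor M ?A ?B = \<epsilon> * rdet q ?\<rho> [0..<q]" by (simp add: e(2))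
    also have "rdet q ?\<rho> [0..<q] = det ((mat q q (\<lambda>(i, j). stacked m q M (L ! i) j))\<^sup>T)"
      unfolding rdet_def by (intro arg_cong[of _ _ det] eq_matI) auto
    also have "\<dots> = rdet q (stacked m q M) L"
      unfolding rdet_def by (rule det_transpose[of _ q]) simp
    finally show ?thesis .
  qed
  thus ?thesis using e(1) by blast
qed

definition minor2 :: "(nat list \<times> nat list) \<times> (nat list \<times> nat list) \<Rightarrow> 'a::comm_ring_1 mat \<Rightarrow> 'a"
    where
  "minor2 = (\<lambda>((A, B), (A', B')) M. minor M A B * minor M A' B')"

text \<open>The size of \<open>C\<close> may be 0: the empty minor 1 corresponds to the largest tuple of the
stacked matrix.\<close>

lemma minor_straightening:
  fixes A B A' B' :: "nat list"
  assumes q: "1 \<le> q" and A: "A \<in> I_set r m" "B \<in> I_set r q" and A': "A' \<in> I_set r' m"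
      "B' \<in> I_set r' q"
  shows "(minor2 ((A, B), (A', B')) :: (coord, 'k::comm_ring_1) mpoly mat \<Rightarrow> _) \<in> comb minor2
    {(C, D). fst C \<in> I_set (length (fst C)) m \<and> snd C \<in> I_set (length (fst C)) q
       \<and> fst D \<in> I_set (length (fst D)) m \<and> snd D \<in> I_set (length (fst D)) q
       \<and> C \<succeq>\<^sub>p (A, B) \<and> C \<succeq>\<^sub>p (A', B') \<and> (A, B) \<succeq>\<^sub>p D \<and> (A', B') \<succeq>\<^sub>p D
       \<and> length (fst C) + length (fst D) = r + r'}" (is "_ \<in> comb _ ?D")
proof -
  let ?r = "\<lambda>t (M :: (coord, 'k) mpoly mat). rdet2 q t (stacked m q M)"
  let ?L = "pluecker_tuple m q A B" and ?L' = "pluecker_tuple m q A' B'"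
  let ?dec = "\<lambda>L. (matrix_rows m L, free_columns m q L)"
  note L = pluecker_tuple[OF A] and L' = pluecker_tuple[OF A']
  let ?S = "{(c, d). c \<in> I_set q (m + q) \<and> d \<in> I_set q (m + q) \<and> c \<succeq> ?L \<and> c \<succeq> ?L' \<and> ?L \<succeq> d \<and> ?L' \<succeq> d
       \<and> mset c + mset d = mset ?L + mset ?L'}"
  have sign: "\<exists>\<epsilon>\<in>{1, -1}. \<forall>M :: (coord, 'k) mpoly mat. minor2 (?dec c, ?dec d) M = \<epsilon> * ?r (c, d) M"
    if "c \<in> I_set q (m + q)" "d \<in> I_set q (m + q)" for c d
  proof -
    from rdet_stacked[OF that(1), where 'a = "(coord, 'k) mpoly"] obtain \<epsilon> where e:
      "\<epsilon> \<in> {1, -1}" "\<forall>M :: (coord, 'k) mpoly mat. minor M (matrix_rows m c) (free_columns m q c)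
         = \<epsilon> * rdet q (stacked m q M) c" by blast
    from rdet_stacked[OF that(2), where 'a = "(coord, 'k) mpoly"] obtain \<epsilon>' where e':
      "\<epsilon>' \<in> {1, -1}" "\<forall>M :: (coord, 'k) mpoly mat. minor M (matrix_rows m d) (free_columns m q d)
         = \<epsilon>' * rdet q (stacked m q M) d" by blast
    have "minor2 (?dec c, ?dec d) M = \<epsilon> * \<epsilon>' * ?r (c, d) M" for M :: "(coord, 'k) mpoly mat"
      by (simp add: minor2_def rdet2_def e(2) e'(2) mult.assoc mult.left_commute)
    moreover have "\<epsilon> * \<epsilon>' \<in> {1, -1}" using e(1) e'(1) by auto
    ultimately show ?thesis by (intro bexI[of _ "\<epsilon> * \<epsilon>'"]) auto
  qed
  have "?r (?L, ?L') \<in> comb ?r ?S"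
    using comb_compose[OF two_sided_straightening[OF q L(1) L'(1), where 'k = 'k], of "stacked m q"]
    by simp
  moreover have "?r t \<in> comb minor2 ?D" if t: "t \<in> ?S" for t
  proof -
    obtain c d where cd: "t = (c, d)" "c \<in> I_set q (m + q)" "d \<in> I_set q (m + q)"
      "c \<succeq> ?L" "c \<succeq> ?L'" "?L \<succeq> d" "?L' \<succeq> d" "mset c + mset d = mset ?L + mset ?L'"
      using t by auto
    obtain \<epsilon> where e: "\<epsilon> \<in> {1, -1}"
      "\<forall>M :: (coord, 'k) mpoly mat. minor2 (?dec c, ?dec d) M = \<epsilon> * ?r (c, d) M"
      using sign[OF cd(2,3)] by blast
    have len: "length (matrix_rows m L) = size (filter_mset (\<lambda>x. x < m) (mset L))" for L
      unfolding matrix_rows_def mset_filter[symmetric] size_mset ..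
    have "size (filter_mset (\<lambda>x. x < m) (mset c + mset d))
        = size (filter_mset (\<lambda>x. x < m) (mset ?L + mset ?L'))" by (simp only: cd(8))
    hence "length (matrix_rows m c) + length (matrix_rows m d)
        = length (matrix_rows m ?L) + length (matrix_rows m ?L')"
      unfolding len filter_union_mset size_union .
    also have "\<dots> = r + r'" using L(2) L'(2) A(1) A'(1) I_setD(1) by metis
    finally have sz: "length (matrix_rows m c) + length (matrix_rows m d) = r + r'" .
    have "(?dec c, ?dec d) \<in> ?D"
      using cd(2,3) sz tuple_ge_matrix_rows[OF cd(2) L(1) cd(4)] tuple_ge_matrix_rows[OF cd(2)
          L'(1) cd(5)]
        tuple_ge_matrix_rows[OF L(1) cd(3,6)] tuple_ge_matrix_rows[OF L'(1) cd(3,7)]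
      by (simp add: pair_ge_def L L' matrix_rows_in_I_set free_columns_in_I_set)
    hence "(\<lambda>M :: (coord, 'k) mpoly mat. \<epsilon> * minor2 (?dec c, ?dec d) M) \<in> comb minor2 ?D"
      by (intro comb_sign[OF e(1)] comb_base)
    also have "(\<lambda>M :: (coord, 'k) mpoly mat. \<epsilon> * minor2 (?dec c, ?dec d) M) = ?r t"
      using e by (auto simp: cd(1))
    finally show ?thesis .
  qed
  ultimately have "?r (?L, ?L') \<in> comb minor2 ?D" by (rule comb_trans)
  moreover obtain \<epsilon> where e: "\<epsilon> \<in> {1, -1}"
    "\<forall>M :: (coord, 'k) mpoly mat. minor2 (?dec ?L, ?dec ?L') M = \<epsilon> * ?r (?L, ?L') M"
    using sign[OF L(1) L'(1)] by blast
  ultimately have "(\<lambda>M. \<epsilon> * ?r (?L, ?L') M) \<in> comb minor2 ?D" by (intro comb_sign)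
  also have "(\<lambda>M. \<epsilon> * ?r (?L, ?L') M) = minor2 ((A, B), (A', B'))"
    using e(2) by (auto simp: L L')
  finally show ?thesis .
qed

section \<open>The presentation map\<close>

definition mon_subst :: "('x \<Rightarrow> ('y, 'a::comm_ring_1) mpoly) \<Rightarrow> ('x \<Rightarrow>\<^sub>0 nat) \<Rightarrow> ('y, 'a) mpoly" where
  "mon_subst g e = (\<Prod>x\<in>keys e. g x ^ lookup e x)"

lemma mon_subst_superset:
  assumes "finite S" and "keys e \<subseteq> S"
  shows "mon_subst g e = (\<Prod>x\<in>S. g x ^ lookup e x)"
  unfolding mon_subst_def using assms
  by (intro prod.mono_neutral_left) (auto simp: in_keys_iff)

lemma mon_subst_add: "mon_subst g (e + e') = mon_subst g e * mon_subst g e'"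
proof -
  let ?S = "keys e \<union> keys e'"
  have "keys (e + e') \<subseteq> ?S" by (rule Poly_Mapping.keys_add)
  thus ?thesis
    by (simp add: mon_subst_superset[of ?S] lookup_add power_add prod.distrib)
qed

lemma poly_subst_superset:
  assumes "finite S" and "keys F \<subseteq> S"
  shows "poly_subst g F = (\<Sum>e\<in>S. Const (lookup F e) * mon_subst g e)"
  unfolding poly_subst_def mon_subst_def[symmetric] using assms
  by (intro sum.mono_neutral_left) (auto simp: in_keys_iff)

lemma poly_subst_add: "poly_subst g (F + G) = poly_subst g F + poly_subst g G"
proof -
  let ?S = "keys F \<union> keys G"
  have "keys (F + G) \<subseteq> ?S" by (rule Poly_Mapping.keys_add)
  thus ?thesis
    by (simp add: poly_subst_superset[of ?S] lookup_add Const_add distrib_right sum.distrib)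
qed

lemma poly_subst_0 [simp]: "poly_subst g 0 = 0"
  by (simp add: poly_subst_def)

lemma poly_subst_sum: "poly_subst g (sum F A) = (\<Sum>a\<in>A. poly_subst g (F a))"
  by (induction A rule: infinite_finite_induct) (auto simp: poly_subst_add)

lemma poly_subst_single: "poly_subst g (single e c) = Const c * mon_subst g e"
  by (subst poly_subst_superset[of "{e}"]) auto

lemma sum_of_monomials:
  "F = (\<Sum>e\<in>keys F. single e (lookup F e))"
proof (rule poly_mapping_eqI)
  fix d
  have "lookup (\<Sum>e\<in>keys F. single e (lookup F e)) d
      = (\<Sum>e\<in>keys F. if e = d then lookup F d else 0)"
    unfolding lookup_sum by (intro sum.cong) (auto simp: lookup_single when_def)
  thus "lookup F d = lookup
      (\<Sum>e\<in>keys F. single e (lookup F e)) d"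
    by (simp add: in_keys_iff)
qed

lemma poly_subst_mult: "poly_subst g (F * G) = poly_subst g F * poly_subst g G"
proof -
  have "F * G = (\<Sum>e\<in>keys F. \<Sum>e'\<in>keys G.
      single (e + e') (lookup F e * lookup G e'))"
    by (subst sum_of_monomials[of F], subst sum_of_monomials[of G]) (simp add: sum_product
        mult_single)
  hence "poly_subst g (F * G) = (\<Sum>e\<in>keys F. \<Sum>e'\<in>keys G.
      (Const (lookup F e) * mon_subst g e) * (Const (lookup G e') * mon_subst g e'))"
    by (simp add: poly_subst_sum poly_subst_single Const_mult mon_subst_add ac_simps)
  also have "\<dots> = poly_subst g F * poly_subst g G"
    unfolding poly_subst_def mon_subst_def by (simp add: sum_product)
  finally show ?thesis .
qed

lemma poly_subst_Const [simp]: "poly_subst g (Const c) = Const c"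
  by (simp add: Const_def[of c] poly_subst_single mon_subst_def)

lemma poly_subst_1 [simp]: "poly_subst g 1 = 1"
  using poly_subst_Const[of g 1] by simp

lemma poly_subst_Var [simp]: "poly_subst g (Var x) = g x"
  by (simp add: Var_def poly_subst_single mon_subst_def)

lemma poly_subst_diff: "poly_subst g (F - G) = poly_subst g F - poly_subst g G"
  using poly_subst_add[of g "F - G" G] by simp

lemma poly_subst_prod_mset: "poly_subst g (\<Prod>x\<in>#M. F x) = (\<Prod>x\<in>#M. poly_subst g (F x))"
  by (induction M) (auto simp: poly_subst_mult)

lemma vars_add: "vars (F + G) \<subseteq> vars F \<union> vars G"
  unfolding vars_def using Poly_Mapping.keys_add[of F G] by blast

lemma vars_uminus [simp]: "vars (- F) = vars F" for F :: "('x, 'a::comm_ring_1) mpoly"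
  by (simp add: vars_def in_keys_iff set_eq_iff)

lemma vars_mult: "vars (F * G) \<subseteq> vars F \<union> vars G" for F G :: "('x, 'a::comm_ring_1) mpoly"
proof
  fix x assume "x \<in> vars (F * G)"
  then obtain e where e: "e \<in> keys (F * G)" "x \<in> keys e" by (auto simp: vars_def)
  obtain a b where "e = a + b" "a \<in> keys F" "b \<in> keys G"
    using keys_mult[of F G] e(1) by blast
  thus "x \<in> vars F \<union> vars G" using e(2) Poly_Mapping.keys_add[of a b] by (auto simp: vars_def)
qed

lemma vars_Const [simp]: "vars (Const c) = {}"
  by (auto simp: vars_def Const_def)

lemma vars_0 [simp]: "vars 0 = {}" and vars_1 [simp]: "vars 1 = {}"
  by (auto simp: vars_def)

lemma vars_Var: "vars (Var x) \<subseteq> {x}"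
  by (auto simp: vars_def Var_def)

lemma poly_ring_simps [simp]:
  "x \<in> carrier (poly_ring V) \<longleftrightarrow> vars x \<subseteq> V"
  "x \<otimes>\<^bsub>poly_ring V\<^esub> y = x * y" "x \<oplus>\<^bsub>poly_ring V\<^esub> y = x + y"
  "\<one>\<^bsub>poly_ring V\<^esub> = 1" "\<zero>\<^bsub>poly_ring V\<^esub> = 0"
  by (simp_all add: poly_ring_def)

lemma vars_closed:
  "vars F \<subseteq> V \<Longrightarrow> vars G \<subseteq> V \<Longrightarrow> vars (F + G) \<subseteq> V"
  "vars F \<subseteq> V \<Longrightarrow> vars G \<subseteq> V \<Longrightarrow> vars (F * G) \<subseteq> V"
  for F G :: "('x, 'a::comm_ring_1) mpoly"
  using vars_add[of F G] vars_mult[of F G] by blast+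

lemma vars_diff: "vars F \<subseteq> V \<Longrightarrow> vars G \<subseteq> V \<Longrightarrow> vars (F - G) \<subseteq> V"
  for F G :: "('x, 'a::comm_ring_1) mpoly"
  using vars_closed(1)[of F V "- G"] by simp

lemma vars_sum: "(\<And>x. x \<in> A \<Longrightarrow> vars (F x) \<subseteq> V) \<Longrightarrow> vars (sum F A) \<subseteq> V"
  for F :: "'i \<Rightarrow> ('x, 'a::comm_ring_1) mpoly"
  by (induction A rule: infinite_finite_induct) (simp_all add: vars_closed)

lemma vars_prod: "(\<And>x. x \<in> A \<Longrightarrow> vars (F x) \<subseteq> V) \<Longrightarrow> vars (prod F A) \<subseteq> V"
  for F :: "'i \<Rightarrow> ('x, 'a::comm_ring_1) mpoly"
  by (induction A rule: infinite_finite_induct) (simp_all add: vars_closed)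

lemma cring_poly_ring: "cring (poly_ring V :: ('x, 'a::comm_ring_1) mpoly ring)"
proof (rule cringI)
  show "abelian_group (poly_ring V :: ('x, 'a) mpoly ring)"
  proof (rule abelian_groupI)
    fix x :: "('x, 'a) mpoly" assume "x \<in> carrier (poly_ring V)"
    thus "\<exists>y\<in>carrier (poly_ring V). y \<oplus>\<^bsub>poly_ring V\<^esub> x = \<zero>\<^bsub>poly_ring V\<^esub>"
      by (intro bexI[of _ "- x"]) auto
  qed (simp_all add: vars_closed ac_simps)
  show "Group.comm_monoid (poly_ring V :: ('x, 'a) mpoly ring)"
    by (rule Group.comm_monoidI) (simp_all add: vars_closed ac_simps)
qed (simp add: distrib_right)

lemma a_inv_poly_ring:
  fixes F :: "('x, 'a::comm_ring_1) mpoly"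
  assumes "vars F \<subseteq> V"
  shows "\<ominus>\<^bsub>poly_ring V\<^esub> F = - F"
proof -
  interpret cring "poly_ring V :: ('x, 'a) mpoly ring" by (rule cring_poly_ring)
  show ?thesis using minus_equality[of "- F" F] assms by simp
qed

lemma pres_map_Var: "pres_map n m q (Var g) = gen_fun n m q g"
  by (simp add: pres_map_def)

lemma vars_det:
  "(\<And>i j. i < r \<Longrightarrow> j < r \<Longrightarrow> vars (f i j) \<subseteq> V) \<Longrightarrow> vars (det (mat r r (\<lambda>(i, j). f i j))) \<subseteq> V"
  for f :: "nat \<Rightarrow> nat \<Rightarrow> ('x, 'a::comm_ring_1) mpoly"
  unfolding det_def'[OF mat_carrier]
proof (intro vars_sum vars_closed vars_prod)
  fix p i assume "\<And>i j. i < r \<Longrightarrow> j < r \<Longrightarrow> vars (f i j) \<subseteq> V" "p \<in> {p. p permutes {0..<r}}"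
      "i \<in> {0..<r}"
  thus "vars (mat r r (\<lambda>(i, j). f i j) $$ (i, p i)) \<subseteq> V"
    using permutes_in_image[of p "{0..<r}" i] by auto
qed (auto simp: sign_def)

lemma vars_gen_fun:
  assumes "g \<in> gens n m q"
  shows "vars (gen_fun n m q g :: (coord, 'a::comm_ring_1) mpoly) \<subseteq> coords n m q"
proof -
  have U: "vars (Var (U_coord i k) :: (coord, 'a) mpoly) \<subseteq> coords n m q" if "i < m" "k < n" for i k
    using vars_Var[of "U_coord i k"] that by (auto simp: coords_def)
  have W: "vars (Var (W_coord k j) :: (coord, 'a) mpoly) \<subseteq> coords n m q" if "j < q" "k < n" for j k
    using vars_Var[of "W_coord k j"] that by (auto simp: coords_def)
  show ?thesis
  proof (cases g)
    case (X A B)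
    then obtain r where r: "A \<in> I_set r m"
        "B \<in> I_set r q" using assms by (auto simp: gens_def H_p_def H_u_def)
    note A = I_setD[OF r(1)] and B = I_setD[OF r(2)]
    show ?thesis unfolding X gen_fun.simps p_fun_def generic_point_def prod.case minor_def
        A(1) B(1)
    proof (rule vars_det)
      fix i j assume "i < r" "j < r"
      hence "A ! i < m" "B ! j < q" using A B nth_less[of A m i] nth_less[of B q j] by auto
      hence "(mat m n (\<lambda>(i, k). Var (U_coord i k)) * mat n q (\<lambda>(k, j). Var (W_coord k j)))
          $$ (A ! i, B ! j) = (\<Sum>k = 0..<n. Var (U_coord (A ! i) k) * Var (W_coord k (B ! j)) ::
              (coord, 'a) mpoly)"
        by (simp add: scalar_prod_def)
      also have "vars \<dots> \<subseteq> coords n m q"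
        using \<open>A ! i < m\<close> \<open>B ! j < q\<close> by (intro vars_sum vars_closed(2) U W) auto
      finally show "vars ((mat m n (\<lambda>(i, k). Var (U_coord i k)) * mat n q (\<lambda>(k, j). Var (W_coord k
          j)))
          $$ (A ! i, B ! j) :: (coord, 'a) mpoly) \<subseteq> coords n m q" .
    qed
  next
    case (Y I)
    have "I \<in> I_set n m" using Y assms by (auto simp: gens_def H_u_def)
    note I = I_setD[OF this]
    show ?thesis unfolding Y gen_fun.simps u_fun_def generic_point_def prod.case minor_def I(1)
        length_upt diff_zero
      by (rule vars_det) (use I nth_less[of I m] U in auto)
  next
    case (Z J)
    have "J \<in> I_set n q" using Z assms by (auto simp: gens_def H_xi_def)
    note J = I_setD[OF this]
    show ?thesis unfolding Z gen_fun.simps xi_fun_def generic_point_def prod.case minor_def J(1)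
        length_upt diff_zero
      by (rule vars_det) (use J nth_less[of J q] W in auto)
  qed
qed

lemma generate_ring_closed:
  fixes H :: "('x, 'a::comm_ring_1) mpoly set" and V :: "'x set"
  defines "R \<equiv> generate_ring (poly_ring V) (range Const \<union> H)"
  shows "Const c \<in> R" and "h \<in> H \<Longrightarrow> h \<in> R" and "F \<in> R \<Longrightarrow> G \<in> R \<Longrightarrow> F + G \<in> R"
    and "F \<in> R \<Longrightarrow> G \<in> R \<Longrightarrow> F * G \<in> R"
  unfolding R_def
  using generate_ring.incl[of "Const c" "range Const \<union> H" "poly_ring V"]
    generate_ring.incl[of h "range Const \<union> H" "poly_ring V"]
    generate_ring.eng_add[of F "poly_ring V" "range Const \<union> H" G]
    generate_ring.eng_mult[of F "poly_ring V" "range Const \<union> H" G]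
  by auto

lemma poly_subst_in_generate_ring:
  fixes g :: "'x \<Rightarrow> ('y, 'a::comm_ring_1) mpoly"
  assumes "vars F \<subseteq> W"
  shows "poly_subst g F \<in> generate_ring (poly_ring V) (range Const \<union> g ` W)"
proof -
  let ?R = "generate_ring (poly_ring V) (range Const \<union> g ` W)"
  note cl = generate_ring_closed[where V = V and H = "g ` W"]
  have zero: "0 \<in> ?R" and one: "1 \<in> ?R" using cl(1)[of 0] cl(1)[of 1] by simp_all
  have pow: "x ^ k \<in> ?R" if "x \<in> ?R" for x k using that one cl(4) by (induction k) auto
  have prod: "prod f A \<in> ?R" if "\<And>x. x \<in> A \<Longrightarrow> f x \<in> ?R" for f :: "'x \<Rightarrow> ('y, 'a) mpoly" and A
    using that one cl(4) by (induction A rule: infinite_finite_induct) auto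
  have sum: "sum f A \<in> ?R" if "\<And>x. x \<in> A \<Longrightarrow> f x \<in> ?R" for f :: "('x \<Rightarrow>\<^sub>0 nat) \<Rightarrow> ('y, 'a) mpoly" and A
    using that zero cl(3) by (induction A rule: infinite_finite_induct) auto
  show ?thesis unfolding poly_subst_def
  proof (intro sum cl(4) prod pow cl(1))
    fix e x assume "e \<in> keys F" "x \<in> keys e"
    thus "g x \<in> ?R" using assms by (intro cl(2)) (auto simp: vars_def)
  qed
qed

lemma pres_map_ring_hom:
  "pres_map n m q \<in> ring_hom (gen_ring n m q) (S_alg n m q)"
  unfolding pres_map_def gen_ring_def S_alg_def generated_subalgebra_def KX_def
  by (rule ring_hom_memI)
    (auto simp: poly_subst_add poly_subst_mult poly_ring_def[of "coords n m q"]
      intro: poly_subst_in_generate_ring[unfolded poly_ring_def])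

text \<open>The additive inverse of the ring structure is meaningful on the carrier only.\<close>

lemma generate_ring_vars:
  assumes "h \<in> generate_ring (poly_ring V) H" and "\<And>h. h \<in> H \<Longrightarrow> vars h \<subseteq> V"
  shows "vars (h :: ('x, 'a::comm_ring_1) mpoly) \<subseteq> V"
proof -
  interpret cring "poly_ring V :: ('x, 'a) mpoly ring" by (rule cring_poly_ring)
  have "H \<subseteq> carrier (poly_ring V)" using assms(2) by (intro subsetI) simp
  thus ?thesis using generate_ring_in_carrier[of H h] assms(1) by simp
qed

lemma pres_map_image:
  "pres_map n m q ` carrier (gen_ring n m q)
     = carrier (S_alg n m q :: (coord, 'a::comm_ring_1) mpoly ring)"
proof
  show "pres_map n m q ` carrier (gen_ring n m q) \<subseteq> carrier (S_alg n m q :: (coord, 'a) mpoly ring)"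
    using pres_map_ring_hom[of n m q] by (auto simp: ring_hom_def)
next
  let ?I = "pres_map n m q ` carrier (gen_ring n m q) :: (coord, 'a) mpoly set"
  let ?H = "range Const \<union> gen_fun n m q ` gens n m q :: (coord, 'a) mpoly set"
  have H: "vars h \<subseteq> coords n m q" if "h \<in> ?H" for h using that
      by (auto dest: vars_gen_fun[THEN subsetD])
  show "carrier (S_alg n m q) \<subseteq> ?I"
  proof
    fix h :: "(coord, 'a) mpoly" assume "h \<in> carrier (S_alg n m q)"
    hence "h \<in> generate_ring (poly_ring (coords n m q)) ?H"
      by (simp add: S_alg_def generated_subalgebra_def KX_def)
    thus "h \<in> ?I"
    proof (induction rule: generate_ring.induct)
      case one
      show ?case by (rule image_eqI[of _ _ 1]) (auto simp: pres_map_def gen_ring_def)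
    next
      case (incl h)
      thus ?case
      proof
        assume "h \<in> range Const"
        then obtain c where "h = Const c" by blast
        thus ?thesis by (intro image_eqI[of _ _ "Const c"]) (auto simp: pres_map_def gen_ring_def)
      next
        assume "h \<in> gen_fun n m q ` gens n m q"
        then obtain g where "g \<in> gens n m q" "h = gen_fun n m q g" by blast
        thus ?thesis using vars_Var[of g]
          by (intro image_eqI[of _ _ "Var g"]) (auto simp: pres_map_Var gen_ring_def)
      qed
    next
      case (a_inv h)
      then obtain F where F: "h = pres_map n m q F"
          "vars F \<subseteq> gens n m q" by (auto simp: gen_ring_def)
      have "vars h \<subseteq> coords n m q" using generate_ring_vars[OF a_inv.hyps H] .
      hence "\<ominus>\<^bsub>poly_ring (coords n m q)\<^esub> h = pres_map n m q (- F)"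
        using poly_subst_diff[of "gen_fun n m q" 0 F]
            by (simp add: a_inv_poly_ring F(1) pres_map_def)
      thus ?case using F(2) by (intro image_eqI[of _ _ "- F"]) (auto simp: gen_ring_def)
    next
      case (eng_add h1 h2)
      then obtain F1 F2 where "h1 = pres_map n m q F1" "vars F1 \<subseteq> gens n m q"
        "h2 = pres_map n m q F2" "vars F2 \<subseteq> gens n m q" by (auto simp: gen_ring_def)
      thus ?case using vars_closed(1)[of F1 _ F2]
        by (intro image_eqI[of _ _ "F1 + F2"]) (auto simp: gen_ring_def pres_map_def poly_subst_add)
    next
      case (eng_mult h1 h2)
      then obtain F1 F2 where "h1 = pres_map n m q F1" "vars F1 \<subseteq> gens n m q"
        "h2 = pres_map n m q F2" "vars F2 \<subseteq> gens n m q" by (auto simp: gen_ring_def)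
      thus ?case using vars_closed(2)[of F1 _ F2]
        by (intro image_eqI[of _ _ "F1 * F2"]) (auto simp: gen_ring_def pres_map_def
            poly_subst_mult)
    qed
  qed
qed

lemma pres_map_kernel:
  "a_kernel (gen_ring n m q) (S_alg n m q) (pres_map n m q)
     = {F. vars F \<subseteq> gens n m q \<and> pres_map n m q F = 0}"
  by (simp add: a_kernel_def' gen_ring_def S_alg_def generated_subalgebra_def KX_def)

lemma pres_map_kernel_ideal:
  "ideal {F :: (gen, 'a::comm_ring_1) mpoly. vars F \<subseteq> gens n m q \<and> pres_map n m q F
      = 0} (gen_ring n m q)"
proof (rule idealI)
  interpret cring "gen_ring n m q :: (gen, 'a) mpoly ring"
    unfolding gen_ring_def by (rule cring_poly_ring)
  show "ring (gen_ring n m q :: (gen, 'a) mpoly ring)" by (rule ring_axioms)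
  show "subgroup {F :: (gen, 'a) mpoly. vars F \<subseteq> gens n m q \<and> pres_map n m q F = 0}
      (add_monoid (gen_ring n m q))"
  proof (rule group.subgroupI[OF a_group])
    show "inv\<^bsub>add_monoid (gen_ring n m q)\<^esub> F \<in> {F. vars F \<subseteq> gens n m q \<and> pres_map n m q F = 0}"
      if "F \<in> {F. vars F \<subseteq> gens n m q \<and> pres_map n m q F = 0}" for F :: "(gen, 'a) mpoly"
    proof -
      have "inv\<^bsub>add_monoid (gen_ring n m q)\<^esub> F = - F"
        using that a_inv_poly_ring[of F "gens n m q"] by (simp add: a_inv_def gen_ring_def)
      thus ?thesis using that poly_subst_diff[of "gen_fun n m q" 0 F] by (simp add: pres_map_def)
    qed
    show "{F :: (gen, 'a) mpoly. vars F \<subseteq> gens n m q \<and> pres_map n m q F = 0} \<noteq> {}"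
      by (auto simp: pres_map_def intro!: exI[of _ 0])
    show "{F :: (gen, 'a) mpoly. vars F \<subseteq> gens n m q \<and> pres_map n m q F = 0}
        \<subseteq> carrier (add_monoid (gen_ring n m q))"
      by (intro subsetI) (simp add: gen_ring_def)
  qed (simp_all add: gen_ring_def pres_map_def poly_subst_add vars_closed)
qed (simp_all add: gen_ring_def pres_map_def poly_subst_mult vars_closed)

section \<open>Existence of the six types of relations\<close>

lemma pres_map_simps:
  "pres_map n m q (F + G) = pres_map n m q F + pres_map n m q G"
  "pres_map n m q (F - G) = pres_map n m q F - pres_map n m q G"
  "pres_map n m q (F * G) = pres_map n m q F * pres_map n m q G"
  "pres_map n m q (Const c) = Const c"
  "pres_map n m q (sum f A) = (\<Sum>a\<in>A. pres_map n m q (f a))"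
  by (simp_all add: pres_map_def poly_subst_add poly_subst_diff poly_subst_mult poly_subst_sum)

lemma straightenings_nonempty:
  fixes f :: "'p \<Rightarrow> (coord, 'k::comm_ring_1) mpoly"
  assumes f: "f \<in> comb F D" and lhs: "pres_map n m q lhs = f p"
    and rhs: "\<And>t. t \<in> D \<Longrightarrow> pres_map n m q (rhs t) = F t p"
  shows "straightenings n m q lhs rhs D \<noteq> {}"
proof -
  obtain T c where T: "finite T" "T \<subseteq> D" "\<forall>t\<in>T. c t \<noteq> 0"
    "\<forall>p. f p = (\<Sum>t\<in>T. Const (c t) * F t p)"
    using comb_explicit[OF f] by blast
  have "(\<Sum>t\<in>T. Const (c t) * pres_map n m q (rhs t)) = (\<Sum>t\<in>T. Const (c t) * F t p)"
    using rhs T(2) by (intro sum.cong) auto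
  hence "pres_map n m q (lhs - (\<Sum>t\<in>T. Const (c t) * rhs t)) = 0"
    using lhs T(4) by (simp add: pres_map_simps)
  thus ?thesis unfolding straightenings_def using T(1-3) by blast
qed

lemma pres_map_vars:
  "pres_map n m q (X_var P) = (p_fun (fst P) (snd P) (generic_point n m q) ::
      (coord, 'a::comm_ring_1) mpoly)"
  "pres_map n m q (Y_var I) = u_fun n I (generic_point n m q)"
  "pres_map n m q (Z_var J) = xi_fun n J (generic_point n m q)"
proof -
  have "p_fun [] [] (generic_point n m q) = (1 :: (coord, 'a) mpoly)"
    by (simp add: p_fun_def minor_def generic_point_def)
  moreover have "pres_map n m q 1 = (1 :: (coord, 'a) mpoly)" by (simp add: pres_map_def)
  ultimately show "pres_map n m q (X_var P) = (p_fun (fst P) (snd P) (generic_point n m q) ::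
      (coord, 'a) mpoly)"
    by (auto simp: X_var_def pres_map_Var)
qed (simp_all add: Y_var_def Z_var_def pres_map_Var)

lemma maximal_minor_straightening:
  fixes v :: "nat list \<Rightarrow> (gen, 'k::comm_ring_1) mpoly"
  assumes n: "1 \<le> n" and I: "I \<in> I_set n N" and I': "I' \<in> I_set n N"
    and v: "\<And>L. L \<in> I_set n N \<Longrightarrow> pres_map n m q (v L) = rdet n \<rho> L"
  shows "straightenings n m q (v I * v I') (\<lambda>(L, L'). v L * v L')
    {(L, L'). L \<in> I_set n N \<and> L' \<in> I_set n N \<and> L \<succeq> I \<and> L \<succeq> I' \<and> I \<succeq> L' \<and> I' \<succeq> L'} \<noteq> {}"
    (is "straightenings _ _ _ _ _ ?D \<noteq> {}")
proof (rule straightenings_nonempty[where p = \<rho>])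
  show "(rdet2 n (I, I') :: _ \<Rightarrow> (coord, 'k) mpoly) \<in> comb (rdet2 n) ?D"
    using two_sided_straightening[OF n I I'] by (rule comb_trans) (auto intro!: comb_base)
qed (use I I' in \<open>auto simp: pres_map_simps rdet2_def v\<close>)

lemma R2_nonempty:
  assumes "1 \<le> n" and "I \<in> H_u n m" and "I' \<in> H_u n m"
  shows "(R2 n m q I I' :: (gen, 'k::comm_ring_1) mpoly set) \<noteq> {}"
  unfolding R2_def H_u_def
proof (rule maximal_minor_straightening[OF assms[unfolded H_u_def]])
  fix L assume "L \<in> I_set n m"
  thus "pres_map n m q (Y_var L)
      = rdet n (\<lambda>i j. fst (generic_point n m q) $$ (i, j) :: (coord, 'k) mpoly) L"
    using I_setD(1) by (simp add: pres_map_vars u_fun_def generic_point_def minor_full_columns)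
qed

lemma R3_nonempty:
  assumes "1 \<le> n" and "J \<in> H_xi n q" and "J' \<in> H_xi n q"
  shows "(R3 n m q J J' :: (gen, 'k::comm_ring_1) mpoly set) \<noteq> {}"
  unfolding R3_def H_xi_def
proof (rule maximal_minor_straightening[OF assms[unfolded H_xi_def]])
  let ?W = "snd (generic_point n m q) :: (coord, 'k) mpoly mat"
  fix L assume "L \<in> I_set n q"
  note L = I_setD[OF this]
  have W: "?W \<in> carrier_mat n q" by (simp add: generic_point_def)
  have "minor ?W\<^sup>T L [0..<n] = minor ?W [0..<n] L"
    by (rule minor_transpose[OF W]) (use L in auto)
  moreover have "minor ?W\<^sup>T L [0..<n] = rdet n (\<lambda>j i. ?W $$ (i, j)) L"
    unfolding minor_full_columns[OF L(1)]
    by (rule rdet_cong) (use W L nth_less[of L q] in auto)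
  ultimately show "pres_map n m q (Z_var L) = rdet n (\<lambda>j i. ?W $$ (i, j)) L"
    by (simp add: pres_map_vars xi_fun_def case_prod_unfold)
qed

lemma H_pE:
  assumes "P \<in> H_p n m q"
  obtains A B r where "P = (A, B)" "A \<in> I_set r m" "B \<in> I_set r q" "1 \<le> r" "r \<le> n"
  using assms by (auto simp: H_p_def)

lemma H_pI: "A \<in> I_set r m \<Longrightarrow> B \<in> I_set r q \<Longrightarrow> 1 \<le> r \<Longrightarrow> r \<le> n \<Longrightarrow> (A, B) \<in> H_p n m q"
  by (auto simp: H_p_def)

lemma R4_nonempty:
  assumes q: "1 \<le> q" and P: "P \<in> H_p n m q" and Q: "Q \<in> H_p n m q"
  shows "(R4 n m q P Q :: (gen, 'k::comm_ring_1) mpoly set) \<noteq> {}"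
  unfolding R4_def
proof (rule straightenings_nonempty[where p = "()"])
  let ?D = "{(C, D). C \<in> H_p n m q \<union> {([], [])} \<and> D \<in> H_p n m q
        \<and> C \<succeq>\<^sub>p P \<and> C \<succeq>\<^sub>p Q \<and> P \<succeq>\<^sub>p D \<and> Q \<succeq>\<^sub>p D}"
  define U :: "(coord, 'k) mpoly mat" where "U = fst (generic_point n m q)"
  define W :: "(coord, 'k) mpoly mat" where "W = snd (generic_point n m q)"
  have UW: "U \<in> carrier_mat m n" "W \<in> carrier_mat n q"
      by (simp_all add: U_def W_def generic_point_def)
  obtain A B r where P': "P = (A, B)" "A \<in> I_set r m" "B \<in> I_set r q" "1 \<le> r" "r \<le> n"
    using P by (rule H_pE)
  obtain A' B' r' where Q': "Q = (A', B')" "A' \<in> I_set r' m" "B' \<in> I_set r' q" "1 \<le> r'" "r' \<le> n"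
    using Q by (rule H_pE)
  show "(\<lambda>_ :: unit. minor2 (P, Q) (U * W)) \<in> comb (\<lambda>t _. minor2 t (U * W)) ?D"
  proof (rule comb_trans[OF comb_compose[OF minor_straightening[OF q P'(2,3) Q'(2,3)], folded
      P'(1) Q'(1)]],
      clarify)
    fix C1 C2 D1 D2 :: "nat list"
    let ?C = "(C1, C2)" and ?D' = "(D1, D2)"
    assume "fst ?C \<in> I_set (length (fst ?C)) m" "snd ?C \<in> I_set (length (fst ?C)) q"
      "fst ?D' \<in> I_set (length (fst ?D')) m" "snd ?D' \<in> I_set (length (fst ?D')) q"
      and ge: "?C \<succeq>\<^sub>p P" "?C \<succeq>\<^sub>p Q" "P \<succeq>\<^sub>p ?D'" "Q \<succeq>\<^sub>p ?D'"
    hence C: "C1 \<in> I_set (length C1) m" "C2 \<in> I_set (length C1) q"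
      and D: "D1 \<in> I_set (length D1) m" "D2 \<in> I_set (length D1) q" by simp_all
    show "(\<lambda>_ :: unit. minor2 (?C, ?D') (U * W)) \<in> comb (\<lambda>t _. minor2 t (U * W)) ?D"
    proof (cases "length D1 \<le> n")
      case False
      have "minor (U * W) D1 D2 = 0"
        by (rule minor_mult_eq_0[OF UW, of _ "length D1"])
          (use D False I_setD(1)[OF D(2)] I_setD(3)[OF D(1)] I_setD(3)[OF D(2)] in auto)
      thus ?thesis by (simp add: minor2_def comb.zero)
    next
      case True
      have le: "length C1 \<le> n" and ge1: "1 \<le> length D1"
        using ge(1,3) P' I_setD(1)[OF P'(2)] by (auto simp: pair_ge_def tuple_ge_def)
      have "?C \<in> H_p n m q \<union> {([], [])}"
      proof (cases "length C1 = 0")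
        case True
        thus ?thesis using I_setD(1)[OF C(2)] by simp
      next
        case False
        hence "1 \<le> length C1" by linarith
        thus ?thesis using H_pI[OF C _ le] by blast
      qed
      moreover have "?D' \<in> H_p n m q" by (rule H_pI[OF D ge1 True])
      ultimately have "(?C, ?D') \<in> ?D" using ge by blast
      thus ?thesis by (rule comb_base)
    qed
  qed
  show "pres_map n m q (X_var P * X_var Q) = minor2 (P, Q) (U * W)"
    by (simp add: pres_map_simps pres_map_vars p_fun_def minor2_def U_def W_def case_prod_unfold)
  show "pres_map n m q (case t of (C, D) \<Rightarrow> X_var C * X_var D) = minor2 t (U * W)" for t
    by (cases t) (simp add: pres_map_simps pres_map_vars p_fun_def minor2_def U_def W_def
        case_prod_unfold)
qed

lemma le_nth_of_sorted: "sorted_wrt (<) L \<Longrightarrow> j < length L \<Longrightarrow> j \<le> L ! j" for L :: "nat list"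
proof (induction j)
  case (Suc j)
  thus ?case using sorted_wrt_nth_less[of "(<)" L j "Suc j"] by force
qed simp

text \<open>Apply \<open>minor_straightening\<close> to \<open>U[1|W]\<close>, which has rank at most \<open>n\<close>.  Its first \<open>n\<close>
columns are \<open>U\<close>, and the others are \<open>UW\<close>.  In a term with \<open>D\<close> below \<open>(I, [0..<n])\<close>, the size of
\<open>D\<close> is at least \<open>n\<close>, hence equal to \<open>n\<close>, and its columns are at most \<open>0, \<dots>, n - 1\<close>, hence equal
to them.  The columns of \<open>C\<close> dominate those of \<open>B\<close> and so lie in the part \<open>UW\<close>.\<close>

lemma row_straightening:
  fixes U W :: "(coord, 'k::comm_ring_1) mpoly mat"
  assumes n: "1 \<le> n" and U: "U \<in> carrier_mat m n" and W: "W \<in> carrier_mat n q"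
    and A: "A \<in> I_set r m" and B: "B \<in> I_set r q" and r: "1 \<le> r" "r \<le> n" and I: "I \<in> I_set n m"
  shows "(\<lambda>_ :: unit. minor (U * W) A B * minor U I [0..<n])
    \<in> comb (\<lambda>((A', B'), I') _. minor (U * W) A' B' * minor U I' [0..<n])
      {((A', B'), I'). (A', B') \<in> H_p n m q \<and> I' \<in> I_set n m
          \<and> A' \<succeq> A \<and> A' \<succeq> I \<and> A \<succeq> I' \<and> I \<succeq> I' \<and> B' \<succeq> B}"
    (is "_ \<in> comb ?F ?S")
proof -
  \<comment> \<open>The matrix \<open>[1|W]\<close>.\<close>
  define E where "E = mat n (n + q) (\<lambda>(k, j). if j < n then if k
      = j then 1 else 0 else W $$ (k, j - n))"
  have E: "E \<in> carrier_mat n (n + q)" by (simp add: E_def)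
  let ?sh = "map (\<lambda>b. n + b)"
  have entry1: "(U * E) $$ (i, j) = U $$ (i, j)" if "i < m" "j < n" for i j
  proof -
    have "(U * E) $$ (i, j) = (\<Sum>k = 0..<n. U $$ (i, k) * (if k = j then 1 else 0))"
      using that U by (simp add: E_def scalar_prod_def)
    thus ?thesis using that by (simp add: if_distrib[of "(*) _"] cong: if_cong)
  qed
  have entry2: "(U * E) $$ (i, n + j) = (U * W) $$ (i, j)" if "i < m" "j < q" for i j
    using that U W by (auto simp: E_def scalar_prod_def intro!: sum.cong)
  have minor1: "minor (U * E) I' [0..<n] = minor U I' [0..<n]" if "I' \<in> I_set n m" for I'
    using I_setD[OF that] nth_less[of I' m] entry1
    by (auto simp: minor_full_columns intro!: rdet_cong)
  have minor2: "minor (U * E) A' (?sh B') = minor (U * W) A' B'"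
    if "A' \<in> I_set s m" "B' \<in> I_set s q" for A' B' s
    using I_setD[OF that(1)] I_setD[OF that(2)] nth_less[of A' m] nth_less[of B' q] entry2
    by (auto simp: minor_eq_rdet intro!: rdet_cong)
  have shB: "?sh B \<in> I_set r (n + q)"
    using I_setD[OF B] by (auto simp: I_set_def sorted_wrt_map)
  have up: "[0..<n] \<in> I_set n (n + q)" by (auto simp: I_set_def sorted_wrt_upt)
  have "(\<lambda>_ :: unit. minor2 ((A, ?sh B), (I, [0..<n])) (U * E)) \<in> comb ?F ?S"
  proof (rule comb_trans[OF comb_compose[OF minor_straightening[OF _ A shB I up]]], use n in
      simp, clarify)
    fix C1 C2 D1 D2 :: "nat list"
    assume "fst (C1, C2) \<in> I_set (length (fst (C1, C2))) m"
        "snd (C1, C2) \<in> I_set (length (fst (C1, C2))) (n + q)"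
      "fst (D1, D2) \<in> I_set (length (fst (D1, D2))) m"
          "snd (D1, D2) \<in> I_set (length (fst (D1, D2))) (n + q)"
      "(C1, C2) \<succeq>\<^sub>p (A, ?sh B)" "(C1, C2) \<succeq>\<^sub>p (I, [0..<n])" "(A, ?sh B) \<succeq>\<^sub>p (D1, D2)"
          "(I, [0..<n]) \<succeq>\<^sub>p (D1, D2)"
      "length (fst (C1, C2)) + length (fst (D1, D2)) = r + n"
    hence C: "C1 \<in> I_set (length C1) m" "C2 \<in> I_set (length C1) (n + q)"
      and D: "D1 \<in> I_set (length D1) m" "D2 \<in> I_set (length D1) (n + q)"
      and ge: "C1 \<succeq> A" "C1 \<succeq> I" "C2 \<succeq> ?sh B" "A \<succeq> D1" "I \<succeq> D1" "[0..<n] \<succeq> D2"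
      and len: "length C1 + length D1 = r + n"
      by (simp_all add: pair_ge_def)
    show "(\<lambda>_ :: unit. minor2 ((C1, C2), (D1, D2)) (U * E)) \<in> comb ?F ?S"
    proof (cases "length D1 = n")
      case False
      hence "n < length D1" using ge(5) I_setD(1)[OF I] by (simp add: tuple_ge_def)
      hence "minor (U * E) D1 D2 = 0"
        by (intro minor_mult_eq_0[OF U E, of _ "length D1"])
          (use D I_setD(1)[OF D(2)] I_setD(3)[OF D(1)] I_setD(3)[OF D(2)] in auto)
      thus ?thesis by (simp add: minor2_def comb.zero)
    next
      case True
      have D2: "D2 = [0..<n]"
      proof (rule nth_equalityI)
        show "length D2 = length [0..<n]" using I_setD(1)[OF D(2)] True by simp
        fix j assume j: "j < length D2"
        hence "j \<le> D2 ! j" by (rule le_nth_of_sorted[OF I_setD(2)[OF D(2)]])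
        moreover have "D2 ! j \<le> j"
          using ge(6) j I_setD(1)[OF D(2)] True by (auto simp: tuple_ge_def)
        ultimately show "D2 ! j = [0..<n] ! j" using j I_setD(1)[OF D(2)] True by simp
      qed
      define B' where "B' = map (\<lambda>x. x - n) C2"
      have lenC: "length C1 = r" "length C2 = r" using len True I_setD(1)[OF C(2)] by simp_all
      have n_le: "n + B ! j \<le> C2 ! j" if "j < r" for j
        using ge(3) that lenC I_setD(1)[OF B] by (auto simp: tuple_ge_def)
      have C2: "C2 = ?sh B'"
        unfolding B'_def map_map
      proof (rule map_idI[symmetric])
        fix x assume "x \<in> set C2"
        then obtain j where "j < r" "x = C2 ! j" using lenC by (auto simp: in_set_conv_nth)
        thus "((\<lambda>b. n + b) \<circ> (\<lambda>x. x - n)) x = x" using n_le[of j] by simp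
      qed
      have B': "B' \<in> I_set r q"
        using I_setD[OF C(2)] lenC unfolding C2 by (auto simp: I_set_def sorted_wrt_map)
      have "B ! j \<le> C2 ! j - n" if "j < r" for j using n_le[OF that] by linarith
      hence "B' \<succeq> B" using lenC I_setD(1)[OF B] by (simp add: tuple_ge_def B'_def)
      hence "((C1, B'), D1) \<in> ?S"
        using C(1) D(1) B' r True lenC ge by (auto intro!: H_pI)
      hence "?F ((C1, B'), D1) \<in> comb ?F ?S" by (rule comb_base)
      also have "?F ((C1, B'), D1) = (\<lambda>_ :: unit. minor2 ((C1, C2), (D1, D2)) (U * E))"
        using C(1) D(1) True lenC B' by (auto simp: minor2_def minor1 minor2 D2 C2)
      finally show ?thesis .
    qed
  qed
  also have "(\<lambda>_ :: unit. minor2 ((A, ?sh B), (I, [0..<n])) (U * E))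
      = (\<lambda>_. minor (U * W) A B * minor U I [0..<n])"
    using A B I by (simp add: minor2_def minor1 minor2)
  finally show ?thesis .
qed

lemma R5_nonempty:
  assumes n: "1 \<le> n" and P: "P \<in> H_p n m q" and I: "I \<in> H_u n m"
  shows "(R5 n m q P I :: (gen, 'k::comm_ring_1) mpoly set) \<noteq> {}"
proof -
  obtain A B r where P': "P = (A, B)" "A \<in> I_set r m" "B \<in> I_set r q" "1 \<le> r" "r \<le> n"
    using P by (rule H_pE)
  define U :: "(coord, 'k) mpoly mat" where "U = fst (generic_point n m q)"
  define W :: "(coord, 'k) mpoly mat" where "W = snd (generic_point n m q)"
  have UW: "U \<in> carrier_mat m n" "W \<in> carrier_mat n q"
      by (simp_all add: U_def W_def generic_point_def)
  show ?thesis unfolding R5_def P'(1) prod.case H_u_def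
    by (rule straightenings_nonempty[OF row_straightening[OF n UW P'(2-5) I[unfolded H_u_def]],
        where p = "()"])
      (auto simp: pres_map_simps pres_map_vars p_fun_def u_fun_def U_def W_def case_prod_unfold)
qed

lemma R6_nonempty:
  assumes n: "1 \<le> n" and P: "P \<in> H_p n m q" and J: "J \<in> H_xi n q"
  shows "(R6 n m q P J :: (gen, 'k::comm_ring_1) mpoly set) \<noteq> {}"
proof -
  obtain A B r where P': "P = (A, B)" "A \<in> I_set r m" "B \<in> I_set r q" "1 \<le> r" "r \<le> n"
    using P by (rule H_pE)
  define U :: "(coord, 'k) mpoly mat" where "U = fst (generic_point n m q)"
  define W :: "(coord, 'k) mpoly mat" where "W = snd (generic_point n m q)"
  have U: "U \<in> carrier_mat m n" and W: "W \<in> carrier_mat n q"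
      by (simp_all add: U_def W_def generic_point_def)
  have UT: "U\<^sup>T \<in> carrier_mat n m" and WT: "W\<^sup>T \<in> carrier_mat q n" using U W by simp_all
  have p: "minor (W\<^sup>T * U\<^sup>T) B' A' = minor (U * W) A' B'" if "A' \<in> I_set s m"
      "B' \<in> I_set s q" for A' B' s
  proof -
    have "W\<^sup>T * U\<^sup>T = (U * W)\<^sup>T" using transpose_mult[OF U W] by simp
    thus ?thesis
      using minor_transpose[of "U * W" m q A' B'] I_setD[OF that(1)] I_setD[OF that(2)] U W by simp
  qed
  have xi: "minor W\<^sup>T L [0..<n] = minor W [0..<n] L" if "L \<in> I_set n q" for L
    by (rule minor_transpose[OF W]) (use I_setD[OF that] in auto)
  let ?F = "\<lambda>((A', B'), J') (_ :: unit). minor (U * W) A' B' * minor W [0..<n] J'"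
  let ?S = "{((A', B'), J'). (A', B') \<in> H_p n m q \<and> J' \<in> I_set n q
          \<and> A' \<succeq> A \<and> B' \<succeq> B \<and> B' \<succeq> J \<and> B \<succeq> J' \<and> J \<succeq> J'}"
  have "(\<lambda>_ :: unit. minor (W\<^sup>T * U\<^sup>T) B A * minor W\<^sup>T J [0..<n]) \<in> comb ?F ?S"
  proof (rule comb_trans[OF row_straightening[OF n WT UT P'(3,2,4,5) J[unfolded
      H_xi_def]]], clarify)
    fix B' A' J' assume t: "(B', A') \<in> H_p n q m" "J' \<in> I_set n q" "B' \<succeq> B" "B' \<succeq> J" "B \<succeq> J'"
        "J \<succeq> J'" "A' \<succeq> A"
    obtain s where s: "A' \<in> I_set s m" "B' \<in> I_set s q" "1 \<le> s" "s \<le> n"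
      using t(1) by (auto simp: H_p_def)
    have "?F ((A', B'), J') \<in> comb ?F ?S"
      by (rule comb_base) (use t s in \<open>auto intro!: H_pI\<close>)
    thus "(\<lambda>_. minor (W\<^sup>T * U\<^sup>T) B' A' * minor W\<^sup>T J' [0..<n]) \<in> comb ?F ?S"
      using p[OF s(1,2)] xi[OF t(2)] by simp
  qed
  hence *: "(\<lambda>_ :: unit. minor (U * W) A B * minor W [0..<n] J) \<in> comb ?F ?S"
    using p[OF P'(2,3)] xi[of J] J by (simp add: H_xi_def)
  show ?thesis unfolding R6_def P'(1) prod.case H_xi_def
    by (rule straightenings_nonempty[OF *, where p = "()"])
      (auto simp: pres_map_simps pres_map_vars p_fun_def xi_fun_def U_def W_def case_prod_unfold)
qed

lemma pres_map_R1:
  assumes I: "I \<in> H_u n m" and J: "J \<in> H_xi n q"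
  shows "pres_map n m q (Y_var I * Z_var J - X_var (I, J)) = (0 :: (coord, 'k::comm_ring_1) mpoly)"
proof -
  define U :: "(coord, 'k) mpoly mat" where "U = fst (generic_point n m q)"
  define W :: "(coord, 'k) mpoly mat" where "W = snd (generic_point n m q)"
  have U: "U \<in> carrier_mat m n" and W: "W \<in> carrier_mat n q"
      by (simp_all add: U_def W_def generic_point_def)
  note I' = I_setD[OF I[unfolded H_u_def]] and J' = I_setD[OF J[unfolded H_xi_def]]
  let ?UI = "mat n n (\<lambda>(i, j). U $$ (I ! i, [0..<n] ! j))" and ?WJ
      = "mat n n (\<lambda>(i, j). W $$ ([0..<n] ! i, J ! j))"
  have "mat n n (\<lambda>(i, j). (U * W) $$ (I ! i, J ! j)) = ?UI * ?WJ"
    using U W I' J' nth_less[of I m] nth_less[of J q]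
    by (intro eq_matI) (auto simp: scalar_prod_def intro!: sum.cong)
  hence "minor (U * W) I J = minor U I [0..<n] * minor W [0..<n] J"
    unfolding minor_def I'(1) J'(1) length_upt diff_zero by (simp add: det_mult[of _ n])
  thus ?thesis
    by (simp add: pres_map_simps pres_map_vars p_fun_def u_fun_def xi_fun_def U_def W_def
        case_prod_unfold)
qed

lemma vars_X_var: "(A, B) \<in> H_p n m q \<Longrightarrow> vars (X_var (A, B) :: (gen, 'k::comm_ring_1) mpoly)
    \<subseteq> gens n m q"
  using vars_Var[of "X A B"] by (auto simp: X_var_def gens_iff)

lemma relations_in_kernel:
  assumes n: "1 \<le> n" and R: "R \<in> relation_sets n m q" and r: "r \<in> R"
  shows "vars (r :: (gen, 'k::comm_ring_1) mpoly) \<subseteq> gens n m q \<and> pres_map n m q r = 0"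
proof -
  have X: "vars (X_var P :: (gen, 'k) mpoly) \<subseteq> gens n m q" if "P \<in> H_p n m q \<union> {([], [])}" for P
  proof (cases "P = ([], [])")
    case False
    thus ?thesis using that vars_X_var[of "fst P" "snd P" n m q, where 'k = 'k] by simp
  qed (simp add: X_var_def)
  have Y: "vars (Y_var I :: (gen, 'k) mpoly) \<subseteq> gens n m q" if "I \<in> H_u n m" for I
    using vars_Var[of "Y I"] that by (auto simp: Y_var_def gens_iff)
  have Z: "vars (Z_var J :: (gen, 'k) mpoly) \<subseteq> gens n m q" if "J \<in> H_xi n q" for J
    using vars_Var[of "Z J"] that by (auto simp: Z_var_def gens_iff)
  have str: "vars r \<subseteq> gens n m q \<and> pres_map n m q r = 0"
    if r: "r \<in> straightenings n m q lhs rhs D" and lhs: "vars lhs \<subseteq> gens n m q"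
      and rhs: "\<And>t. t \<in> D \<Longrightarrow> vars (rhs t) \<subseteq> gens n m q"
    for lhs D and rhs :: "'t \<Rightarrow> (gen, 'k) mpoly"
  proof -
    obtain T c where T: "T \<subseteq> D" "r = lhs - (\<Sum>t\<in>T. Const (c t) * rhs t)"
      "pres_map n m q (lhs - (\<Sum>t\<in>T. Const (c t) * rhs t)) = 0"
      using r unfolding straightenings_def by blast
    have "vars (\<Sum>t\<in>T. Const (c t) * rhs t) \<subseteq> gens n m q"
      using T(1) rhs by (intro vars_sum vars_closed(2)) auto
    thus ?thesis using vars_diff[OF lhs] T(2,3) by simp
  qed
  show ?thesis
    using R r unfolding relation_sets_def
  proof (elim UnE CollectE exE conjE)
    fix I J assume h: "R = R1 I J" "I \<in> H_u n m" "J \<in> H_xi n q"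
    have "(I, J) \<in> H_p n m q" using h n by (auto simp: H_u_def H_xi_def intro!: H_pI)
    hence "vars (Y_var I * Z_var J - X_var (I, J) :: (gen, 'k) mpoly) \<subseteq> gens n m q"
      using h X by (intro vars_diff vars_closed(2) Y Z) auto
    thus ?thesis using r pres_map_R1[OF h(2,3)] h(1) by (simp add: R1_def)
  next
    fix I I' assume h: "R = R2 n m q I I'" "I \<in> H_u n m" "I' \<in> H_u n m"
    show ?thesis using r unfolding h(1) R2_def
      by (rule str) (use h Y in \<open>simp_all add: vars_closed(2) case_prod_beta\<close>)
  next
    fix J J' assume h: "R = R3 n m q J J'" "J \<in> H_xi n q" "J' \<in> H_xi n q"
    show ?thesis using r unfolding h(1) R3_def
      by (rule str) (use h Z in \<open>simp_all add: vars_closed(2) case_prod_beta\<close>)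
  next
    fix P Q assume h: "R = R4 n m q P Q" "P \<in> H_p n m q" "Q \<in> H_p n m q"
    show ?thesis using r unfolding h(1) R4_def
      by (rule str) (use h X in \<open>simp_all add: vars_closed(2) case_prod_beta\<close>)
  next
    fix P I assume h: "R = R5 n m q P I" "P \<in> H_p n m q" "I \<in> H_u n m"
    obtain A B where P: "P = (A, B)" by fastforce
    show ?thesis using r unfolding h(1) R5_def P prod.case
      by (rule str) (use h P X Y in \<open>simp_all add: vars_closed(2) case_prod_beta\<close>)
  next
    fix P J assume h: "R = R6 n m q P J" "P \<in> H_p n m q" "J \<in> H_xi n q"
    obtain A B where P: "P = (A, B)" by fastforce
    show ?thesis using r unfolding h(1) R6_def P prod.case
      by (rule str) (use h P X Z in \<open>simp_all add: vars_closed(2) case_prod_beta\<close>)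
  qed
qed

lemma relation_system_exists:
  assumes n: "1 \<le> n" and q: "1 \<le> q"
  shows "relation_system n m q (\<Union> (relation_sets n m q) :: (gen, 'k::comm_ring_1) mpoly set)"
proof -
  have "R \<noteq> {}" if "R \<in> (relation_sets n m q :: (gen, 'k) mpoly set set)" for R
    using that unfolding relation_sets_def
    by (elim UnE CollectE exE conjE)
      (auto simp: R1_def dest: R2_nonempty[OF n] R3_nonempty[OF n] R4_nonempty[OF q]
        R5_nonempty[OF n] R6_nonempty[OF n])
  thus ?thesis unfolding relation_system_def by blast
qed

section \<open>Termination of straightening\<close>

text \<open>Missing entries count as the upper bound \<open>K\<close>, in accordance with the empty tuple being
the largest.\<close>

definition tuple_rank :: "nat \<Rightarrow> nat \<Rightarrow> nat list \<Rightarrow> nat" where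
  "tuple_rank n K A = (\<Sum>j<n. if j < length A then A ! j else K)"

lemma tuple_rank_le:
  "set A \<subseteq> {0..<K} \<Longrightarrow> tuple_rank n K A \<le> n * K"
  using sum_bounded_above[of "{..<n}" "\<lambda>j. if j < length A then A ! j else K" K] nth_less[of A K]
  by (auto simp: tuple_rank_def less_imp_le)

lemma tuple_rank_mono:
  assumes "A \<succeq> A'" and "set A' \<subseteq> {0..<K}" "length A' \<le> n"
  shows "tuple_rank n K A' \<le> tuple_rank n K A" and "A \<noteq> A' \<Longrightarrow> tuple_rank n K A' < tuple_rank n K A"
proof -
  let ?f = "\<lambda>A j. if j < length A then A ! j else K"
  have lt: "A' ! j < K" if "j < length A'" for j using nth_less[OF assms(2) that] .
  have le: "?f A' j \<le> ?f A j" for j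
    using assms(1) lt[of j] by (auto simp: tuple_ge_def)
  show "tuple_rank n K A' \<le> tuple_rank n K A" unfolding tuple_rank_def by (rule sum_mono) (rule le)
  assume ne: "A \<noteq> A'"
  have "\<exists>j<n. ?f A' j < ?f A j"
  proof (cases "length A = length A'")
    case True
    then obtain j where j: "j < length A" "A ! j \<noteq> A' ! j" using ne nth_equalityI by blast
    hence "A' ! j < A ! j" using assms(1) by (auto simp: tuple_ge_def le_neq_implies_less)
    thus ?thesis using j True assms(3) by (intro exI[of _ j]) auto
  next
    case False
    hence "length A < length A'" using assms(1) by (simp add: tuple_ge_def)
    thus ?thesis using lt[of "length A"] assms(3) by (intro exI[of _ "length A"]) auto
  qed
  hence ex: "\<exists>j\<in>{..<n}. ?f A' j < ?f A j" by blast
  show "tuple_rank n K A' < tuple_rank n K A"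
    unfolding tuple_rank_def by (rule sum_strict_mono_ex1[OF finite_lessThan ballI[OF le] ex])
qed

text \<open>The summand 1 makes \<open>p(A,B)\<close> larger than \<open>u(I)\<close> whenever \<open>A \<succeq> I\<close>.\<close>

fun gen_rank :: "nat \<Rightarrow> nat \<Rightarrow> gen \<Rightarrow> nat" where
  "gen_rank n K (X A B) = Suc (tuple_rank n K A + tuple_rank n K B)"
| "gen_rank n K (Y I) = tuple_rank n K I"
| "gen_rank n K (Z J) = tuple_rank n K J"

text \<open>The rank of \<open>p(\<emptyset>,\<emptyset>) = 1\<close>, so that its cost is 0 and dropping this factor is the same as
keeping it.\<close>

definition top_rank :: "nat \<Rightarrow> nat \<Rightarrow> nat" where
  "top_rank n K = gen_rank n K (X [] [])"

text \<open>The surcharge on \<open>u\<close> and \<open>\<xi>\<close> makes (R1) decrease the cost; the other relations preserve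
the number of these factors.\<close>

fun charge :: "gen \<Rightarrow> nat" where
  "charge (X A B) = 0" | "charge (Y I) = 1" | "charge (Z J) = 1"

definition gen_cost :: "nat \<Rightarrow> nat \<Rightarrow> gen \<Rightarrow> nat" where
  "gen_cost n K g = (2 ^ top_rank n K - 2 ^ gen_rank n K g)
     + charge g * 2 ^ top_rank n K"

text \<open>The smaller factor of an exchange can become arbitrarily small; an exponential cost
rewards the larger factor enough to compensate for that.\<close>

lemma two_power_convex:
  fixes R x y c d :: nat
  assumes "x < c" "y < c" "c \<le> R"
  shows "(2 ^ R - 2 ^ c) + (2 ^ R - 2 ^ d) < (2 ^ R - 2 ^ x) + (2 ^ R - 2 ^ y :: nat)"
proof -
  obtain e where c: "c = Suc e" using assms(1) by (cases c) auto
  have "(2 :: nat) ^ x + 2 ^ y \<le> 2 ^ e + 2 ^ e"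
    using assms c by (intro add_mono power_increasing) auto
  hence "(2 :: nat) ^ x + 2 ^ y \<le> 2 ^ c" by (simp add: c)
  moreover have "(2 :: nat) ^ c \<le> 2 ^ R" using assms(3) by (rule power_increasing) simp
  moreover have "(0 :: nat) < 2 ^ d" "(0 :: nat) < 2 ^ R" by simp_all
  ultimately show ?thesis by linarith
qed

definition gen_monom :: "gen multiset \<Rightarrow> (gen, 'k::comm_ring_1) mpoly" where
  "gen_monom M = (\<Prod>g\<in>#M. Var g)"

lemma gen_monom_simps [simp]:
  "gen_monom {#} = 1" "gen_monom (add_mset g M) = Var g * gen_monom M"
      "gen_monom (M + N) = gen_monom M * gen_monom N"
  by (simp_all add: gen_monom_def)

lemma vars_gen_monom: "set_mset M \<subseteq> V \<Longrightarrow> vars (gen_monom M :: (gen, 'k::comm_ring_1) mpoly) \<subseteq> V"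
proof (induction M)
  case (add g M)
  hence "vars (Var g :: (gen, 'k) mpoly) \<subseteq> V" using vars_Var[of g] by fastforce
  thus ?case using add by (simp add: vars_closed(2))
qed simp

lemma pres_map_gen_monom: "pres_map n m q (gen_monom M) = (\<Prod>g\<in>#M. gen_fun n m q g)"
  unfolding gen_monom_def pres_map_def poly_subst_prod_mset by simp

definition cost :: "nat \<Rightarrow> nat \<Rightarrow> gen multiset \<Rightarrow> nat" where
  "cost n K M = (\<Sum>g\<in>#M. gen_cost n K g)"

lemma cost_simps [simp]:
  "cost n K {#} = 0" "cost n K (add_mset g M) = gen_cost n K g + cost n K M"
  "cost n K (M + N) = cost n K M + cost n K N"
  by (simp_all add: cost_def)

text \<open>Modulo \<open>r\<close>, the product of \<open>g\<close> and \<open>h\<close> is a combination of cheaper monomials.\<close>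

definition reduces ::
    "nat \<Rightarrow> nat \<Rightarrow> nat \<Rightarrow> gen \<Rightarrow> gen \<Rightarrow> (gen, 'k::comm_ring_1) mpoly \<Rightarrow> bool" where
  "reduces n m q g h r \<longleftrightarrow> (\<lambda>_ :: unit. Var g * Var h - r) \<in> comb (\<lambda>M _. gen_monom M)
     {M. set_mset M \<subseteq> gens n m q \<and> cost n (m + q) M < cost n (m + q) {#g, h#}}"

lemma straightening_reduces:
  assumes r: "r \<in> straightenings n m q (Var g * Var h) rhs D"
    and D: "\<And>t. t \<in> D \<Longrightarrow> \<exists>M. rhs t = gen_monom M \<and> set_mset M \<subseteq> gens n m q
      \<and> cost n (m + q) M < cost n (m + q) {#g, h#}"
  shows "reduces n m q g h r"
proof -
  obtain T c where T: "T \<subseteq> D" "r = Var g * Var h - (\<Sum>t\<in>T. Const (c t) * rhs t)"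
    using r unfolding straightenings_def by blast
  have "(\<lambda>_ :: unit. \<Sum>t\<in>T. Const (c t) * rhs t) \<in> comb (\<lambda>M _. gen_monom M)
     {M. set_mset M \<subseteq> gens n m q \<and> cost n (m + q) M < cost n (m + q) {#g, h#}}"
  proof (intro comb_sum comb_scale)
    fix t assume "t \<in> T"
    then obtain M where M: "rhs t = gen_monom M" "M \<in> {M. set_mset M \<subseteq> gens n m q
      \<and> cost n (m + q) M < cost n (m + q) {#g, h#}}" using D T(1) by blast
    show "(\<lambda>_ :: unit. rhs t) \<in> comb (\<lambda>M _. gen_monom M)
       {M. set_mset M \<subseteq> gens n m q \<and> cost n (m + q) M < cost n (m + q) {#g, h#}}"
      unfolding M(1) by (rule comb_base[OF M(2), of "\<lambda>M _. gen_monom M"])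
  qed
  thus ?thesis unfolding reduces_def T(2) by simp
qed

lemma H_bounds:
  "(A, B) \<in> H_p n m q \<Longrightarrow> set A \<subseteq> {0..<m + q} \<and> set B \<subseteq> {0..<m + q} \<and> length A \<le> n \<and> length B \<le> n
     \<and> length B = length A \<and> A \<noteq> [] \<and> B \<noteq> []"
  "I \<in> H_u n m \<Longrightarrow> set I \<subseteq> {0..<m + q} \<and> length I = n"
  "J \<in> H_xi n q \<Longrightarrow> set J \<subseteq> {0..<m + q} \<and> length J = n"
  by (fastforce simp: H_p_def H_u_def H_xi_def I_set_def)+

lemma gen_rank_le:
  assumes "g \<in> gens n m q" shows "gen_rank n (m + q) g \<le> top_rank n (m + q)"
proof (cases g)
  case (X A B)
  thus ?thesis using assms H_bounds(1)[of A B n m q] tuple_rank_le[of A "m + q" n]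
      tuple_rank_le[of B "m + q" n]
    by (simp add: gens_iff top_rank_def) (simp add: tuple_rank_def)
next
  case (Y I)
  thus ?thesis using assms H_bounds(2)[of I n m q] tuple_rank_le[of I "m + q" n]
    by (simp add: gens_iff top_rank_def) (simp add: tuple_rank_def)
next
  case (Z J)
  thus ?thesis using assms H_bounds(3)[of J n q m] tuple_rank_le[of J "m + q" n]
    by (simp add: gens_iff top_rank_def) (simp add: tuple_rank_def)
qed

lemma pair_rank_less:
  assumes "C \<succeq>\<^sub>p (A, B)" "C \<noteq> (A, B)" "(A, B) \<in> H_p n m q"
  shows "gen_rank n (m + q) (X A B) < gen_rank n (m + q) (X (fst C) (snd C))"
proof -
  note b = H_bounds(1)[OF assms(3)]
  have ge: "fst C \<succeq> A" "snd C \<succeq> B" using assms(1) by (simp_all add: pair_ge_def)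
  have le: "tuple_rank n (m + q) A \<le> tuple_rank n (m + q) (fst C)"
    "tuple_rank n (m + q) B \<le> tuple_rank n (m + q) (snd C)"
    using tuple_rank_mono(1)[OF ge(1)] tuple_rank_mono(1)[OF ge(2)] b by auto
  have "fst C \<noteq> A \<or> snd C \<noteq> B" using assms(2) by (auto simp: prod_eq_iff)
  hence "tuple_rank n (m + q) A < tuple_rank n (m + q) (fst C)
      \<or> tuple_rank n (m + q) B < tuple_rank n (m + q) (snd C)"
    using tuple_rank_mono(2)[OF ge(1)] tuple_rank_mono(2)[OF ge(2)] b by auto
  thus ?thesis using le by auto
qed

lemma cost_exchange:
  assumes "gen_rank n (m + q) g < gen_rank n (m + q) c"
      "gen_rank n (m + q) h < gen_rank n (m + q) c"
    and "c \<in> gens n m q"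
    and "charge g + charge h = charge c + charge d"
  shows "cost n (m + q) {#c, d#} < cost n (m + q) {#g, h#}"
proof -
  let ?R = "2 ^ top_rank n (m + q) :: nat"
  have "charge g * ?R + charge h * ?R = charge c * ?R + charge d * ?R"
    using assms(4) by (simp add: distrib_right[symmetric])
  thus ?thesis
    using two_power_convex[OF assms(1,2) gen_rank_le[OF assms(3)], of "gen_rank n (m + q) d"]
    by (simp add: gen_cost_def)
qed

lemma reduces_commute: "reduces n m q g h r \<Longrightarrow> reduces n m q h g r"
  by (simp add: reduces_def mult.commute add_mset_commute)

lemma R5_reduces:
  assumes P: "(A, B) \<in> H_p n m q" and I: "I \<in> H_u n m" and ng: "\<not> A \<succeq> I"
    and r: "r \<in> R5 n m q (A, B) I"
  shows "reduces n m q (X A B) (Y I) (r :: (gen, 'k::comm_ring_1) mpoly)"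
proof -
  note b = H_bounds(1)[OF P] and bI = H_bounds(2)[OF I, of q]
  have lhs: "X_var (A, B) * Y_var I = (Var (X A B) * Var (Y I) :: (gen, 'k) mpoly)"
    using b by (simp add: X_var_def Y_var_def)
  show ?thesis
  proof (rule straightening_reduces[OF r[unfolded R5_def prod.case lhs]], clarify)
    fix A' B' I' assume t: "(A', B') \<in> H_p n m q" "I' \<in> H_u n m" "A' \<succeq> A" "A' \<succeq> I" "A \<succeq> I'"
        "I \<succeq> I'" "B' \<succeq> B"
    note b' = H_bounds(1)[OF t(1)]
    have "gen_rank n (m + q) (X A B) < gen_rank n (m + q) (X A' B')"
      using pair_rank_less[of "(A', B')" A B] P t ng by (auto simp: pair_ge_def)
    moreover have "gen_rank n (m + q) (Y I) < gen_rank n (m + q) (X A' B')"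
      using tuple_rank_mono(1)[OF t(4)] bI by (simp add: less_Suc_eq_le trans_le_add1)
    ultimately have "cost n (m + q) {#X A' B', Y I'#} < cost n (m + q) {#X A B, Y I#}"
      using t(1) by (intro cost_exchange) (simp_all add: gens_iff)
    thus "\<exists>M. X_var (A', B') * Y_var I' = (gen_monom M :: (gen, 'k) mpoly) \<and> set_mset M \<subseteq> gens n m q
        \<and> cost n (m + q) M < cost n (m + q) {#X A B, Y I#}"
      using t(1,2) b' by (intro exI[of _ "{#X A' B', Y I'#}"]) (simp add: X_var_def Y_var_def
          gens_iff)
  qed
qed

lemma R6_reduces:
  assumes P: "(A, B) \<in> H_p n m q" and J: "J \<in> H_xi n q" and ng: "\<not> B \<succeq> J"
    and r: "r \<in> R6 n m q (A, B) J"
  shows "reduces n m q (X A B) (Z J) (r :: (gen, 'k::comm_ring_1) mpoly)"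
proof -
  note b = H_bounds(1)[OF P] and bJ = H_bounds(3)[OF J, of m]
  have lhs: "X_var (A, B) * Z_var J = (Var (X A B) * Var (Z J) :: (gen, 'k) mpoly)"
    using b by (simp add: X_var_def Z_var_def)
  show ?thesis
  proof (rule straightening_reduces[OF r[unfolded R6_def prod.case lhs]], clarify)
    fix A' B' J' assume t: "(A', B') \<in> H_p n m q" "J' \<in> H_xi n q" "A' \<succeq> A" "B' \<succeq> B" "B' \<succeq> J"
        "B \<succeq> J'" "J \<succeq> J'"
    note b' = H_bounds(1)[OF t(1)]
    have "gen_rank n (m + q) (X A B) < gen_rank n (m + q) (X A' B')"
      using pair_rank_less[of "(A', B')" A B] P t ng by (auto simp: pair_ge_def)
    moreover have "gen_rank n (m + q) (Z J) < gen_rank n (m + q) (X A' B')"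
      using tuple_rank_mono(1)[OF t(5)] bJ by (simp add: less_Suc_eq_le trans_le_add2)
    ultimately have "cost n (m + q) {#X A' B', Z J'#} < cost n (m + q) {#X A B, Z J#}"
      using t(1) by (intro cost_exchange) (simp_all add: gens_iff)
    thus "\<exists>M. X_var (A', B') * Z_var J' = (gen_monom M :: (gen, 'k) mpoly) \<and> set_mset M \<subseteq> gens n m q
        \<and> cost n (m + q) M < cost n (m + q) {#X A B, Z J#}"
      using t(1,2) b' by (intro exI[of _ "{#X A' B', Z J'#}"]) (simp add: X_var_def Z_var_def
          gens_iff)
  qed
qed

lemma maximal_minor_reduces:
  fixes r :: "(gen, 'k::comm_ring_1) mpoly"
  assumes c: "c = Y \<and> H = H_u n m \<or> c = Z \<and> H = H_xi n q"
    and I: "I \<in> H" "I' \<in> H" and nc: "\<not> I \<succeq> I'" "\<not> I' \<succeq> I"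
    and r: "r \<in> straightenings n m q (Var (c I) * Var (c I')) (\<lambda>(L, L'). Var (c L) * Var (c L'))
      {(L, L'). L \<in> H \<and> L' \<in> H \<and> L \<succeq> I \<and> L \<succeq> I' \<and> I \<succeq> L' \<and> I' \<succeq> L'}"
  shows "reduces n m q (c I) (c I') r"
proof (rule straightening_reduces[OF r], clarify)
  fix L L' assume t: "L \<in> H" "L' \<in> H" "L \<succeq> I" "L \<succeq> I'" "I \<succeq> L'" "I' \<succeq> L'"
  have bound: "set K \<subseteq> {0..<m + q} \<and> length K = n" if "K \<in> H" for K
    using c that H_bounds(2,3) by blast
  have rank: "gen_rank n k (c K) = tuple_rank n k K" "charge (c K) = 1" for k K using c by auto
  have gen: "c K \<in> gens n m q" if "K \<in> H" for K using c that by (auto simp: gens_iff)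
  have "L \<noteq> I" "L \<noteq> I'" using nc t(3,4) by auto
  hence "cost n (m + q) {#c L, c L'#} < cost n (m + q) {#c I, c I'#}"
    using tuple_rank_mono(2)[OF t(3)] tuple_rank_mono(2)[OF t(4)] bound[OF I(1)] bound[OF I(2)]
    by (intro cost_exchange gen[OF t(1)]) (simp_all add: rank)
  thus "\<exists>M. Var (c L) * Var (c L') = (gen_monom M :: (gen, 'k) mpoly) \<and> set_mset M \<subseteq> gens n m q
      \<and> cost n (m + q) M < cost n (m + q) {#c I, c I'#}"
    using gen[OF t(1)] gen[OF t(2)] by (intro exI[of _ "{#c L, c L'#}"]) simp
qed

lemma R4_reduces:
  assumes P: "(A, B) \<in> H_p n m q" and Q: "(A', B') \<in> H_p n m q"
    and nc: "\<not> (A, B) \<succeq>\<^sub>p (A', B')" "\<not> (A', B') \<succeq>\<^sub>p (A, B)"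
    and r: "r \<in> R4 n m q (A, B) (A', B')"
  shows "reduces n m q (X A B) (X A' B') (r :: (gen, 'k::comm_ring_1) mpoly)"
proof -
  note b = H_bounds(1)[OF P] H_bounds(1)[OF Q]
  have lhs: "X_var (A, B) * X_var (A', B') = (Var (X A B) * Var (X A' B') :: (gen, 'k) mpoly)"
    using b by (simp add: X_var_def)
  show ?thesis
  proof (rule straightening_reduces[OF r[unfolded R4_def lhs]], goal_cases)
    case (1 t)
    then obtain C D1 D2 where t: "t = (C, (D1, D2))" "C \<in> H_p n m q \<or> C = ([], [])"
      "(D1, D2) \<in> H_p n m q" "C \<succeq>\<^sub>p (A, B)" "C \<succeq>\<^sub>p (A', B')" by auto
    have ne: "C \<noteq> (A, B)" "C \<noteq> (A', B')" using nc t(4,5) by auto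
    note rank = pair_rank_less[OF t(4) ne(1) P] pair_rank_less[OF t(5) ne(2) Q]
    have D: "X_var (D1, D2) = (Var (X D1 D2) :: (gen, 'k) mpoly)"
      using H_bounds(1)[OF t(3)] by (simp add: X_var_def)
    show ?case
    proof (cases "C = ([], [])")
      case True
      have "cost n (m + q) {#X D1 D2#} < cost n (m + q) {#X A B, X A' B'#}"
        using two_power_convex[OF rank, of "top_rank n (m + q)" "gen_rank n (m + q) (X D1 D2)"] True
        by (simp add: gen_cost_def top_rank_def)
      thus ?thesis using t(3) True D
        by (intro exI[of _ "{#X D1 D2#}"]) (simp add: t(1) X_var_def[of "([], [])"] gens_iff)
    next
      case False
      then obtain C1 C2 where C: "C = (C1, C2)" "(C1, C2) \<in> H_p n m q" using t(2) by (cases C) auto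
      have "cost n (m + q) {#X C1 C2, X D1 D2#} < cost n (m + q) {#X A B, X A' B'#}"
        using rank C by (intro cost_exchange) (simp_all add: gens_iff)
      thus ?thesis using t(3) C D H_bounds(1)[OF C(2)]
        by (intro exI[of _ "{#X C1 C2, X D1 D2#}"]) (simp add: t(1) X_var_def[of "(C1, C2)"]
            gens_iff)
    qed
  qed
qed

lemma R1_reduces:
  assumes I: "I \<in> H_u n m" and J: "J \<in> H_xi n q" and n: "1 \<le> n" and r: "r \<in> R1 I J"
  shows "reduces n m q (Y I) (Z J) (r :: (gen, 'k::comm_ring_1) mpoly)"
proof -
  have H: "(I, J) \<in> H_p n m q" using I J n by (auto simp: H_u_def H_xi_def intro!: H_pI)
  hence X: "X_var (I, J) = (Var (X I J) :: (gen, 'k) mpoly)"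
    using H_bounds(1)[OF H] by (simp add: X_var_def)
  have "gen_cost n (m + q) (X I J) < 2 ^ top_rank n (m + q)" by (simp add: gen_cost_def)
  moreover have "2 ^ top_rank n (m + q) \<le> gen_cost n (m + q) (Y I)" by (simp add: gen_cost_def)
  ultimately have "{#X I J#} \<in> {M. set_mset M \<subseteq> gens n m q
      \<and> cost n (m + q) M < cost n (m + q) {#Y I, Z J#}}" using H by (simp add: gens_iff)
  note comb_base[OF this, of "\<lambda>M _. gen_monom M"]
  moreover have "Var (Y I) * Var (Z J) - r = gen_monom {#X I J#}"
    using r X by (simp add: R1_def Y_var_def Z_var_def)
  ultimately show ?thesis unfolding reduces_def by simp
qed

lemma incomparable_reduces:
  assumes n: "1 \<le> n" and G: "relation_system n m q (G :: (gen, 'k::comm_ring_1) mpoly set)"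
    and g: "g \<in> gens n m q" and h: "h \<in> gens n m q" and nc: "\<not> comparable g h"
  shows "\<exists>r\<in>G. reduces n m q g h r"
proof -
  have meet: "\<exists>r\<in>G. r \<in> R" if "R \<in> relation_sets n m q" for R
    using G that by (auto simp: relation_system_def)
  have R1: "\<exists>r\<in>G. reduces n m q (Y I) (Z J) r" if "I \<in> H_u n m" "J \<in> H_xi n q" for I J
    using meet[of "R1 I J"] R1_reduces[OF that n] that unfolding relation_sets_def by blast
  have R5: "\<exists>r\<in>G. reduces n m q (X A B) (Y I) r" if "(A, B) \<in> H_p n m q" "I \<in> H_u n m"
      "\<not> A \<succeq> I" for A B I
  proof -
    have "R5 n m q (A, B) I \<in> relation_sets n m q" unfolding relation_sets_def using that by force
    thus ?thesis using meet R5_reduces[OF that] by blast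
  qed
  have R6: "\<exists>r\<in>G. reduces n m q (X A B) (Z J) r" if "(A, B) \<in> H_p n m q" "J \<in> H_xi n q"
      "\<not> B \<succeq> J" for A B J
  proof -
    have "R6 n m q (A, B) J \<in> relation_sets n m q" unfolding relation_sets_def using that by force
    thus ?thesis using meet R6_reduces[OF that] by blast
  qed
  have R2: "\<exists>r\<in>G. reduces n m q (Y I) (Y I') r"
    if "I \<in> H_u n m" "I' \<in> H_u n m" "\<not> I \<succeq> I'" "\<not> I' \<succeq> I" for I I'
    using meet[of "R2 n m q I I'"] maximal_minor_reduces[of Y "H_u n m", OF _ that] that
    unfolding relation_sets_def R2_def Y_var_def by blast
  have R3: "\<exists>r\<in>G. reduces n m q (Z J) (Z J') r"
    if "J \<in> H_xi n q" "J' \<in> H_xi n q" "\<not> J \<succeq> J'" "\<not> J' \<succeq> J" for J J'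
    using meet[of "R3 n m q J J'"] maximal_minor_reduces[of Z "H_xi n q", OF _ that] that
    unfolding relation_sets_def R3_def Z_var_def by blast
  have R4: "\<exists>r\<in>G. reduces n m q (X A B) (X A' B') r"
    if "(A, B) \<in> H_p n m q" "(A', B') \<in> H_p n m q"
      "\<not> (A, B) \<succeq>\<^sub>p (A', B')" "\<not> (A', B') \<succeq>\<^sub>p (A, B)" for A B A' B'
    using meet[of "R4 n m q (A, B) (A', B')"] R4_reduces[OF that] that unfolding relation_sets_def
        by blast
  have R1': "\<exists>r\<in>G. reduces n m q (Z J) (Y I) r" if "I \<in> H_u n m" "J \<in> H_xi n q" for I J
    using R1[OF that] reduces_commute by blast
  have R5': "\<exists>r\<in>G. reduces n m q (Y I) (X A B) r" if "(A, B) \<in> H_p n m q" "I \<in> H_u n m"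
      "\<not> A \<succeq> I" for A B I
    using R5[OF that] reduces_commute by blast
  have R6': "\<exists>r\<in>G. reduces n m q (Z J) (X A B) r" if "(A, B) \<in> H_p n m q" "J \<in> H_xi n q"
      "\<not> B \<succeq> J" for A B J
    using R6[OF that] reduces_commute by blast
  show ?thesis
    using g h nc R1 R1' R2 R3 R4 R5 R5' R6 R6'
    by (cases g; cases h) (simp_all add: gens_iff)
qed

section \<open>The kernel\<close>

lemma mon_subst_Var:
  fixes e :: "'x \<Rightarrow>\<^sub>0 nat"
  shows "mon_subst Var e = single e (1 :: 'a::comm_ring_1)"
proof -
  have pow: "Var x ^ k = (single (single x k) 1 :: ('x, 'a) mpoly)" for x :: 'x and k
    by (induction k) (auto simp: Var_def mult_single single_add[symmetric])
  have "(\<Prod>x\<in>S. Var x ^ f x) = (single (\<Sum>x\<in>S. single x (f x)) 1 :: ('x, 'a) mpoly)"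
    for S and f :: "'x \<Rightarrow> nat"
    by (induction S rule: infinite_finite_induct) (auto simp: pow mult_single)
  hence "mon_subst Var e = (single
      (\<Sum>x\<in>keys e. single x (lookup e x)) 1 :: ('x, 'a) mpoly)"
    by (simp only: mon_subst_def)
  thus ?thesis by (simp only: sum_of_monomials[of e, symmetric])
qed

lemma poly_expansion:
  fixes F :: "(gen, 'a::comm_ring_1) mpoly"
  shows "F = (\<Sum>e\<in>keys F. Const (lookup F e)
    * gen_monom (\<Sum>x\<in>keys e. replicate_mset (lookup e x) x))"
proof -
  have rep: "gen_monom (replicate_mset k x) = (Var x ^ k :: (gen, 'a) mpoly)" for x k
    by (induction k) auto
  have "gen_monom (\<Sum>x\<in>S. replicate_mset (f x) x) = (\<Prod>x\<in>S. Var x ^ f x :: (gen, 'a) mpoly)"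
    for S and f :: "gen \<Rightarrow> nat"
    by (induction S rule: infinite_finite_induct) (auto simp: rep)
  hence "gen_monom (\<Sum>x\<in>keys e. replicate_mset (lookup e x) x)
      = (single e 1 :: (gen, 'a) mpoly)" for e
    unfolding mon_subst_Var[symmetric] mon_subst_def .
  thus ?thesis using sum_of_monomials[of F] by (simp add: Const_def mult_single)
qed

text \<open>The polynomials that are congruent modulo \<open>I\<close> to a combination of standard monomials.\<close>

definition standard_span ::
    "nat \<Rightarrow> nat \<Rightarrow> nat \<Rightarrow> (gen, 'k::comm_ring_1) mpoly set \<Rightarrow> (gen, 'k) mpoly set" where
  "standard_span n m q I = {F. \<exists>H\<in>I. (\<lambda>_ :: unit. F - H) \<in> comb (\<lambda>M _. gen_monom M)
     {M. standard M \<and> set_mset M \<subseteq> gens n m q}}"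

lemma ideal_gen_ring:
  assumes "ideal I (gen_ring n m q :: (gen, 'k::comm_ring_1) mpoly ring)"
  shows "0 \<in> I" and "F \<in> I \<Longrightarrow> F' \<in> I \<Longrightarrow> F + F' \<in> I" and "F \<in> I \<Longrightarrow> vars G \<subseteq> gens n m q \<Longrightarrow> G * F \<in> I"
proof -
  interpret ideal I "gen_ring n m q" by (rule assms)
  show "0 \<in> I" using additive_subgroup.zero_closed[OF is_additive_subgroup]
      by (simp add: gen_ring_def)
  show "F \<in> I \<Longrightarrow> F' \<in> I \<Longrightarrow> F + F' \<in> I" 
    using additive_subgroup.a_closed[OF is_additive_subgroup, of F F'] by (simp add: gen_ring_def)
  show "F \<in> I \<Longrightarrow> vars G \<subseteq> gens n m q \<Longrightarrow> G * F \<in> I"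
    using I_l_closed[of F G] by (simp add: gen_ring_def)
qed

lemma standard_span_closed:
  assumes I: "ideal I (gen_ring n m q :: (gen, 'k::comm_ring_1) mpoly ring)"
  shows "F \<in> I \<Longrightarrow> F \<in> standard_span n m q I"
    and "F \<in> standard_span n m q I \<Longrightarrow> F' \<in> standard_span n m q I \<Longrightarrow> F + F' \<in> standard_span n m q I"
    and "F \<in> standard_span n m q I \<Longrightarrow> Const c * F \<in> standard_span n m q I"
proof -
  let ?C = "comb (\<lambda>M (_ :: unit). gen_monom M :: (gen, 'k) mpoly) {M. standard M \<and> set_mset M
      \<subseteq> gens n m q}"
  note cl = ideal_gen_ring[OF I]
  show "F \<in> I \<Longrightarrow> F \<in> standard_span n m q I"
    unfolding standard_span_def by (auto intro!: bexI[of _ F] comb.zero)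
  show "F + F' \<in> standard_span n m q I" if F: "F \<in> standard_span n m q I" and F': "F'
      \<in> standard_span n m q I"
  proof -
    obtain H where H: "H \<in> I" "(\<lambda>_. F - H) \<in> ?C"
      using F unfolding standard_span_def by blast
    obtain H' where H': "H' \<in> I" "(\<lambda>_. F' - H') \<in> ?C"
      using F' unfolding standard_span_def by blast
    have "(\<lambda>_. (F - H) + (F' - H')) \<in> ?C" by (rule comb_add[OF H(2) H'(2)])
    moreover have "(F - H) + (F' - H') = F + F' - (H + H')" by simp
    ultimately show ?thesis unfolding standard_span_def using cl(2)[OF H(1) H'(1)] by auto
  qed
  show "Const c * F \<in> standard_span n m q I" if F: "F \<in> standard_span n m q I"
  proof -
    obtain H where H: "H \<in> I" "(\<lambda>_. F - H) \<in> ?C" using F unfolding standard_span_def by blast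
    have "(\<lambda>_. Const c * (F - H)) \<in> ?C" by (rule comb_scale[OF H(2)])
    hence "(\<lambda>_. Const c * F - Const c * H) \<in> ?C" by (simp add: right_diff_distrib)
    moreover have "Const c * H \<in> I" using cl(3)[OF H(1), of "Const c"] by simp
    ultimately show ?thesis unfolding standard_span_def by blast
  qed
qed

text \<open>Two incomparable factors of a monomial can be replaced by means of a relation, which
lowers the cost.\<close>

lemma gen_monom_in_standard_span:
  assumes n: "1 \<le> n" and G: "relation_system n m q (G :: (gen, 'k::comm_ring_1) mpoly set)"
    and I: "ideal I (gen_ring n m q)" and GI: "G \<subseteq> I"
    and M: "set_mset M \<subseteq> gens n m q"
  shows "gen_monom M \<in> standard_span n m q I"
  using M
proof (induction "cost n (m + q) M" arbitrary: M rule: less_induct)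
  case less
  show ?case
  proof (cases "standard M")
    case True
    have "(\<lambda>_ :: unit. gen_monom M - 0 :: (gen, 'k) mpoly) \<in> comb (\<lambda>M _. gen_monom M)
        {M. standard M \<and> set_mset M \<subseteq> gens n m q}"
      using comb_base[of M "{M. standard M \<and> set_mset M \<subseteq> gens n m q}" "\<lambda>M _. gen_monom M"]
        True less.prems by simp
    thus ?thesis unfolding standard_span_def using ideal_gen_ring(1)[OF I] by blast
  next
    case False
    then obtain g h where gh: "g \<in># M" "h \<in># M" "\<not> comparable g h" by (auto simp: standard_def)
    have "g \<noteq> h" using gh(3) by (cases g) (auto simp: pair_ge_def)
    then obtain N where N: "M = add_mset g (add_mset h N)"
      using gh(1,2) by (metis insert_DiffM insert_noteq_member)
    obtain r where r: "r \<in> G" "reduces n m q g h r"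
      using incomparable_reduces[OF n G _ _ gh(3)] less.prems gh(1,2) by blast
    have "f \<in> comb (\<lambda>M' _. gen_monom M') D \<Longrightarrow> (\<And>M'. M' \<in> D \<Longrightarrow> gen_monom (N + M')
        \<in> standard_span n m q I)
        \<Longrightarrow> gen_monom N * f () \<in> standard_span n m q I" for f :: "unit \<Rightarrow> (gen, 'k) mpoly" and D
    proof (induction rule: comb.induct)
      case zero
      show ?case using standard_span_closed(1)[OF I ideal_gen_ring(1)[OF I]] by simp
    next
      case (step M' f c)
      have "gen_monom N * (Const c * gen_monom M' + f ())
          = Const c * gen_monom (N + M') + gen_monom N * f ()"
              by (simp add: distrib_left mult.left_commute)
      thus ?case using standard_span_closed(2,3)[OF I] step by simp
    qed
    note mult = this
    have "gen_monom (N + M') \<in> standard_span n m q I"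
      if "M' \<in> {M'. set_mset M' \<subseteq> gens n m q \<and> cost n (m + q) M' < cost n (m + q) {#g, h#}}" for M'
    proof (rule less.hyps)
      show "cost n (m + q) (N + M') < cost n (m + q) M" using that by (simp add: N)
      show "set_mset (N + M') \<subseteq> gens n m q" using that less.prems by (simp add: N)
    qed
    from mult[OF r(2)[unfolded reduces_def] this]
    have "gen_monom N * (Var g * Var h - r) \<in> standard_span n m q I" .
    moreover have "gen_monom N * r \<in> standard_span n m q I"
      using r(1) GI less.prems
      by (intro standard_span_closed(1)[OF I] ideal_gen_ring(3)[OF I] vars_gen_monom) (auto simp: N)
    moreover have "gen_monom M = gen_monom N * (Var g * Var h - r) + gen_monom N * r"
      by (simp add: N algebra_simps)
    ultimately show ?thesis using standard_span_closed(2)[OF I] by metis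
  qed
qed

lemma carrier_subset_standard_span:
  assumes n: "1 \<le> n" and G: "relation_system n m q (G :: (gen, 'k::comm_ring_1) mpoly set)"
    and I: "ideal I (gen_ring n m q)" and GI: "G \<subseteq> I" and F: "vars F \<subseteq> gens n m q"
  shows "F \<in> standard_span n m q I"
proof -
  have sum: "sum f S \<in> standard_span n m q I" if "\<And>e. e \<in> S \<Longrightarrow> f e \<in> standard_span n m q I"
    for f :: "(gen \<Rightarrow>\<^sub>0 nat) \<Rightarrow> (gen, 'k) mpoly" and S
    using that standard_span_closed(1)[OF I ideal_gen_ring(1)[OF I]] standard_span_closed(2)[OF I]
    by (induction S rule: infinite_finite_induct) auto
  show ?thesis
  proof (subst poly_expansion, rule sum, rule standard_span_closed(3)[OF I],
      rule gen_monom_in_standard_span[OF n G I GI])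
    fix e assume "e \<in> keys F"
    hence "keys e \<subseteq> gens n m q" using F by (auto simp: vars_def)
    thus "set_mset (\<Sum>x\<in>keys e. replicate_mset (lookup e x) x) \<subseteq> gens n m q"
      by (auto simp: set_mset_sum split: if_splits)
  qed
qed

lemma kernel_subset_ideal:
  assumes n: "1 \<le> n" and G: "relation_system n m q (G :: (gen, 'k::comm_ring_1) mpoly set)"
    and I: "ideal I (gen_ring n m q)" and GI: "G \<subseteq> I"
    and IK: "\<And>H. H \<in> I \<Longrightarrow> pres_map n m q H = 0"
    and F: "vars F \<subseteq> gens n m q" "pres_map n m q F = 0"
  shows "F \<in> I"
proof -
  obtain H where H: "H \<in> I" "(\<lambda>_ :: unit. F - H) \<in> comb (\<lambda>M _. gen_monom M)
     {M. standard M \<and> set_mset M \<subseteq> gens n m q}"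
    using carrier_subset_standard_span[OF n G I GI F(1)] unfolding standard_span_def by blast
  obtain T c where T: "finite T" "T \<subseteq> {M. standard M \<and> set_mset M \<subseteq> gens n m q}" "\<forall>M\<in>T. c M \<noteq> 0"
    "F - H = (\<Sum>M\<in>T. Const (c M) * gen_monom M)"
    using comb_explicit[OF H(2)] by blast
  have "(\<Sum>M\<in>T. Const (c M) * (\<Prod>g\<in>#M. gen_fun n m q g)) = pres_map n m q (F - H)"
    unfolding T(4) by (simp add: pres_map_simps pres_map_gen_monom)
  also have "\<dots> = 0" using F(2) IK[OF H(1)] by (simp add: pres_map_simps)
  finally have zero: "(\<Sum>M\<in>T. Const (c M) * (\<Prod>g\<in>#M. gen_fun n m q g)) = 0" .
  have "c M = 0" if "M \<in> T" for M
    by (rule standard_independent[OF n T(1), where f = "\<lambda>M. M"]) (use T(2) zero that in auto)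
  hence "T = {}" using T(3) by blast
  thus ?thesis using T(4) H(1) by simp
qed

lemma presentation_kernel:
  assumes n: "1 \<le> n" and G: "relation_system n m q (G :: (gen, 'k::comm_ring_1) mpoly set)"
  shows "{F. vars F \<subseteq> gens n m q \<and> pres_map n m q F = 0} = Idl\<^bsub>gen_ring n m q\<^esub> G" (is "?K = _")
proof
  interpret cring "gen_ring n m q :: (gen, 'k) mpoly ring"
    unfolding gen_ring_def by (rule cring_poly_ring)
  have GK: "G \<subseteq> ?K" using G relations_in_kernel[OF n] unfolding relation_system_def by blast
  have Gc: "G \<subseteq> carrier (gen_ring n m q)" using GK by (auto simp: gen_ring_def)
  show le: "Idl\<^bsub>gen_ring n m q\<^esub> G \<subseteq> ?K"
    by (rule genideal_minimal[OF pres_map_kernel_ideal GK])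
  show "?K \<subseteq> Idl\<^bsub>gen_ring n m q\<^esub> G"
  proof
    fix F assume "F \<in> ?K"
    thus "F \<in> Idl\<^bsub>gen_ring n m q\<^esub> G"
      using kernel_subset_ideal[OF n G genideal_ideal[OF Gc] genideal_self[OF Gc]] le by auto
  qed
qed

theorem theorem4p5p5:
  fixes n m q :: nat
  assumes "n \<ge> 1" and "m > n" and "q > n"
  shows "(pres_map n m q :: (gen, 'k::alg_closed_field) mpoly \<Rightarrow> (coord, 'k) mpoly)
           \<in> ring_hom (gen_ring n m q) (S_alg n m q)
    \<and> (pres_map n m q :: (gen, 'k) mpoly \<Rightarrow> (coord, 'k) mpoly) ` carrier (gen_ring n m q)
        = carrier (S_alg n m q)
    \<and> (\<exists>G :: (gen, 'k) mpoly set. relation_system n m q G)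
    \<and> (\<forall>G :: (gen, 'k) mpoly set. relation_system n m q G \<longrightarrow>
         a_kernel (gen_ring n m q) (S_alg n m q) (pres_map n m q) = Idl\<^bsub>gen_ring n m q\<^esub> G)"
proof (intro conjI allI impI)
  have q: "1 \<le> q" using assms by simp
  show "\<exists>G :: (gen, 'k) mpoly set. relation_system n m q G"
    using relation_system_exists[OF assms(1) q] by blast
  fix G :: "(gen, 'k) mpoly set" assume "relation_system n m q G"
  thus "a_kernel (gen_ring n m q) (S_alg n m q) (pres_map n m q) = Idl\<^bsub>gen_ring n m q\<^esub> G"
    unfolding pres_map_kernel by (rule presentation_kernel[OF assms(1)])
qed (rule pres_map_ring_hom pres_map_image)+

end
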